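(* Let $(M^n,g)$ be a Walker manifold of dimension $n$ and rank $r$, with null parallel distribution $\mathcal{D}$. The Walker foliation $\mathcal{F}_{\mathcal{D}}$ has abelian model group $G\cong\mathbb{R}^r$ if and only if the parallel vector fields $X_1,\dots,X_r$ spanning $\mathcal{D}$ pairwise commute, i.e., if and only if the structure algebra $\mathfrak{g}_{\mathcal{D}}$ is abelian. This is automatically the case when $r=1$, i.e., for all Walker $3$-manifolds.
   Context: A pseudo-Riemannian manifold $(M^n,g)$ with Levi-Civita connection $\nabla$ is a Walker manifold of rank $r$ if there is a distribution $\mathcal{D}\subset TM$ of rank $r\le n/2$ which is parallel ($\nabla_XY\in\Gamma(\mathcal{D})$ for all $X\in\Gamma(TM)$, $Y\in\Gamma(\mathcal{D})$) and totally isotropic ($g(Y,Z)=0$ for all $Y,Z\in\Gamma(\mathcal{D})$). It is involutive; the foliation $\mathcal{F}_{\mathcal{D}}$ tangent to it is the Walker foliation. Structure algebra: the paper takes it that, since $\mathcal{D}$ is parallel, there is locally a basis $\{X_1,\dots,X_r\}$ of parallel sections of $\mathcal{D}$ ($\nabla_ZX_i=0$ for all $Z$); then $[X_i,X_j]=\sum_kc^k_{ij}X_k$ with real constants $c^k_{ij}$, and $\mathfrak{g}_{\mathcal{D}}$ is the Lie algebra on $\mathrm{Span}_{\mathbb{R}}\{X_1,\dots,X_r\}$ with this bracket. The model group $G$ of $\mathcal{F}_{\mathcal{D}}$ is the simply connected Lie group with Lie algebra $\mathfrak{g}_{\mathcal{D}}$. Walker $3$-manifolds are Walker manifolds with $n=3$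 (hence $r=1$). *)

theory Defs
  imports "HOL-Analysis.Analysis" "HOL-Algebra.Group"
begin

section \<open>Smooth maps between Euclidean spaces\<close>

text \<open>Used for open \<open>S\<close> only, so that the Frechet derivative at a point of \<open>S\<close> is unique and
  does not depend on the values outside \<open>S\<close>.\<close>

primrec Ck_on :: "nat \<Rightarrow> 'e::euclidean_space set \<Rightarrow> ('e \<Rightarrow> 'f::real_normed_vector) \<Rightarrow> bool" where
  "Ck_on 0 S f \<longleftrightarrow> continuous_on S f"
| "Ck_on (Suc k) S f \<longleftrightarrow>
     (\<forall>x\<in>S. f differentiable (at x)) \<and>
     (\<forall>v. Ck_on k S (\<lambda>x. frechet_derivative f (at x) v))"

definition smooth_on :: "'e::euclidean_space set \<Rightarrow> ('e \<Rightarrow> 'f::real_normed_vector) \<Rightarrow> bool" where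
  "smooth_on S f \<longleftrightarrow> (\<forall>k. Ck_on k S f)"

section \<open>Smooth manifolds\<close>

text \<open>A manifold is given by an atlas on an open subset of a Hausdorff, second countable
  topological space; a chart is a pair of its (open) domain and its coordinate map. The atlas
  need not be maximal.\<close>

type_synonym ('a, 'e) atlas = "('a set \<times> ('a \<Rightarrow> 'e)) set"

definition mcarrier :: "('a, 'e) atlas \<Rightarrow> 'a set" where
  "mcarrier A = (\<Union>(U, \<phi>)\<in>A. U)"

definition smooth_atlas ::
  "('a::{t2_space, second_countable_topology}, 'e::euclidean_space) atlas \<Rightarrow> bool" where
  "smooth_atlas A \<longleftrightarrow>
     (\<forall>(U, \<phi>)\<in>A. open U \<and> open (\<phi> ` U) \<and> homeomorphism U (\<phi> ` U) \<phi> (inv_into U \<phi>)) \<and>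
     (\<forall>(U, \<phi>)\<in>A. \<forall>(V, \<psi>)\<in>A. smooth_on (\<phi> ` (U \<inter> V)) (\<psi> \<circ> inv_into U \<phi>))"

definition product_atlas ::
  "('a, 'e) atlas \<Rightarrow> ('b, 'f) atlas \<Rightarrow> ('a \<times> 'b, 'e \<times> 'f) atlas" where
  "product_atlas A B = (\<lambda>((U, \<phi>), (V, \<psi>)). (U \<times> V, map_prod \<phi> \<psi>)) ` (A \<times> B)"

definition smooth_map ::
  "('a::topological_space, 'e::euclidean_space) atlas \<Rightarrow>
   ('b::topological_space, 'f::euclidean_space) atlas \<Rightarrow> ('a \<Rightarrow> 'b) \<Rightarrow> bool" where
  "smooth_map A B F \<longleftrightarrow>
     F ` mcarrier A \<subseteq> mcarrier B \<and> continuous_on (mcarrier A) F \<and>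
     (\<forall>(U, \<phi>)\<in>A. \<forall>(V, \<psi>)\<in>B. smooth_on (\<phi> ` (U \<inter> F -` V)) (\<psi> \<circ> F \<circ> inv_into U \<phi>))"

text \<open>Smooth real functions on an open subset \<open>W\<close> of the manifold, and near a point. Functions
  are total; their values outside \<open>W\<close> are irrelevant.\<close>

definition smooth_fun ::
  "('a, 'e::euclidean_space) atlas \<Rightarrow> 'a set \<Rightarrow> ('a \<Rightarrow> real) \<Rightarrow> bool" where
  "smooth_fun A W f \<longleftrightarrow> (\<forall>(U, \<phi>)\<in>A. smooth_on (\<phi> ` (U \<inter> W)) (f \<circ> inv_into U \<phi>))"

definition smooth_at ::
  "('a::topological_space, 'e::euclidean_space) atlas \<Rightarrow> 'a \<Rightarrow> ('a \<Rightarrow> real) \<Rightarrow> bool" where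
  "smooth_at A p f \<longleftrightarrow> (\<exists>W. open W \<and> p \<in> W \<and> W \<subseteq> mcarrier A \<and> smooth_fun A W f)"

section \<open>Tangent vectors and vector fields\<close>

text \<open>Tangent vectors at \<open>p\<close> are derivations at \<open>p\<close> of the functions that are smooth near \<open>p\<close>.
  Locality need not be required: if \<open>f = g\<close> on an open set \<open>W\<close> around \<open>p\<close>, then
  \<open>(f - g) * indicator W = 0\<close>, and the Leibniz rule yields \<open>v f = v g\<close>. The last clause only
  normalises \<open>v\<close> outside its domain of definition, so that equal tangent vectors are equal as
  HOL functions.\<close>

type_synonym 'a tvec = "('a \<Rightarrow> real) \<Rightarrow> real"
type_synonym 'a vfield = "'a \<Rightarrow> 'a tvec"

definition tangent_space ::
  "('a::topological_space, 'e::euclidean_space) atlas \<Rightarrow> 'a \<Rightarrow> 'a tvec set" where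
  "tangent_space A p = {v.
     (\<forall>f h. smooth_at A p f \<and> smooth_at A p h \<longrightarrow>
        v (\<lambda>q. f q + h q) = v f + v h \<and>
        v (\<lambda>q. f q * h q) = v f * h p + f p * v h) \<and>
     (\<forall>c f. smooth_at A p f \<longrightarrow> v (\<lambda>q. c * f q) = c * v f) \<and>
     (\<forall>f. \<not> smooth_at A p f \<longrightarrow> v f = 0)}"

definition smooth_vfield ::
  "('a::topological_space, 'e::euclidean_space) atlas \<Rightarrow> 'a set \<Rightarrow> 'a vfield \<Rightarrow> bool" where
  "smooth_vfield A W X \<longleftrightarrow>
     (\<forall>p\<in>W. X p \<in> tangent_space A p) \<and>
     (\<forall>V f. open V \<and> V \<subseteq> W \<and> smooth_fun A V f \<longrightarrow> smooth_fun A V (\<lambda>p. X p f))"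

definition lie_bracket ::
  "('a::topological_space, 'e::euclidean_space) atlas \<Rightarrow> 'a vfield \<Rightarrow> 'a vfield \<Rightarrow> 'a vfield" where
  "lie_bracket A X Y = (\<lambda>p f. if smooth_at A p f
     then X p (\<lambda>q. Y q f) - Y p (\<lambda>q. X q f) else 0)"

definition lincomb :: "nat \<Rightarrow> (nat \<Rightarrow> real) \<Rightarrow> (nat \<Rightarrow> 'a tvec) \<Rightarrow> 'a tvec" where
  "lincomb r a e = (\<lambda>f. \<Sum>i<r. a i * e i f)"

definition is_basis :: "nat \<Rightarrow> 'a tvec set \<Rightarrow> (nat \<Rightarrow> 'a tvec) \<Rightarrow> bool" where
  "is_basis r S e \<longleftrightarrow>
     S = {lincomb r a e |a. True} \<and>
     (\<forall>a. lincomb r a e = (\<lambda>f. 0) \<longrightarrow> (\<forall>i<r. a i = 0))"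

section \<open>Pseudo-Riemannian metrics and the Levi-Civita connection\<close>

definition pseudo_riemannian_metric ::
  "('a::topological_space, 'e::euclidean_space) atlas \<Rightarrow> ('a \<Rightarrow> 'a tvec \<Rightarrow> 'a tvec \<Rightarrow> real) \<Rightarrow> bool"
where
  "pseudo_riemannian_metric A g \<longleftrightarrow>
     (\<forall>p\<in>mcarrier A.
        (\<forall>u\<in>tangent_space A p. \<forall>v\<in>tangent_space A p. g p u v = g p v u) \<and>
        (\<forall>u\<in>tangent_space A p. \<forall>v\<in>tangent_space A p. \<forall>w\<in>tangent_space A p. \<forall>a b.
           g p (\<lambda>f. a * u f + b * v f) w = a * g p u w + b * g p v w) \<and>
        (\<forall>u\<in>tangent_space A p. (\<forall>v\<in>tangent_space A p. g p u v = 0) \<longrightarrow> u = (\<lambda>f. 0))) \<and>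
     (\<forall>W X Y. open W \<and> W \<subseteq> mcarrier A \<and> smooth_vfield A W X \<and> smooth_vfield A W Y \<longrightarrow>
        smooth_fun A W (\<lambda>p. g p (X p) (Y p)))"

text \<open>A connection acts on vector fields over arbitrary open subsets \<open>W\<close> of the manifold, as
  needed for local parallel sections. As for tangent vectors, the Leibniz rule for functions
  smooth on \<open>W\<close> (in particular the indicator function of \<open>W\<close>) forces \<open>nabla X Y\<close> on \<open>W\<close> to
  depend on \<open>X\<close> and \<open>Y\<close> on \<open>W\<close> only.\<close>

definition affine_connection ::
  "('a::topological_space, 'e::euclidean_space) atlas \<Rightarrow>
   ('a vfield \<Rightarrow> 'a vfield \<Rightarrow> 'a vfield) \<Rightarrow> bool" where
  "affine_connection A nabla \<longleftrightarrow>
     (\<forall>W X Y. open W \<and> W \<subseteq> mcarrier A \<and> smooth_vfield A W X \<and> smooth_vfield A W Y \<longrightarrow>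
        smooth_vfield A W (nabla X Y) \<and>
        (\<forall>Z. smooth_vfield A W Z \<longrightarrow> (\<forall>p\<in>W.
           nabla (\<lambda>q h. X q h + Z q h) Y p = (\<lambda>h. nabla X Y p h + nabla Z Y p h) \<and>
           nabla X (\<lambda>q h. Y q h + Z q h) p = (\<lambda>h. nabla X Y p h + nabla X Z p h))) \<and>
        (\<forall>f. smooth_fun A W f \<longrightarrow> (\<forall>p\<in>W.
           nabla (\<lambda>q h. f q * X q h) Y p = (\<lambda>h. f p * nabla X Y p h) \<and>
           nabla X (\<lambda>q h. f q * Y q h) p = (\<lambda>h. X p f * Y p h + f p * nabla X Y p h))))"

definition levi_civita_connection ::
  "('a::topological_space, 'e::euclidean_space) atlas \<Rightarrow> ('a \<Rightarrow> 'a tvec \<Rightarrow> 'a tvec \<Rightarrow> real) \<Rightarrow>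
   ('a vfield \<Rightarrow> 'a vfield \<Rightarrow> 'a vfield) \<Rightarrow> bool" where
  "levi_civita_connection A g nabla \<longleftrightarrow>
     affine_connection A nabla \<and>
     (\<forall>W X Y. open W \<and> W \<subseteq> mcarrier A \<and> smooth_vfield A W X \<and> smooth_vfield A W Y \<longrightarrow>
        (\<forall>p\<in>W. (\<lambda>h. nabla X Y p h - nabla Y X p h) = lie_bracket A X Y p) \<and>
        (\<forall>Z. smooth_vfield A W Z \<longrightarrow> (\<forall>p\<in>W.
           X p (\<lambda>q. g q (Y q) (Z q)) = g p (nabla X Y p) (Z p) + g p (Y p) (nabla X Z p))))"

section \<open>Walker manifolds\<close>

definition distribution_of_rank ::
  "('a::topological_space, 'e::euclidean_space) atlas \<Rightarrow> nat \<Rightarrow> ('a \<Rightarrow> 'a tvec set) \<Rightarrow> bool" where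
  "distribution_of_rank A r D \<longleftrightarrow>
     (\<forall>p\<in>mcarrier A. D p \<subseteq> tangent_space A p) \<and>
     (\<forall>p\<in>mcarrier A. \<exists>W Y. open W \<and> p \<in> W \<and> W \<subseteq> mcarrier A \<and>
        (\<forall>i<r. smooth_vfield A W (Y i)) \<and> (\<forall>q\<in>W. is_basis r (D q) (\<lambda>i. Y i q)))"

definition smooth_section ::
  "('a::topological_space, 'e::euclidean_space) atlas \<Rightarrow> ('a \<Rightarrow> 'a tvec set) \<Rightarrow> 'a set \<Rightarrow>
   'a vfield \<Rightarrow> bool" where
  "smooth_section A D W Y \<longleftrightarrow> smooth_vfield A W Y \<and> (\<forall>p\<in>W. Y p \<in> D p)"

definition parallel_distribution ::
  "('a::topological_space, 'e::euclidean_space) atlas \<Rightarrow>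
   ('a vfield \<Rightarrow> 'a vfield \<Rightarrow> 'a vfield) \<Rightarrow> ('a \<Rightarrow> 'a tvec set) \<Rightarrow> bool" where
  "parallel_distribution A nabla D \<longleftrightarrow>
     (\<forall>X Y. smooth_vfield A (mcarrier A) X \<and> smooth_section A D (mcarrier A) Y \<longrightarrow>
        smooth_section A D (mcarrier A) (nabla X Y))"

definition totally_isotropic ::
  "('a::topological_space, 'e::euclidean_space) atlas \<Rightarrow> ('a \<Rightarrow> 'a tvec \<Rightarrow> 'a tvec \<Rightarrow> real) \<Rightarrow>
   ('a \<Rightarrow> 'a tvec set) \<Rightarrow> bool" where
  "totally_isotropic A g D \<longleftrightarrow>
     (\<forall>Y Z. smooth_section A D (mcarrier A) Y \<and> smooth_section A D (mcarrier A) Z \<longrightarrow>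
        (\<forall>p\<in>mcarrier A. g p (Y p) (Z p) = 0))"

definition walker_manifold ::
  "('a::{t2_space, second_countable_topology}, real ^ 'n) atlas \<Rightarrow>
   ('a \<Rightarrow> 'a tvec \<Rightarrow> 'a tvec \<Rightarrow> real) \<Rightarrow> ('a vfield \<Rightarrow> 'a vfield \<Rightarrow> 'a vfield) \<Rightarrow> nat \<Rightarrow>
   ('a \<Rightarrow> 'a tvec set) \<Rightarrow> bool" where
  "walker_manifold A g nabla r D \<longleftrightarrow>
     smooth_atlas A \<and> pseudo_riemannian_metric A g \<and> levi_civita_connection A g nabla \<and>
     1 \<le> r \<and> 2 * r \<le> CARD('n) \<and> distribution_of_rank A r D \<and>
     parallel_distribution A nabla D \<and> totally_isotropic A g D"

text \<open>A basis \<open>X 0, \<dots>, X (r - 1)\<close> of parallel sections of \<open>D\<close> over the open set \<open>U\<close>.\<close>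

definition parallel_basis ::
  "('a::topological_space, 'e::euclidean_space) atlas \<Rightarrow>
   ('a vfield \<Rightarrow> 'a vfield \<Rightarrow> 'a vfield) \<Rightarrow> nat \<Rightarrow> ('a \<Rightarrow> 'a tvec set) \<Rightarrow> 'a set \<Rightarrow>
   (nat \<Rightarrow> 'a vfield) \<Rightarrow> bool" where
  "parallel_basis A nabla r D U X \<longleftrightarrow>
     (\<forall>i<r. smooth_section A D U (X i)) \<and>
     (\<forall>p\<in>U. is_basis r (D p) (\<lambda>i. X i p)) \<and>
     (\<forall>i<r. \<forall>Z. smooth_vfield A U Z \<longrightarrow> (\<forall>p\<in>U. nabla Z (X i) p = (\<lambda>f. 0)))"

section \<open>Lie algebras\<close>

record 'v lie_algebra =
  lie_carrier :: "'v set"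
  lie_zero :: 'v
  lie_add :: "'v \<Rightarrow> 'v \<Rightarrow> 'v"
  lie_scale :: "real \<Rightarrow> 'v \<Rightarrow> 'v"
  lie_br :: "'v \<Rightarrow> 'v \<Rightarrow> 'v"

definition abelian_lie_algebra :: "'v lie_algebra \<Rightarrow> bool" where
  "abelian_lie_algebra L \<longleftrightarrow>
     (\<forall>x\<in>lie_carrier L. \<forall>y\<in>lie_carrier L. lie_br L x y = lie_zero L)"

definition lie_algebra_isomorphic :: "'v lie_algebra \<Rightarrow> 'w lie_algebra \<Rightarrow> bool" where
  "lie_algebra_isomorphic L K \<longleftrightarrow>
     (\<exists>T. bij_betw T (lie_carrier L) (lie_carrier K) \<and>
        (\<forall>x\<in>lie_carrier L. \<forall>y\<in>lie_carrier L.
           T (lie_add L x y) = lie_add K (T x) (T y) \<and>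
           T (lie_br L x y) = lie_br K (T x) (T y)) \<and>
        (\<forall>c. \<forall>x\<in>lie_carrier L. T (lie_scale L c x) = lie_scale K c (T x)))"

definition vfield_algebra ::
  "('a::topological_space, 'e::euclidean_space) atlas \<Rightarrow> 'a vfield set \<Rightarrow> 'a vfield lie_algebra"
where
  "vfield_algebra A V = \<lparr>
     lie_carrier = V,
     lie_zero = (\<lambda>p f. 0),
     lie_add = (\<lambda>X Y p f. X p f + Y p f),
     lie_scale = (\<lambda>c X p f. c * X p f),
     lie_br = lie_bracket A \<rparr>"

text \<open>The real span of the fields \<open>X i\<close> on \<open>U\<close> with the bracket of vector fields. Fields over
  \<open>U\<close> are represented by their extension by zero.\<close>

definition structure_algebra ::
  "('a::topological_space, 'e::euclidean_space) atlas \<Rightarrow> nat \<Rightarrow> 'a set \<Rightarrow> (nat \<Rightarrow> 'a vfield) \<Rightarrow>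
   'a vfield lie_algebra" where
  "structure_algebra A r U X = vfield_algebra A
     {(\<lambda>p. if p \<in> U then lincomb r a (\<lambda>i. X i p) else (\<lambda>f. 0)) |a. True}"

section \<open>Lie groups\<close>

definition lie_group ::
  "('g::{t2_space, second_countable_topology}, 'x) monoid_scheme \<Rightarrow>
   ('g, 'e::euclidean_space) atlas \<Rightarrow> bool" where
  "lie_group G B \<longleftrightarrow>
     group G \<and> smooth_atlas B \<and> carrier G = mcarrier B \<and>
     smooth_map (product_atlas B B) B (\<lambda>(x, y). x \<otimes>\<^bsub>G\<^esub> y) \<and>
     smooth_map B B (\<lambda>x. inv\<^bsub>G\<^esub> x)"

text \<open>The Lie algebra of left-invariant vector fields: the differential of left translation by
  \<open>a\<close> maps \<open>X p\<close> to \<open>X (a p)\<close>.\<close>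

definition left_invariant_vfields ::
  "('g::topological_space, 'x) monoid_scheme \<Rightarrow> ('g, 'e::euclidean_space) atlas \<Rightarrow>
   'g vfield set" where
  "left_invariant_vfields G B = {X.
     smooth_vfield B (carrier G) X \<and> (\<forall>p. p \<notin> carrier G \<longrightarrow> X p = (\<lambda>f. 0)) \<and>
     (\<forall>a\<in>carrier G. \<forall>p\<in>carrier G. \<forall>f. smooth_at B (a \<otimes>\<^bsub>G\<^esub> p) f \<longrightarrow>
        X (a \<otimes>\<^bsub>G\<^esub> p) f = X p (\<lambda>q. f (a \<otimes>\<^bsub>G\<^esub> q)))}"

definition lie_algebra_of ::
  "('g::topological_space, 'x) monoid_scheme \<Rightarrow> ('g, 'e::euclidean_space) atlas \<Rightarrow>
   'g vfield lie_algebra" where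
  "lie_algebra_of G B = vfield_algebra B (left_invariant_vfields G B)"

definition lie_group_isomorphic ::
  "('g::topological_space, 'x) monoid_scheme \<Rightarrow> ('g, 'e::euclidean_space) atlas \<Rightarrow>
   ('h::topological_space, 'y) monoid_scheme \<Rightarrow> ('h, 'f::euclidean_space) atlas \<Rightarrow> bool" where
  "lie_group_isomorphic G B H C \<longleftrightarrow>
     (\<exists>F \<in> iso G H. smooth_map B C F \<and> smooth_map C B (inv_into (carrier G) F))"

definition additive_group :: "'e::euclidean_space monoid" where
  "additive_group = \<lparr>carrier = UNIV, mult = (+), one = 0\<rparr>"

definition euclidean_atlas :: "('e::euclidean_space, 'e) atlas" where
  "euclidean_atlas = {(UNIV, \<lambda>x. x)}"

text \<open>The model group of the Walker foliation is determined (up to isomorphism) by the structure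
  algebra: it is the simply connected Lie group with this Lie algebra.\<close>

definition model_group ::
  "('a::topological_space, 'd::euclidean_space) atlas \<Rightarrow> nat \<Rightarrow> 'a set \<Rightarrow> (nat \<Rightarrow> 'a vfield) \<Rightarrow>
   ('g::{t2_space, second_countable_topology}, 'x) monoid_scheme \<Rightarrow>
   ('g, 'e::euclidean_space) atlas \<Rightarrow> bool" where
  "model_group A r U X G B \<longleftrightarrow>
     lie_group G B \<and> simply_connected (carrier G) \<and>
     lie_algebra_isomorphic (lie_algebra_of G B) (structure_algebra A r U X)"

end

theory Submission
  imports Defs
begin

text \<open>The Levi-Civita connection is torsion-free, so parallel fields satisfy
  \<open>[X\<^sub>i, X\<^sub>j] = \<nabla>\<^bsub>X\<^sub>i\<^esub> X\<^sub>j - \<nabla>\<^bsub>X\<^sub>j\<^esub> X\<^sub>i = 0\<close>: for a Walker foliation the fields of a parallel basis always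
  commute, and by bilinearity the structure algebra is abelian. Hence all the conditions compared in
  the theorem hold, once it is known that a simply connected Lie group \<open>G\<close> with abelian Lie
  algebra is isomorphic to the vector group of its model space
  (\<open>abelian_simply_connected_iso\<close>). That statement is the substance of the proof.

  Locally, let \<open>\<omega>\<close> be the Maurer--Cartan form of \<open>G\<close>, read in a chart at the identity. Since the
  left-invariant fields commute, \<open>\<omega>\<close> is closed, and the Poincare lemma
  (\<open>closed_one_form_has_primitive\<close>) gives a primitive \<open>f\<close>. Left invariance of \<open>\<omega>\<close> says that
  \<open>x \<mapsto> f (a x)\<close> and \<open>f\<close> have the same derivative, so \<open>f (a x) = f a + f x\<close> near the identity.
  By the inverse function theorem \<open>f\<close> is a chart, and its inverse \<open>\<sigma>\<close> is a local homomorphism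
  (\<open>canonical_coordinates\<close>).

  Globally, \<open>E v = \<sigma> (v / n)\<^sup>n\<close> with \<open>n\<close> large extends \<open>\<sigma>\<close> to a homomorphism from the whole vector
  space. Its image is an open subgroup, hence all of the connected group \<open>G\<close>. If \<open>E v = \<one>\<close>, then
  \<open>t \<mapsto> E (t v)\<close> is a loop, and lifting a null-homotopy of it along \<open>E\<close> forces \<open>v = 0\<close>
  (\<open>E_kernel_trivial\<close>). So \<open>E\<close> is bijective. It is smooth with smooth inverse because, up to
  translations, it is \<open>\<sigma>\<close> near every point.\<close>

section \<open>Calculus of smooth maps on open subsets of Euclidean spaces\<close>

lemma Ck_on_cong:
  assumes "open S" "\<And>x. x \<in> S \<Longrightarrow> f x = g x" "Ck_on k S f"
  shows "Ck_on k S g"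
  using assms(2,3)
proof (induction k arbitrary: f g)
  case 0
  then show ?case by (simp cong: continuous_on_cong)
next
  case (Suc k)
  have d: "f differentiable (at x)" if "x \<in> S" for x
    using Suc.prems that by simp
  have dg: "g differentiable (at x)" if "x \<in> S" for x
    using d[OF that] Suc.prems(1) \<open>open S\<close> that
    by (meson differentiable_def has_derivative_transform_within_open)
  have eq: "frechet_derivative f (at x) = frechet_derivative g (at x)" if "x \<in> S" for x
    using frechet_derivative_transform_within_open[OF d \<open>open S\<close>] Suc.prems(1) that by blast
  have "Ck_on k S (\<lambda>x. frechet_derivative g (at x) v)" for v
    by (rule Suc.IH[of "\<lambda>x. frechet_derivative f (at x) v"]) (use eq Suc.prems in auto)
  then show ?case using dg by simp
qed

lemma Ck_on_subset: "Ck_on k S f \<Longrightarrow> T \<subseteq> S \<Longrightarrow> Ck_on k T f"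
  by (induction k arbitrary: f) (auto intro: continuous_on_subset)

lemma Ck_on_local:
  assumes "\<And>x. x \<in> S \<Longrightarrow> \<exists>W. open W \<and> x \<in> W \<and> Ck_on k W f"
  shows "Ck_on k S f"
  using assms
proof (induction k arbitrary: f)
  case 0
  then show ?case
    by (fastforce intro!: continuous_at_imp_continuous_on simp: continuous_on_eq_continuous_at)
next
  case (Suc k)
  have "Ck_on k S (\<lambda>x. frechet_derivative f (at x) v)" for v
    by (rule Suc.IH) (use Suc.prems in fastforce)
  moreover have "f differentiable (at x)" if "x \<in> S" for x
    using Suc.prems[OF that] by auto
  ultimately show ?case by simp
qed

lemma Ck_on_Suc_imp: "Ck_on (Suc k) S f \<Longrightarrow> Ck_on k S f"
proof (induction k arbitrary: f)
  case 0
  then show ?case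
    by (auto intro!: continuous_at_imp_continuous_on differentiable_imp_continuous_within)
next
  case (Suc k)
  have "Ck_on k S (\<lambda>x. frechet_derivative f (at x) v)" for v
    by (rule Suc.IH) (use Suc.prems in simp)
  with Suc.prems show ?case by simp
qed

lemma Ck_on_SucI:
  assumes "open S" "\<And>x. x \<in> S \<Longrightarrow> (f has_derivative f' x) (at x)"
    and "\<And>v. Ck_on k S (\<lambda>x. f' x v)"
  shows "Ck_on (Suc k) S f"
proof -
  have "f' x = frechet_derivative f (at x)" if "x \<in> S" for x
    using assms(2)[OF that] by (rule frechet_derivative_at)
  then have "Ck_on k S (\<lambda>x. frechet_derivative f (at x) v)" for v
    by (intro Ck_on_cong[OF assms(1) _ assms(3)[of v]]) simp
  then show ?thesis using assms(2) by (auto simp: differentiable_def)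
qed

lemma Ck_on_SucD:
  assumes "Ck_on (Suc k) S f"
  shows "\<And>x. x \<in> S \<Longrightarrow> (f has_derivative frechet_derivative f (at x)) (at x)"
    and "\<And>v. Ck_on k S (\<lambda>x. frechet_derivative f (at x) v)"
  using assms frechet_derivative_works by auto

lemma Ck_on_const: "Ck_on k S (\<lambda>x. c)"
  by (induction k arbitrary: c) auto

lemma Ck_on_bounded_linear_compose:
  assumes "bounded_linear L" "open S" "Ck_on k S f"
  shows "Ck_on k S (\<lambda>x. L (f x))"
  using assms(3)
proof (induction k arbitrary: f)
  case 0
  then show ?case using assms(1)
    by (simp add: bounded_linear.continuous_on)
next
  case (Suc k)
  note D = Ck_on_SucD[OF Suc.prems]
  show ?case
    by (rule Ck_on_SucI[OF assms(2) bounded_linear.has_derivative[OF assms(1) D(1)] Suc.IH[OF D(2)]])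
qed

lemma Ck_on_add:
  assumes "open S" "Ck_on k S f" "Ck_on k S g"
  shows "Ck_on k S (\<lambda>x. f x + g x)"
  using assms(2,3)
proof (induction k arbitrary: f g)
  case 0
  then show ?case by (simp add: continuous_on_add)
next
  case (Suc k)
  note D = Ck_on_SucD[OF Suc.prems(1)] Ck_on_SucD[OF Suc.prems(2)]
  show ?case
    by (rule Ck_on_SucI[OF assms(1) has_derivative_add[OF D(1,3)] Suc.IH[OF D(2,4)]])
qed

lemma Ck_on_sum:
  assumes "open S" "finite I" "\<And>i. i \<in> I \<Longrightarrow> Ck_on k S (f i)"
  shows "Ck_on k S (\<lambda>x. \<Sum>i\<in>I. f i x)"
  using assms(2,3)
proof (induction I)
  case (insert i I)
  then show ?case using Ck_on_add[OF assms(1), of k "f i" "\<lambda>x. \<Sum>i\<in>I. f i x"] by simp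
qed (simp add: Ck_on_const)

lemma (in bounded_bilinear) Ck_on:
  assumes "open S" "Ck_on k S f" "Ck_on k S g"
  shows "Ck_on k S (\<lambda>x. prod (f x) (g x))"
  using assms(2,3)
proof (induction k arbitrary: f g)
  case 0
  then show ?case by (simp add: continuous_on)
next
  case (Suc k)
  note D = Ck_on_SucD[OF Suc.prems(1)] Ck_on_SucD[OF Suc.prems(2)]
  show ?case
  proof (rule Ck_on_SucI[OF assms(1)])
    show "((\<lambda>x. prod (f x) (g x)) has_derivative
      (\<lambda>v. prod (f x) (frechet_derivative g (at x) v) + prod (frechet_derivative f (at x) v) (g x))) (at x)"
      if "x \<in> S" for x
      by (rule FDERIV) (use D that in auto)
    show "Ck_on k S (\<lambda>x. prod (f x) (frechet_derivative g (at x) v) +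
        prod (frechet_derivative f (at x) v) (g x))" for v
      by (rule Ck_on_add[OF assms(1) Suc.IH[OF Ck_on_Suc_imp[OF Suc.prems(1)] D(4)]
            Suc.IH[OF D(2) Ck_on_Suc_imp[OF Suc.prems(2)]]])
  qed
qed

lemma linear_basis_expansion:
  fixes L :: "'a::euclidean_space \<Rightarrow> 'b::real_vector"
  assumes "linear L"
  shows "L u = (\<Sum>b\<in>Basis. (u \<bullet> b) *\<^sub>R L b)"
proof -
  have "L u = L (\<Sum>b\<in>Basis. (u \<bullet> b) *\<^sub>R b)"
    by (simp add: euclidean_representation)
  also have "\<dots> = (\<Sum>b\<in>Basis. (u \<bullet> b) *\<^sub>R L b)"
    using assms by (simp add: linear_sum linear_scale)
  finally show ?thesis .
qed

lemma Ck_on_compose: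
  fixes f :: "'b::euclidean_space \<Rightarrow> 'c::real_normed_vector"
    and g :: "'a::euclidean_space \<Rightarrow> 'b"
  assumes "open S" "g ` S \<subseteq> T" "Ck_on k T f" "Ck_on k S g"
  shows "Ck_on k S (\<lambda>x. f (g x))"
  using assms(3,4)
proof (induction k arbitrary: f)
  case 0
  then show ?case using assms(2) by (auto intro: continuous_on_compose2)
next
  case (Suc k)
  note D = Ck_on_SucD[OF Suc.prems(1)] Ck_on_SucD[OF Suc.prems(2)]
  let ?f' = "\<lambda>x v. \<Sum>b\<in>Basis. (frechet_derivative g (at x) v \<bullet> b) *\<^sub>R frechet_derivative f (at (g x)) b"
  show ?case
  proof (rule Ck_on_SucI[OF assms(1)])
    show "((\<lambda>x. f (g x)) has_derivative ?f' x) (at x)" if "x \<in> S" for x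
    proof -
      have gx: "g x \<in> T" using assms(2) that by blast
      have "((\<lambda>x. f (g x)) has_derivative
          (\<lambda>v. frechet_derivative f (at (g x)) (frechet_derivative g (at x) v))) (at x)"
        using has_derivative_compose[OF D(3)[OF that] D(1)[OF gx]] .
      moreover have "(\<lambda>v. frechet_derivative f (at (g x)) (frechet_derivative g (at x) v)) = ?f' x"
        by (rule ext, rule linear_basis_expansion, rule has_derivative_linear, rule D(1)[OF gx])
      ultimately show ?thesis by simp
    qed
    show "Ck_on k S (\<lambda>x. ?f' x v)" for v
    proof (intro Ck_on_sum assms(1) finite_Basis)
      fix b :: 'b
      have "Ck_on k S (\<lambda>x. frechet_derivative g (at x) v \<bullet> b)"
        by (rule Ck_on_bounded_linear_compose[OF bounded_linear_inner_left assms(1) D(4)])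
      moreover have "Ck_on k S (\<lambda>x. frechet_derivative f (at (g x)) b)"
        by (rule Suc.IH[OF D(2) Ck_on_Suc_imp[OF Suc.prems(2)]])
      ultimately show "Ck_on k S (\<lambda>x. (frechet_derivative g (at x) v \<bullet> b) *\<^sub>R
          frechet_derivative f (at (g x)) b)"
        by (rule bounded_bilinear.Ck_on[OF bounded_bilinear_scaleR assms(1)])
    qed
  qed
qed

lemma smooth_on_cong:
  "open S \<Longrightarrow> (\<And>x. x \<in> S \<Longrightarrow> f x = g x) \<Longrightarrow> smooth_on S f \<Longrightarrow> smooth_on S g"
  unfolding smooth_on_def by (rule allI, rule Ck_on_cong[of S f g]) auto

lemma smooth_on_subset: "smooth_on S f \<Longrightarrow> T \<subseteq> S \<Longrightarrow> smooth_on T f"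
  unfolding smooth_on_def by (rule allI, rule Ck_on_subset[of _ S f T]) auto

lemma smooth_on_local:
  "(\<And>x. x \<in> S \<Longrightarrow> \<exists>W. open W \<and> x \<in> W \<and> smooth_on W f) \<Longrightarrow> smooth_on S f"
  unfolding smooth_on_def by (rule allI, rule Ck_on_local) metis

lemma smooth_on_has_derivative:
  "smooth_on S f \<Longrightarrow> x \<in> S \<Longrightarrow> (f has_derivative frechet_derivative f (at x)) (at x)"
  unfolding smooth_on_def by (rule Ck_on_SucD(1)[of 0 S]) auto

lemma smooth_on_frechet_derivative:
  "smooth_on S f \<Longrightarrow> smooth_on S (\<lambda>x. frechet_derivative f (at x) v)"
  unfolding smooth_on_def by (rule allI, rule Ck_on_SucD(2)) simp

lemma smooth_onI_derivative:
  "open S \<Longrightarrow> (\<And>x. x \<in> S \<Longrightarrow> (f has_derivative f' x) (at x)) \<Longrightarrow>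
    (\<And>v. smooth_on S (\<lambda>x. f' x v)) \<Longrightarrow> smooth_on S f"
  unfolding smooth_on_def by (rule allI, rule Ck_on_Suc_imp, rule Ck_on_SucI[of S f f']) auto

lemma smooth_on_imp_continuous_on: "smooth_on S f \<Longrightarrow> continuous_on S f"
  unfolding smooth_on_def by (drule spec[of _ 0]) simp

lemma smooth_on_const: "smooth_on S (\<lambda>x. c)"
  unfolding smooth_on_def by (simp add: Ck_on_const)

lemma smooth_on_ident: "open S \<Longrightarrow> smooth_on S (\<lambda>x. x)"
  by (rule smooth_onI_derivative[where f' = "\<lambda>x v. v"]) (auto intro: smooth_on_const)

lemma smooth_on_bounded_linear_compose:
  "bounded_linear L \<Longrightarrow> open S \<Longrightarrow> smooth_on S f \<Longrightarrow> smooth_on S (\<lambda>x. L (f x))"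
  unfolding smooth_on_def by (rule allI, rule Ck_on_bounded_linear_compose[of L]) auto

lemma smooth_on_bounded_linear:
  "bounded_linear L \<Longrightarrow> open S \<Longrightarrow> smooth_on S L"
  by (rule smooth_on_bounded_linear_compose[OF _ _ smooth_on_ident])

lemma smooth_on_add:
  "open S \<Longrightarrow> smooth_on S f \<Longrightarrow> smooth_on S g \<Longrightarrow> smooth_on S (\<lambda>x. f x + g x)"
  unfolding smooth_on_def by (rule allI, rule Ck_on_add) auto

lemma smooth_on_diff:
  "open S \<Longrightarrow> smooth_on S f \<Longrightarrow> smooth_on S g \<Longrightarrow> smooth_on S (\<lambda>x. f x - g x)"
  using smooth_on_add[of S f "\<lambda>x. - g x"]
    smooth_on_bounded_linear_compose[OF bounded_linear_minus[OF bounded_linear_ident], of S g] by simp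

lemma smooth_on_sum:
  "open S \<Longrightarrow> finite I \<Longrightarrow> (\<And>i. i \<in> I \<Longrightarrow> smooth_on S (f i)) \<Longrightarrow> smooth_on S (\<lambda>x. \<Sum>i\<in>I. f i x)"
  unfolding smooth_on_def by (rule allI, rule Ck_on_sum) auto

lemma (in bounded_bilinear) smooth_on:
  "open S \<Longrightarrow> smooth_on S f \<Longrightarrow> smooth_on S g \<Longrightarrow> smooth_on S (\<lambda>x. prod (f x) (g x))"
  unfolding smooth_on_def by (rule allI, rule Ck_on) auto

lemmas smooth_on_mult = bounded_bilinear.smooth_on[OF bounded_bilinear_mult]
lemmas smooth_on_scaleR = bounded_bilinear.smooth_on[OF bounded_bilinear_scaleR]

lemma smooth_on_compose:
  fixes f :: "'b::euclidean_space \<Rightarrow> 'c::real_normed_vector"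
  shows "open S \<Longrightarrow> smooth_on T f \<Longrightarrow> smooth_on S g \<Longrightarrow> g ` S \<subseteq> T \<Longrightarrow> smooth_on S (\<lambda>x. f (g x))"
  unfolding smooth_on_def by (rule allI, rule Ck_on_compose[of S g T _ f]) auto

lemma smooth_on_Pair:
  assumes "open S" "smooth_on S f" "smooth_on S g"
  shows "smooth_on S (\<lambda>x. (f x, g x))"
proof -
  have "smooth_on S (\<lambda>x. (f x, 0) + (0, g x))"
    by (rule smooth_on_add[OF assms(1)
        smooth_on_bounded_linear_compose[OF bounded_linear_Pair[OF bounded_linear_ident bounded_linear_zero] assms(1,2)]
        smooth_on_bounded_linear_compose[OF bounded_linear_Pair[OF bounded_linear_zero bounded_linear_ident] assms(1,3)]])
  then show ?thesis by simp
qed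

text \<open>Although \<^const>\<open>Ck_on\<close> only speaks of derivatives in constant directions, the direction
  may vary smoothly as well, because the derivative is linear in it.\<close>

lemma smooth_on_frechet_derivative_apply:
  fixes f :: "'b::euclidean_space \<Rightarrow> 'c::real_normed_vector"
    and u :: "'a::euclidean_space \<Rightarrow> 'b"
  assumes "open S" "smooth_on T f" "smooth_on S g" "g ` S \<subseteq> T" "smooth_on S u"
  shows "smooth_on S (\<lambda>x. frechet_derivative f (at (g x)) (u x))"
proof (rule smooth_on_cong[OF assms(1)])
  show "smooth_on S (\<lambda>x. \<Sum>b\<in>Basis. (u x \<bullet> b) *\<^sub>R frechet_derivative f (at (g x)) b)"
  proof (intro smooth_on_sum assms(1) finite_Basis)
    fix b :: 'b
    show "smooth_on S (\<lambda>x. (u x \<bullet> b) *\<^sub>R frechet_derivative f (at (g x)) b)"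
      by (rule smooth_on_scaleR[OF assms(1)
            smooth_on_bounded_linear_compose[OF bounded_linear_inner_left assms(1,5)]
            smooth_on_compose[OF assms(1) smooth_on_frechet_derivative[OF assms(2)] assms(3,4)]])
  qed
  fix x assume "x \<in> S"
  then have "linear (frechet_derivative f (at (g x)))"
    using smooth_on_has_derivative[OF assms(2)] assms(4) has_derivative_linear by blast
  then show "(\<Sum>b\<in>Basis. (u x \<bullet> b) *\<^sub>R frechet_derivative f (at (g x)) b)
      = frechet_derivative f (at (g x)) (u x)"
    by (rule linear_basis_expansion[symmetric])
qed

section \<open>Closed one-forms and canonical coordinates of local Lie groups\<close>

text \<open>The product rule for evaluating a linear map that depends on \<open>x\<close> at a vector that depends on \<open>x\<close>.
  Only the maps \<open>x \<mapsto> \<omega> x v\<close> with \<open>v\<close> fixed are assumed differentiable; expanding the vector in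
  the standard basis reduces the general case to them.\<close>

lemma has_derivative_linear_family:
  fixes \<omega> :: "'a::real_normed_vector \<Rightarrow> 'b::euclidean_space \<Rightarrow> 'c::real_normed_vector"
  assumes "open S" "x \<in> S" and lin: "\<And>x. x \<in> S \<Longrightarrow> linear (\<omega> x)"
    and d\<omega>: "\<And>v. ((\<lambda>x. \<omega> x v) has_derivative \<omega>' v) (at x)"
    and dz: "(z has_derivative z') (at x)"
  shows "((\<lambda>x. \<omega> x (z x)) has_derivative (\<lambda>w. \<omega>' (z x) w + \<omega> x (z' w))) (at x)"
proof -
  have expand: "((\<lambda>x. \<omega> x (y x)) has_derivative
      (\<lambda>w. \<Sum>b\<in>Basis. (y x \<bullet> b) *\<^sub>R \<omega>' b w + (y' w \<bullet> b) *\<^sub>R \<omega> x b)) (at x)"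
    if "(y has_derivative y') (at x)" for y y'
  proof (rule has_derivative_transform_within_open[OF _ assms(1,2)])
    show "((\<lambda>x. \<Sum>b\<in>Basis. (y x \<bullet> b) *\<^sub>R \<omega> x b) has_derivative
      (\<lambda>w. \<Sum>b\<in>Basis. (y x \<bullet> b) *\<^sub>R \<omega>' b w + (y' w \<bullet> b) *\<^sub>R \<omega> x b)) (at x)"
      by (intro has_derivative_sum has_derivative_scaleR has_derivative_inner_left that d\<omega>)
  qed (use linear_basis_expansion[OF lin] in simp)
  have "\<omega>' (z x) w = (\<Sum>b\<in>Basis. (z x \<bullet> b) *\<^sub>R \<omega>' b w)" for w
    using has_derivative_unique[OF d\<omega>[of "z x"] expand[OF has_derivative_const]] by simp
  moreover have "\<omega> x (z' w) = (\<Sum>b\<in>Basis. (z' w \<bullet> b) *\<^sub>R \<omega> x b)" for w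
    using linear_basis_expansion[OF lin[OF assms(2)]] .
  ultimately show ?thesis
    using expand[OF dz] by (simp add: sum.distrib)
qed

text \<open>The Poincare lemma: integrating \<open>\<omega>\<close> along the segment from \<open>c\<close> to \<open>x\<close> gives the primitive
  \<open>f x = \<integral>\<^sub>0\<^sup>1 \<omega> (c + t (x - c)) (x - c) dt\<close>, which is differentiated under the integral sign.\<close>

theorem closed_one_form_has_primitive:
  fixes \<omega> :: "'a::euclidean_space \<Rightarrow> 'a \<Rightarrow> 'b::banach"
  assumes S: "open S" "convex S" "c \<in> S"
    and lin: "\<And>x. x \<in> S \<Longrightarrow> linear (\<omega> x)"
    and smooth: "\<And>v. smooth_on S (\<lambda>x. \<omega> x v)"
    and closed: "\<And>x u v. x \<in> S \<Longrightarrow>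
      frechet_derivative (\<lambda>x. \<omega> x v) (at x) u = frechet_derivative (\<lambda>x. \<omega> x u) (at x) v"
  obtains f where "f c = 0" "\<And>x. x \<in> S \<Longrightarrow> (f has_derivative \<omega> x) (at x)"
proof -
  define y where "y x t = c + t *\<^sub>R (x - c)" for x and t :: real
  define \<omega>' where "\<omega>' v = (\<lambda>x. frechet_derivative (\<lambda>x. \<omega> x v) (at x))" for v
  define K where "K x t v = \<omega> (y x t) v + t *\<^sub>R \<omega>' v (y x t) (x - c)" for x t v
  define f where "f x = integral (cbox 0 1) (\<lambda>t. \<omega> (y x t) (x - c))" for x
  have yS: "y x t \<in> S" if "x \<in> S" "t \<in> cbox 0 1" for x t
  proof -
    have "y x t = (1 - t) *\<^sub>R c + t *\<^sub>R x" by (simp add: y_def algebra_simps)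
    then show ?thesis
      using S(2,3) that unfolding convex_alt by (auto simp: cbox_interval)
  qed
  have D: "((\<lambda>x. \<omega> x v) has_derivative \<omega>' v x) (at x)" if "x \<in> S" for x v
    unfolding \<omega>'_def by (rule smooth_on_has_derivative[OF smooth that])
  \<comment> \<open>Closedness turns the derivative of the integrand into an exact derivative in \<open>t\<close>.\<close>
  have DK: "((\<lambda>x. \<omega> (y x t) (x - c)) has_derivative K x t) (at x)"
    if "x \<in> S" "t \<in> cbox 0 1" for x t
  proof -
    let ?T = "(\<lambda>x. y x t) -` S"
    have opT: "open ?T"
      by (intro open_vimage S(1)) (auto simp: y_def intro!: continuous_intros)
    have dy: "((\<lambda>x. y x t) has_derivative (\<lambda>w. t *\<^sub>R w)) (at x)"
      unfolding y_def by (auto intro!: derivative_eq_intros)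
    have "((\<lambda>x. \<omega> (y x t) (x - c)) has_derivative
        (\<lambda>w. \<omega>' (x - c) (y x t) (t *\<^sub>R w) + \<omega> (y x t) w)) (at x)"
    proof (rule has_derivative_linear_family[OF opT])
      show "((\<lambda>x. \<omega> (y x t) v) has_derivative (\<lambda>w. \<omega>' v (y x t) (t *\<^sub>R w))) (at x)" for v
        using has_derivative_compose[OF dy D[OF yS[OF that]]] .
      show "((\<lambda>x. x - c) has_derivative (\<lambda>w. w)) (at x)"
        by (auto intro!: derivative_eq_intros)
    qed (use yS that lin in auto)
    moreover have "\<omega>' (x - c) (y x t) (t *\<^sub>R w) + \<omega> (y x t) w = K x t w" for w
      using closed[OF yS[OF that]] linear_scale[OF has_derivative_linear[OF D[OF yS[OF that]]]]
      by (simp add: K_def \<omega>'_def)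
    ultimately show ?thesis by simp
  qed
  have Dt: "((\<lambda>t. t *\<^sub>R \<omega> (y x t) v) has_vector_derivative K x t v) (at t within cbox 0 1)"
    if "x \<in> S" "t \<in> cbox 0 1" for x t v
  proof -
    have dy: "(y x has_derivative (\<lambda>s. s *\<^sub>R (x - c))) (at t)"
      unfolding y_def by (auto intro!: derivative_eq_intros)
    have "((\<lambda>t. \<omega> (y x t) v) has_derivative (\<lambda>s. \<omega>' v (y x t) (s *\<^sub>R (x - c)))) (at t)"
      using has_derivative_compose[OF dy D[OF yS[OF that]]] .
    then have "((\<lambda>t. \<omega> (y x t) v) has_vector_derivative \<omega>' v (y x t) (x - c)) (at t)"
      using linear_scale[OF has_derivative_linear[OF D[OF yS[OF that]]]]
      by (simp add: has_vector_derivative_def)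
    then have "((\<lambda>t. t *\<^sub>R \<omega> (y x t) v) has_vector_derivative
       (t *\<^sub>R \<omega>' v (y x t) (x - c) + 1 *\<^sub>R \<omega> (y x t) v)) (at t)"
      by (intro has_vector_derivative_scaleR) (auto intro!: derivative_eq_intros)
    then show ?thesis
      unfolding K_def by (auto simp: add.commute intro: has_vector_derivative_at_within)
  qed
  have blK: "bounded_linear (K x t)" if "x \<in> S" "t \<in> cbox 0 1" for x t
    using DK[OF that] by (rule has_derivative_bounded_linear)
  have contK: "continuous_on (S \<times> cbox 0 1) (\<lambda>(x, t). Blinfun (K x t))"
  proof (rule continuous_on_blinfun_componentwise)
    fix i :: 'a assume "i \<in> Basis"
    have "continuous_on (S \<times> UNIV) (\<lambda>p. \<omega>' i (fst p) (snd p :: 'a))"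
      unfolding \<omega>'_def
      by (rule smooth_on_imp_continuous_on, rule smooth_on_frechet_derivative_apply[OF _ smooth])
        (auto intro!: smooth_on_bounded_linear bounded_linear_fst bounded_linear_snd open_Times S)
    then have "continuous_on (S \<times> cbox 0 1) (\<lambda>p. \<omega>' i (fst (y (fst p) (snd p), fst p - c))
        (snd (y (fst p) (snd p), fst p - c)))"
      by (rule continuous_on_compose2) (use yS in \<open>auto simp: y_def intro!: continuous_intros\<close>)
    moreover have "continuous_on (S \<times> cbox 0 1) (\<lambda>p. \<omega> (y (fst p) (snd p)) i)"
      by (rule continuous_on_compose2[OF smooth_on_imp_continuous_on[OF smooth[of i]]])
        (use yS in \<open>auto simp: y_def intro!: continuous_intros\<close>)
    ultimately have "continuous_on (S \<times> cbox 0 1) (\<lambda>p. K (fst p) (snd p) i)"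
      unfolding K_def by (intro continuous_intros) auto
    then show "continuous_on (S \<times> cbox 0 1) (\<lambda>p. blinfun_apply (case p of (x, t) \<Rightarrow> Blinfun (K x t)) i)"
      by (rule continuous_on_cong[THEN iffD1, rotated 2])
        (auto simp: bounded_linear_Blinfun_apply[OF blK] split: prod.splits)
  qed
  have cont: "continuous_on (cbox 0 1) (\<lambda>t. Blinfun (K x t))" if "x \<in> S" for x
  proof -
    have "continuous_on (cbox 0 1) (\<lambda>t. (x, t))"
      by (intro continuous_intros)
    then have "continuous_on (cbox 0 1) (\<lambda>t. case (x, t) of (x, t) \<Rightarrow> Blinfun (K x t))"
      by (rule continuous_on_compose2[OF contK]) (use that in auto)
    then show ?thesis by simp
  qed
  have "(f has_derivative \<omega> x) (at x)" if x: "x \<in> S" for x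
  proof -
    have "(f has_derivative integral (cbox 0 1) (\<lambda>t. Blinfun (K x t))) (at x within S)"
      unfolding f_def
    proof (rule leibniz_rule[OF _ _ contK x S(2)])
      show "((\<lambda>x. \<omega> (y x t) (x - c)) has_derivative blinfun_apply (Blinfun (K x t))) (at x within S)"
        if "x \<in> S" "t \<in> cbox 0 1" for x t
        using DK[OF that] bounded_linear_Blinfun_apply[OF blK[OF that]]
        by (simp add: has_derivative_at_withinI)
      show "(\<lambda>t. \<omega> (y x t) (x - c)) integrable_on cbox 0 1" if "x \<in> S" for x
        by (rule integrable_continuous,
            rule continuous_on_compose2[OF smooth_on_imp_continuous_on[OF smooth]])
          (use yS that in \<open>auto simp: y_def intro!: continuous_intros\<close>)
    qed
    moreover have "blinfun_apply (integral (cbox 0 1) (\<lambda>t. Blinfun (K x t))) = \<omega> x"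
    proof
      fix v
      have "((\<lambda>t. K x t v) has_integral 1 *\<^sub>R \<omega> (y x 1) v - 0 *\<^sub>R \<omega> (y x 0) v) {0..1}"
        by (rule fundamental_theorem_of_calculus) (use Dt x in auto)
      then have "integral (cbox 0 1) (\<lambda>t. K x t v) = \<omega> x v"
        by (simp add: integral_unique y_def)
      moreover have "integral (cbox 0 1) (\<lambda>t. Blinfun (K x t)) v
          = integral (cbox 0 1) (\<lambda>t. blinfun_apply (Blinfun (K x t)) v)"
        by (rule blinfun_apply_integral[symmetric] blinfun_apply_integral,
            rule integrable_continuous, rule cont[OF x])
      moreover have "\<dots> = integral (cbox 0 1) (\<lambda>t. K x t v)"
        by (rule integral_cong) (simp add: bounded_linear_Blinfun_apply[OF blK[OF x]])
      ultimately show "integral (cbox 0 1) (\<lambda>t. Blinfun (K x t)) v = \<omega> x v" by simp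
    qed
    ultimately have "(f has_derivative \<omega> x) (at x within S)" by simp
    then show ?thesis by (simp only: at_within_open[OF x S(1)])
  qed
  moreover have "f c = 0"
    using linear_0[OF lin[OF S(3)]] by (simp add: f_def y_def)
  ultimately show ?thesis using that by blast
qed

text \<open>A Lie group near its identity \<open>e\<close>, written in one chart: \<open>m (x, y)\<close> is the product and
  \<open>q (x, y)\<close> the left quotient \<open>x\<inverse> y\<close>, and each law is required only where all the products in it
  stay inside \<open>W\<close>. For fixed \<open>v\<close>, \<open>x \<mapsto> A x v\<close> is the left-invariant field with value \<open>v\<close> at
  \<open>e\<close>; in the last assumption the two sides differ by the Lie bracket of the fields of \<open>u\<close> and \<open>v\<close>.\<close>

locale local_abelian_group =
  fixes e :: "'e::euclidean_space"
    and W :: "('e \<times> 'e) set"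
    and m q :: "'e \<times> 'e \<Rightarrow> 'e"
    and A :: "'e \<Rightarrow> 'e \<Rightarrow> 'e"
  defines "A \<equiv> \<lambda>x v. frechet_derivative m (at (x, e)) (0, v)"
  assumes open_W: "open W" and e_W: "(e, e) \<in> W"
    and smooth_m: "smooth_on W m" and smooth_q: "smooth_on W q"
    and right_unit: "(x, e) \<in> W \<Longrightarrow> m (x, e) = x"
    and left_unit: "(e, y) \<in> W \<Longrightarrow> m (e, y) = y"
    and cancel: "(x, y) \<in> W \<Longrightarrow> (x, m (x, y)) \<in> W \<Longrightarrow> q (x, m (x, y)) = y"
    and assoc: "(a, x) \<in> W \<Longrightarrow> (x, y) \<in> W \<Longrightarrow> (m (a, x), y) \<in> W \<Longrightarrow> (a, m (x, y)) \<in> W \<Longrightarrow>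
      m (m (a, x), y) = m (a, m (x, y))"
    and commuting: "(x, e) \<in> W \<Longrightarrow>
      frechet_derivative (\<lambda>x. A x v) (at x) (A x u) = frechet_derivative (\<lambda>x. A x u) (at x) (A x v)"
begin

definition frame_dom :: "'e set" where
  "frame_dom = {x. (x, e) \<in> W \<and> (x, x) \<in> W}"

text \<open>The Maurer--Cartan form, whose value at \<open>x\<close> inverts the frame \<open>A x\<close>.\<close>

definition \<omega> :: "'e \<Rightarrow> 'e \<Rightarrow> 'e" where
  "\<omega> x v = frechet_derivative q (at (x, x)) (0, v)"

lemma open_frame_dom: "open frame_dom"
proof -
  have "frame_dom = (\<lambda>x. (x, e)) -` W \<inter> (\<lambda>x. (x, x)) -` W" by (auto simp: frame_dom_def)
  then show ?thesis
    by (auto intro!: open_Int open_vimage open_W continuous_intros)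
qed

lemma e_frame_dom: "e \<in> frame_dom" by (simp add: frame_dom_def e_W)

lemma has_derivative_m_snd:
  assumes "(m has_derivative D) (at (x, y))"
  shows "((\<lambda>y. m (x, y)) has_derivative (\<lambda>v. D (0, v))) (at y)"
  by (rule has_derivative_compose[OF has_derivative_Pair[OF has_derivative_const has_derivative_ident] assms])

lemma derivative_m: "p \<in> W \<Longrightarrow> (m has_derivative frechet_derivative m (at p)) (at p)"
  by (rule smooth_on_has_derivative[OF smooth_m])

lemma derivative_q: "p \<in> W \<Longrightarrow> (q has_derivative frechet_derivative q (at p)) (at p)"
  by (rule smooth_on_has_derivative[OF smooth_q])

lemma has_derivative_A:
  "(x, e) \<in> W \<Longrightarrow> ((\<lambda>y. m (x, y)) has_derivative A x) (at e)"
  using has_derivative_m_snd[OF derivative_m[of "(x, e)"]] by (simp add: A_def)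

lemma has_derivative_\<omega>:
  assumes "x \<in> frame_dom"
  shows "((\<lambda>y. q (x, y)) has_derivative \<omega> x) (at x)"
proof -
  have "(x, x) \<in> W" using assms by (simp add: frame_dom_def)
  then show ?thesis
    unfolding \<omega>_def[abs_def]
    by (rule has_derivative_compose[OF has_derivative_Pair[OF has_derivative_const has_derivative_ident] derivative_q])
qed

lemma linear_A: "x \<in> frame_dom \<Longrightarrow> linear (A x)"
  using has_derivative_linear[OF has_derivative_A] by (simp add: frame_dom_def)

lemma linear_\<omega>: "x \<in> frame_dom \<Longrightarrow> linear (\<omega> x)"
  using has_derivative_linear[OF has_derivative_\<omega>] .

lemma smooth_A: "smooth_on frame_dom (\<lambda>x. A x v)"
  unfolding A_def
  by (rule smooth_on_compose[OF open_frame_dom smooth_on_frechet_derivative[OF smooth_m]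
        smooth_on_Pair[OF open_frame_dom smooth_on_ident[OF open_frame_dom] smooth_on_const]])
    (auto simp: frame_dom_def)

lemma smooth_\<omega>: "smooth_on frame_dom (\<lambda>x. \<omega> x v)"
  unfolding \<omega>_def
  by (rule smooth_on_compose[OF open_frame_dom smooth_on_frechet_derivative[OF smooth_q]
        smooth_on_Pair[OF open_frame_dom smooth_on_ident[OF open_frame_dom] smooth_on_ident[OF open_frame_dom]]])
    (auto simp: frame_dom_def)

lemma \<omega>_A:
  assumes "x \<in> frame_dom"
  shows "\<omega> x (A x v) = v"
proof -
  have W: "(x, e) \<in> W" "(x, x) \<in> W" using assms by (auto simp: frame_dom_def)
  have dm: "((\<lambda>y. m (x, y)) has_derivative A x) (at e)"
    by (rule has_derivative_A[OF W(1)])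
  have "((\<lambda>y. q (x, m (x, y))) has_derivative (\<lambda>v. \<omega> x (A x v))) (at e)"
    using has_derivative_compose[OF dm, of "\<lambda>y. q (x, y)"] has_derivative_\<omega>[OF assms]
    by (simp add: right_unit[OF W(1)])
  moreover have "((\<lambda>y. q (x, m (x, y))) has_derivative (\<lambda>v. v)) (at e)"
  proof -
    have "isCont (\<lambda>y. m (x, y)) e" using dm has_derivative_continuous by blast
    then have "((\<lambda>y. (x, m (x, y))) \<longlongrightarrow> (x, x)) (at e)"
      by (auto simp: isCont_def right_unit[OF W(1)] intro!: tendsto_intros)
    then have "\<forall>\<^sub>F y in at e. (x, m (x, y)) \<in> W"
      using open_W W(2) topological_tendstoD by blast
    moreover have "\<forall>\<^sub>F y in at e. (x, y) \<in> W"
      using tendsto_Pair[OF tendsto_const tendsto_ident_at] open_W W(1) topological_tendstoD by blast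
    ultimately have "\<forall>\<^sub>F y in at e. y = q (x, m (x, y))"
      by eventually_elim (simp add: cancel)
    then show ?thesis
      by (rule has_derivative_transform_eventually[OF has_derivative_ident])
        (use cancel[of x e] W right_unit in auto)
  qed
  ultimately show ?thesis
    by (rule fun_cong[OF has_derivative_unique])
qed

lemma A_\<omega>:
  assumes "x \<in> frame_dom"
  shows "A x (\<omega> x v) = v"
proof -
  have "inj (A x)" by (metis \<omega>_A[OF assms] injI)
  then have "surj (A x)" using linear_A[OF assms] linear_injective_imp_surjective by blast
  then show ?thesis by (metis \<omega>_A[OF assms] surjD)
qed

text \<open>Differentiating \<open>\<omega> (A v) = v\<close> along \<open>A u\<close> gives \<open>(D\<^bsub>A u\<^esub> \<omega>) (A v) = - \<omega> (D\<^bsub>A u\<^esub> (A v))\<close>, which is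
  symmetric in \<open>u\<close> and \<open>v\<close> because the fields \<open>A u\<close> and \<open>A v\<close> commute.\<close>

lemma closed_\<omega>:
  assumes x: "x \<in> frame_dom"
  shows "frechet_derivative (\<lambda>x. \<omega> x v) (at x) u = frechet_derivative (\<lambda>x. \<omega> x u) (at x) v"
proof -
  let ?d\<omega> = "\<lambda>v. frechet_derivative (\<lambda>x. \<omega> x v) (at x)"
  let ?dA = "\<lambda>v. frechet_derivative (\<lambda>x. A x v) (at x)"
  have key: "?d\<omega> (A x v) w = - \<omega> x (?dA v w)" for v w
  proof -
    have "((\<lambda>x. \<omega> x (A x v)) has_derivative (\<lambda>w. ?d\<omega> (A x v) w + \<omega> x (?dA v w))) (at x)"
      by (rule has_derivative_linear_family[of frame_dom x \<omega> ?d\<omega> "\<lambda>x. A x v" "?dA v",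
            OF open_frame_dom x linear_\<omega>
            smooth_on_has_derivative[OF smooth_\<omega> x] smooth_on_has_derivative[OF smooth_A x]])
    moreover have "((\<lambda>x. \<omega> x (A x v)) has_derivative (\<lambda>w. 0)) (at x)"
      by (rule has_derivative_transform_within_open[OF has_derivative_const open_frame_dom x])
        (simp add: \<omega>_A)
    ultimately have "?d\<omega> (A x v) w + \<omega> x (?dA v w) = 0"
      by (rule fun_cong[OF has_derivative_unique])
    then show ?thesis by (simp add: eq_neg_iff_add_eq_0)
  qed
  have "?d\<omega> (A x v') (A x u') = ?d\<omega> (A x u') (A x v')" for u' v'
    using commuting[of x v' u'] x by (simp add: key frame_dom_def)
  from this[of "\<omega> x v" "\<omega> x u"] show ?thesis by (simp add: A_\<omega>[OF x])
qed

text \<open>The derivative of the associative law \<open>m (m (a, x), y) = m (a, m (x, y))\<close> in \<open>y\<close> at \<open>y = e\<close>.\<close>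

lemma derivative_left_translation:
  assumes "(a, x) \<in> W" "x \<in> frame_dom" "m (a, x) \<in> frame_dom"
  shows "frechet_derivative m (at (a, x)) (0, A x v) = A (m (a, x)) v"
proof -
  have W: "(x, e) \<in> W" "(m (a, x), e) \<in> W" using assms by (auto simp: frame_dom_def)
  have dm: "((\<lambda>y. m (x, y)) has_derivative A x) (at e)"
    by (rule has_derivative_A[OF W(1)])
  have da: "((\<lambda>y. m (a, y)) has_derivative (\<lambda>v. frechet_derivative m (at (a, x)) (0, v))) (at x)"
    by (rule has_derivative_m_snd[OF derivative_m[OF assms(1)]])
  have "((\<lambda>y. m (a, m (x, y))) has_derivative
      (\<lambda>v. frechet_derivative m (at (a, x)) (0, A x v))) (at e)"
    using has_derivative_compose[OF dm, of "\<lambda>y. m (a, y)"] da by (simp add: right_unit[OF W(1)])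
  moreover have "((\<lambda>y. m (a, m (x, y))) has_derivative A (m (a, x))) (at e)"
  proof -
    have "isCont (\<lambda>y. m (x, y)) e" using dm has_derivative_continuous by blast
    then have "((\<lambda>y. (a, m (x, y))) \<longlongrightarrow> (a, x)) (at e)"
      by (auto simp: isCont_def right_unit[OF W(1)] intro!: tendsto_intros)
    then have "\<forall>\<^sub>F y in at e. (a, m (x, y)) \<in> W"
      using open_W assms(1) topological_tendstoD by blast
    moreover have "\<forall>\<^sub>F y in at e. (x, y) \<in> W"
      using tendsto_Pair[OF tendsto_const tendsto_ident_at] open_W W(1) topological_tendstoD by blast
    moreover have "\<forall>\<^sub>F y in at e. (m (a, x), y) \<in> W"
      using tendsto_Pair[OF tendsto_const tendsto_ident_at] open_W W(2) topological_tendstoD by blast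
    ultimately have "\<forall>\<^sub>F y in at e. m (m (a, x), y) = m (a, m (x, y))"
      by eventually_elim (simp add: assoc[OF assms(1)])
    then show ?thesis
      by (rule has_derivative_transform_eventually[OF has_derivative_A[OF W(2)]])
        (simp_all add: right_unit W)
  qed
  ultimately show ?thesis
    by (rule fun_cong[OF has_derivative_unique])
qed

text \<open>Since \<open>\<omega>\<close> is left-invariant, \<open>x \<mapsto> f (m (a, x))\<close> and \<open>f\<close> have the same derivative \<open>\<omega>\<close>; their
  difference is therefore constant on a ball, with value \<open>f a\<close> at \<open>x = e\<close>.\<close>

lemma primitive_additive:
  assumes \<rho>: "ball e \<rho> \<subseteq> frame_dom" "0 < \<rho>"
    and f: "\<And>x. x \<in> ball e \<rho> \<Longrightarrow> (f has_derivative \<omega> x) (at x)" "f e = 0"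
  obtains \<delta> where "0 < \<delta>" "\<And>a x. a \<in> ball e \<delta> \<Longrightarrow> x \<in> ball e \<delta> \<Longrightarrow>
    (a, x) \<in> W \<and> m (a, x) \<in> ball e \<rho> \<and> f (m (a, x)) = f a + f x"
proof -
  have "continuous_on W m" by (rule smooth_on_imp_continuous_on[OF smooth_m])
  then have "open (W \<inter> m -` ball e \<rho>)"
    using open_W by (intro continuous_open_preimage) auto
  then obtain P Q where PQ: "open P" "open Q" "(e, e) \<in> P \<times> Q" "P \<times> Q \<subseteq> W \<inter> m -` ball e \<rho>"
    by (rule open_prod_elim) (use e_W right_unit \<rho> in auto)
  then have "open (P \<inter> Q \<inter> ball e \<rho>)" "e \<in> P \<inter> Q \<inter> ball e \<rho>" using \<rho> by auto
  then obtain \<delta> where \<delta>: "0 < \<delta>" "ball e \<delta> \<subseteq> P \<inter> Q \<inter> ball e \<rho>" by (rule openE)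
  have in_W: "(a, x) \<in> W \<and> m (a, x) \<in> ball e \<rho>" if "a \<in> ball e \<delta>" "x \<in> ball e \<delta>" for a x
  proof -
    have "(a, x) \<in> P \<times> Q" using that \<delta>(2) by auto
    then show ?thesis using PQ(4) by auto
  qed
  have "f (m (a, x)) = f a + f x" if a: "a \<in> ball e \<delta>" and x: "x \<in> ball e \<delta>" for a x
  proof -
    have "((\<lambda>x. f (m (a, x)) - f x) has_derivative (\<lambda>v. 0)) (at x)" if x: "x \<in> ball e \<delta>" for x
    proof -
      have W: "(a, x) \<in> W" "m (a, x) \<in> ball e \<rho>" "m (a, x) \<in> frame_dom" "x \<in> frame_dom" "x \<in> ball e \<rho>"
        using in_W[OF a x] \<rho>(1) \<delta>(2) x by auto
      have "((\<lambda>x. f (m (a, x)) - f x) has_derivative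
          (\<lambda>v. \<omega> (m (a, x)) (frechet_derivative m (at (a, x)) (0, v)) - \<omega> x v)) (at x)"
        by (intro has_derivative_diff f W
            has_derivative_compose[OF has_derivative_m_snd[OF derivative_m[OF W(1)]]])
      moreover have "\<omega> (m (a, x)) (frechet_derivative m (at (a, x)) (0, v)) = \<omega> x v" for v
        using derivative_left_translation[OF W(1,4,3), of "\<omega> x v"]
        by (simp add: A_\<omega>[OF W(4)] \<omega>_A[OF W(3)])
      ultimately show ?thesis by simp
    qed
    then have "f (m (a, x)) - f x = f (m (a, e)) - f e"
      by (intro has_derivative_zero_unique[OF convex_ball[of e \<delta>], of "\<lambda>x. f (m (a, x)) - f x" x e])
        (use x \<delta> in \<open>auto intro: has_derivative_at_withinI\<close>)
    moreover have "m (a, e) = a"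
      using in_W[of a e] a \<delta>(1) by (intro right_unit) auto
    ultimately show ?thesis using f(2) by (simp add: algebra_simps)
  qed
  with in_W \<delta>(1) that show ?thesis by blast
qed

text \<open>A primitive \<open>f\<close> of \<open>\<omega>\<close> turns the product into vector addition, and \<open>\<omega> e\<close> is the identity, so
  the inverse function theorem makes \<open>f\<close> a chart around \<open>e\<close>. The radius \<open>\<epsilon>\<close> is chosen so small that
  products of two points \<open>g u\<close>, \<open>g w\<close> stay where \<open>f\<close> is additive and injective.\<close>

theorem canonical_coordinates:
  obtains N and V :: "'e set" and f g \<epsilon> where "open N" "e \<in> N" "open V" "homeomorphism N V f g"
    "smooth_on N f" "smooth_on V g" "f e = 0" "0 < \<epsilon>" "ball 0 \<epsilon> \<subseteq> V"
    "\<And>u w. u \<in> ball 0 \<epsilon> \<Longrightarrow> w \<in> ball 0 \<epsilon> \<Longrightarrow>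
      (g u, g w) \<in> W \<and> u + w \<in> V \<and> m (g u, g w) = g (u + w)"
proof -
  obtain \<rho> where \<rho>: "0 < \<rho>" "ball e \<rho> \<subseteq> frame_dom"
    using openE[OF open_frame_dom e_frame_dom] by blast
  let ?B = "ball e \<rho>"
  have BX: "x \<in> frame_dom" if "x \<in> ?B" for x using \<rho>(2) that by blast
  obtain f where f: "f e = 0" "\<And>x. x \<in> ?B \<Longrightarrow> (f has_derivative \<omega> x) (at x)"
    by (rule closed_one_form_has_primitive[of ?B e \<omega>])
      (use \<rho> linear_\<omega> BX smooth_on_subset[OF smooth_\<omega>] closed_\<omega> in auto)
  obtain \<delta> where \<delta>: "0 < \<delta>" "\<And>a x. a \<in> ball e \<delta> \<Longrightarrow> x \<in> ball e \<delta> \<Longrightarrow>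
      (a, x) \<in> W \<and> m (a, x) \<in> ?B \<and> f (m (a, x)) = f a + f x"
    by (rule primitive_additive[OF \<rho>(2,1) f(2,1)]) (assumption, (rule that; blast))
  have smooth_f: "smooth_on ?B f"
    by (rule smooth_onI_derivative[OF open_ball f(2)])
      (use smooth_on_subset[OF smooth_\<omega> \<rho>(2)] in auto)
  let ?f' = "\<lambda>x. Blinfun (\<omega> x)"
  have f': "blinfun_apply (?f' x) = \<omega> x" if "x \<in> ?B" for x
    using linear_\<omega>[OF BX[OF that]] by (simp add: bounded_linear_Blinfun_apply linear_conv_bounded_linear)
  have cont_f': "continuous_on ?B ?f'"
  proof (rule continuous_on_blinfun_componentwise)
    fix i :: 'e
    have "continuous_on ?B (\<lambda>x. \<omega> x i)"
      using smooth_on_imp_continuous_on[OF smooth_on_subset[OF smooth_\<omega> \<rho>(2)]] .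
    then show "continuous_on ?B (\<lambda>x. blinfun_apply (?f' x) i)"
      by (rule continuous_on_cong[THEN iffD1, rotated 2]) (simp_all add: f')
  qed
  have A_e: "A e v = v" for v
  proof -
    have "open ((\<lambda>y. (e, y)) -` W)" by (intro open_vimage open_W continuous_intros)
    then have "((\<lambda>y. m (e, y)) has_derivative (\<lambda>v. v)) (at e)"
      by (rule has_derivative_transform_within_open[OF has_derivative_ident])
        (use e_W left_unit in auto)
    from has_derivative_unique[OF has_derivative_A[OF e_W] this] show ?thesis by simp
  qed
  have Df: "(f has_derivative blinfun_apply (?f' x)) (at x)" if "x \<in> ?B" for x
    using f(2)[OF that] by (simp add: f'[OF that])
  have eB: "e \<in> ?B" using \<rho>(1) by simp
  have inv_e: "id_blinfun o\<^sub>L ?f' e = id_blinfun"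
    using \<omega>_A[OF e_frame_dom] f'[of e] \<rho>(1) by (intro blinfun_eqI) (simp add: A_e)
  obtain N V g g' where N: "open N" "N \<subseteq> ?B" "e \<in> N" "open V" "f e \<in> V" "homeomorphism N V f g"
    and Dg: "\<And>y. y \<in> V \<Longrightarrow> (g has_derivative g' y) (at y)"
    and g': "\<And>y. y \<in> V \<Longrightarrow> g' y = inv_into UNIV (blinfun_apply (?f' (g y)))"
    apply (rule inverse_function_theorem[OF open_ball Df cont_f' eB inv_e], assumption)
    subgoal for N V g g' by (rule that[of N V g g']) blast+
    done
  have gN: "g y \<in> N" if "y \<in> V" for y
    using N(6) that by (auto simp: homeomorphism_def)
  have gB: "g y \<in> ?B" if "y \<in> V" for y
    using gN[OF that] N(2) by blast
  have g'_A: "g' y = A (g y)" if "y \<in> V" for y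
    unfolding g'[OF that] f'[OF gB[OF that]]
    by (rule inv_unique_comp) (simp_all add: fun_eq_iff A_\<omega> \<omega>_A BX[OF gB[OF that]])
  \<comment> \<open>The inverse solves \<open>Dg = A \<circ> g\<close>, so it inherits the smoothness of \<open>A\<close> degree by degree.\<close>
  have "Ck_on k V g" for k
  proof (induction k)
    case 0
    then show ?case using N(6) by (simp add: homeomorphism_def)
  next
    case (Suc k)
    show ?case
    proof (rule Ck_on_SucI[OF N(4) Dg])
      fix v
      have "Ck_on k V (\<lambda>y. A (g y) v)"
        by (rule Ck_on_compose[OF N(4) _ _ Suc.IH, of frame_dom])
          (use smooth_A BX gB in \<open>auto simp: smooth_on_def\<close>)
      then show "Ck_on k V (\<lambda>y. g' y v)"
        by (rule Ck_on_cong[OF N(4), rotated]) (simp add: g'_A)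
    qed
  qed
  then have smooth_g: "smooth_on V g" by (simp add: smooth_on_def)
  have g0: "g 0 = e" "0 \<in> V"
    using N(3,5,6) f(1) by (auto simp: homeomorphism_def)
  define Z where "Z = {p \<in> V \<times> V. g (fst p) \<in> ball e \<delta> \<and> g (snd p) \<in> ball e \<delta> \<and>
      (g (fst p), g (snd p)) \<in> W \<and> m (g (fst p), g (snd p)) \<in> N \<and> fst p + snd p \<in> V}"
  have "open Z"
  proof -
    have cg: "continuous_on V g" by (rule smooth_on_imp_continuous_on[OF smooth_g])
    have c2: "continuous_on (V \<times> V) (\<lambda>p. (g (fst p), g (snd p)))"
      by (intro continuous_on_Pair continuous_on_compose2[OF cg] continuous_intros) auto
    have oW: "open (W \<inter> m -` N)"
      using smooth_on_imp_continuous_on[OF smooth_m] open_W N(1) by (intro continuous_open_preimage) auto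
    have Z: "Z = (V \<times> V) \<inter> (\<lambda>p. (g (fst p), g (snd p))) -` ((ball e \<delta> \<times> ball e \<delta>) \<inter> (W \<inter> m -` N))
        \<inter> ((\<lambda>p. fst p + snd p) -` V)"
      by (auto simp: Z_def)
    show ?thesis
      unfolding Z
      by (intro open_Int continuous_open_preimage[OF c2] open_Times open_vimage oW N(4)
          open_ball continuous_intros)
  qed
  moreover have "(0, 0) \<in> Z"
    using g0 \<delta>(1) e_W right_unit[OF e_W] N(3) by (simp add: Z_def)
  ultimately obtain P Q where PQ: "open P" "open Q" "(0, 0) \<in> P \<times> Q" "P \<times> Q \<subseteq> Z"
    by (rule open_prod_elim)
  then have "open (P \<inter> Q)" "0 \<in> P \<inter> Q" by auto
  then obtain \<epsilon> where \<epsilon>: "0 < \<epsilon>" "ball 0 \<epsilon> \<subseteq> P \<inter> Q" by (rule openE)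
  have in_Z: "(u, w) \<in> Z" if "u \<in> ball 0 \<epsilon>" "w \<in> ball 0 \<epsilon>" for u w
    using PQ(4) \<epsilon>(2) that by blast
  have "(g u, g w) \<in> W \<and> u + w \<in> V \<and> m (g u, g w) = g (u + w)"
    if u: "u \<in> ball 0 \<epsilon>" and w: "w \<in> ball 0 \<epsilon>" for u w
  proof -
    have z: "u \<in> V" "w \<in> V" "g u \<in> ball e \<delta>" "g w \<in> ball e \<delta>" "(g u, g w) \<in> W"
      "m (g u, g w) \<in> N" "u + w \<in> V"
      using in_Z[OF u w] by (auto simp: Z_def)
    have "f (m (g u, g w)) = f (g u) + f (g w)"
      using \<delta>(2)[OF z(3,4)] by blast
    also have "\<dots> = u + w"
      using N(6) z(1,2) by (simp add: homeomorphism_def)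
    finally have "g (f (m (g u, g w))) = g (u + w)" by simp
    moreover have "g (f (m (g u, g w))) = m (g u, g w)"
      using N(6) z(6) by (simp add: homeomorphism_def)
    ultimately show ?thesis using z by simp
  qed
  moreover have "ball 0 \<epsilon> \<subseteq> V"
    using in_Z by (auto simp: Z_def)
  ultimately show ?thesis
    using that[OF N(1,3,4,6) smooth_on_subset[OF smooth_f N(2)] smooth_g f(1) \<epsilon>(1)] by blast
qed

end

section \<open>From a local to a global isomorphism\<close>

text \<open>Two constant loops are freely homotopic, and such a homotopy traces a path from one point to the
  other.\<close>

lemma simply_connected_space_imp_connected:
  fixes S :: "'a::topological_space set"
  assumes "simply_connected S"
  shows "connected S"
proof (rule path_connected_imp_connected, unfold path_connected_def, intro ballI)
  fix a b assume "a \<in> S" "b \<in> S"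
  then have "homotopic_loops S (\<lambda>t. a) (\<lambda>t. b)"
    by (intro assms[unfolded simply_connected_def, rule_format])
      (auto simp: path_def pathfinish_def pathstart_def path_image_def)
  then obtain h where h: "continuous_on ({0..1::real} \<times> {0..1::real}) h"
    "h ` ({0..1} \<times> {0..1}) \<subseteq> S" "\<forall>t\<in>{0..1}. h (0, t) = a" "\<forall>t\<in>{0..1}. h (1, t) = b"
    unfolding homotopic_loops image_subset_iff_funcset by blast
  have "continuous_on {0..1} (\<lambda>s. h (s, 0))"
    by (rule continuous_on_compose2[OF h(1)]) (auto intro!: continuous_intros)
  then show "\<exists>g. path g \<and> path_image g \<subseteq> S \<and> pathstart g = a \<and> pathfinish g = b"
    using h(2-4)
    by (intro exI[of _ "\<lambda>s. h (s, 0)"])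
      (auto simp: path_def path_image_def pathstart_def pathfinish_def)
qed

text \<open>The topological data from which an isomorphism with a vector group is built: a local
  homomorphism \<open>\<sigma>\<close> from a ball, the exponential map near \<open>0\<close>, and its continuous local inverse \<open>F\<close>,
  the logarithm.\<close>

locale local_exponential = group G for G :: "('g::t2_space, 'x) monoid_scheme" (structure) +
  fixes \<sigma> :: "'e::euclidean_space \<Rightarrow> 'g" and F :: "'g \<Rightarrow> 'e" and \<epsilon> :: real
  assumes open_carrier: "open (carrier G)"
    and continuous_mult: "continuous_on (carrier G \<times> carrier G) (\<lambda>(x, y). x \<otimes> y)"
    and continuous_inv: "continuous_on (carrier G) (\<lambda>x. inv x)"
    and \<epsilon>_pos: "0 < \<epsilon>"
    and \<sigma>_closed: "u \<in> ball 0 \<epsilon> \<Longrightarrow> \<sigma> u \<in> carrier G"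
    and open_range_\<sigma>: "open (\<sigma> ` ball 0 \<epsilon>)"
    and continuous_\<sigma>: "continuous_on (ball 0 \<epsilon>) \<sigma>"
    and continuous_F: "continuous_on (\<sigma> ` ball 0 \<epsilon>) F"
    and F_\<sigma>: "u \<in> ball 0 \<epsilon> \<Longrightarrow> F (\<sigma> u) = u"
    and \<sigma>_add: "u \<in> ball 0 \<epsilon> \<Longrightarrow> w \<in> ball 0 \<epsilon> \<Longrightarrow> u + w \<in> ball 0 \<epsilon> \<Longrightarrow>
      \<sigma> (u + w) = \<sigma> u \<otimes> \<sigma> w"
begin

lemma \<sigma>_0: "\<sigma> 0 = \<one>"
  using \<sigma>_add[of 0 0] \<sigma>_closed[of 0] \<epsilon>_pos by (simp add: r_cancel_one')

lemma \<sigma>_scale: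
  assumes "norm (real k *\<^sub>R w) < \<epsilon>"
  shows "\<sigma> (real k *\<^sub>R w) = \<sigma> w [^] k"
  using assms
proof (induction k)
  case (Suc k)
  have le: "real k * norm w \<le> real (Suc k) * norm w" "norm w \<le> real (Suc k) * norm w"
    by (auto simp: algebra_simps)
  then have "norm (real k *\<^sub>R w) < \<epsilon>" "norm w < \<epsilon>"
    using Suc.prems by auto
  moreover have "real (Suc k) *\<^sub>R w = real k *\<^sub>R w + w" by (simp add: algebra_simps)
  ultimately show ?case
    using Suc \<sigma>_add[of "real k *\<^sub>R w" w] by simp
qed (simp add: \<sigma>_0)

text \<open>Any \<open>n\<close> with \<open>v / n\<close> in the ball gives the same value (\<open>E_eq\<close> below), and the \<open>n\<close> taken
  here is one of them.\<close>

definition E :: "'e \<Rightarrow> 'g" where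
  "E v = (let n = Suc (nat \<lceil>norm v / \<epsilon>\<rceil>) in \<sigma> (v /\<^sub>R real n) [^] n)"

lemma E_eq:
  assumes "norm v < real n * \<epsilon>"
  shows "E v = \<sigma> (v /\<^sub>R real n) [^] n"
proof -
  define k where "k = Suc (nat \<lceil>norm v / \<epsilon>\<rceil>)"
  have "norm v / \<epsilon> < real k" unfolding k_def by linarith
  then have k: "norm v < real k * \<epsilon>" "0 < k" using \<epsilon>_pos by (simp_all add: field_simps k_def)
  have n: "0 < n"
    using assms norm_ge_zero[of v] by (cases n) auto
  \<comment> \<open>Two admissible subdivisions agree with their common refinement.\<close>
  have refine: "\<sigma> (v /\<^sub>R real a) [^] a = \<sigma> (v /\<^sub>R real (a * b)) [^] (a * b)"
    if "norm v < real a * \<epsilon>" "0 < a" "0 < b" for a b :: nat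
  proof -
    let ?w = "v /\<^sub>R real (a * b)"
    have w: "v /\<^sub>R real a = real b *\<^sub>R ?w" using that by simp
    have va: "norm (v /\<^sub>R real a) < \<epsilon>"
      using that by (simp add: field_simps)
    moreover have "norm ?w \<le> norm (v /\<^sub>R real a)"
    proof -
      have "real a * 1 \<le> real a * real b" using that by (intro mult_left_mono) auto
      then have "inverse (real a * real b) \<le> inverse (real a)"
        using that by (intro le_imp_inverse_le) auto
      then show ?thesis by (auto intro: mult_right_mono)
    qed
    ultimately have "\<sigma> ?w \<in> carrier G" by (intro \<sigma>_closed) auto
    then show ?thesis
      using \<sigma>_scale[of b ?w] va unfolding w by (simp add: nat_pow_pow mult.commute)
  qed
  have "E v = \<sigma> (v /\<^sub>R real k) [^] k" by (simp add: E_def k_def Let_def)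
  also have "\<dots> = \<sigma> (v /\<^sub>R real n) [^] n"
    using refine[OF k n] refine[OF assms n k(2)] by (simp add: mult.commute)
  finally show ?thesis .
qed

lemma E_\<sigma>: "u \<in> ball 0 \<epsilon> \<Longrightarrow> E u = \<sigma> u"
  using E_eq[of u 1] \<sigma>_closed by simp

lemma E_0: "E 0 = \<one>"
  using E_\<sigma>[of 0] \<epsilon>_pos by (simp add: \<sigma>_0)

lemma subdivision: "\<exists>n. norm v < real n * \<epsilon>"
  using reals_Archimedean3[OF \<epsilon>_pos] by blast

lemma small_multiple:
  assumes "norm v < real n * \<epsilon>"
  shows "v /\<^sub>R real n \<in> ball 0 \<epsilon>"
proof -
  have "0 < n" using assms norm_ge_zero[of v] by (cases n) auto
  then show ?thesis using assms by (simp add: field_simps)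
qed

lemma E_closed: "E v \<in> carrier G"
proof -
  obtain n where n: "norm v < real n * \<epsilon>" using subdivision by blast
  then show ?thesis using E_eq[OF n] \<sigma>_closed[OF small_multiple[OF n]] by simp
qed

text \<open>For a common large \<open>n\<close> the elements \<open>\<sigma> (u / n)\<close> and \<open>\<sigma> (v / n)\<close> commute, since \<open>\<sigma>\<close> maps
  sums to products in either order; so the \<open>n\<close>-th power of their product splits.\<close>

lemma E_add: "E (u + v) = E u \<otimes> E v"
proof -
  obtain n where n: "norm u + norm v < real n * \<epsilon>"
    using reals_Archimedean3[OF \<epsilon>_pos] by blast
  then have nu: "norm u < real n * \<epsilon>" and nv: "norm v < real n * \<epsilon>" and nuv: "norm (u + v) < real n * \<epsilon>"
    using norm_ge_zero[of u] norm_ge_zero[of v] norm_triangle_ineq[of u v] by linarith+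
  note s = small_multiple[OF nu] small_multiple[OF nv] small_multiple[OF nuv]
  have "\<sigma> (u /\<^sub>R real n + v /\<^sub>R real n) = \<sigma> (u /\<^sub>R real n) \<otimes> \<sigma> (v /\<^sub>R real n)"
    using s by (intro \<sigma>_add) (simp_all add: scaleR_add_right)
  moreover have "\<sigma> (v /\<^sub>R real n + u /\<^sub>R real n) = \<sigma> (v /\<^sub>R real n) \<otimes> \<sigma> (u /\<^sub>R real n)"
    using s by (intro \<sigma>_add) (simp_all add: scaleR_add_right add.commute)
  ultimately show ?thesis
    using pow_mult_distrib[of "\<sigma> (u /\<^sub>R real n)" "\<sigma> (v /\<^sub>R real n)" n] \<sigma>_closed[OF s(1)] \<sigma>_closed[OF s(2)]
    by (simp add: E_eq[OF nu] E_eq[OF nv] E_eq[OF nuv] scaleR_add_right add.commute)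
qed

lemma E_uminus: "E (- v) = inv E v"
  using E_add[of "- v" v] by (simp add: E_0 E_closed inv_equality)

lemma E_diff: "E (u - v) = E u \<otimes> inv E v"
  using E_add[of u "- v"] by (simp add: E_uminus)

lemma E_F: "x \<in> \<sigma> ` ball 0 \<epsilon> \<Longrightarrow> E (F x) = x"
  using F_\<sigma> E_\<sigma> by auto

lemma E_locally_inj:
  assumes "E a = E b" "norm (a - b) < \<epsilon>"
  shows "a = b"
proof -
  have "\<sigma> (a - b) = \<sigma> 0"
    using assms E_\<sigma>[of "a - b"] E_diff[of a b] by (simp add: E_closed \<sigma>_0)
  then have "a - b = 0" using F_\<sigma>[of "a - b"] F_\<sigma>[of 0] assms(2) \<epsilon>_pos by simp
  then show ?thesis by simp
qed

lemma continuous_translation: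
  assumes "a \<in> carrier G"
  shows "continuous_on (carrier G) (\<lambda>x. a \<otimes> x)"
proof -
  have "continuous_on (carrier G) (\<lambda>x. case (a, x) of (x, y) \<Rightarrow> x \<otimes> y)"
    by (rule continuous_on_compose2[OF continuous_mult])
      (use assms in \<open>auto intro: continuous_on_Pair continuous_on_const continuous_on_id\<close>)
  then show ?thesis by simp
qed

lemma open_translation:
  assumes "a \<in> carrier G" "open S" "S \<subseteq> carrier G"
  shows "open ((\<lambda>x. a \<otimes> x) ` S)"
proof -
  have "(\<lambda>x. a \<otimes> x) ` S = carrier G \<inter> (\<lambda>x. inv a \<otimes> x) -` S"
  proof (intro equalityI subsetI)
    fix y assume y: "y \<in> carrier G \<inter> (\<lambda>x. inv a \<otimes> x) -` S"
    then have "y = a \<otimes> (inv a \<otimes> y)" using assms(1) by (simp add: m_assoc[symmetric])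
    then show "y \<in> (\<lambda>x. a \<otimes> x) ` S" using y by blast
  qed (use assms in \<open>auto simp: m_assoc[symmetric] subset_iff\<close>)
  then show ?thesis
    using continuous_open_preimage[OF continuous_translation open_carrier assms(2)] assms(1) by simp
qed

lemma E_near: "norm (v - v0) < \<epsilon> \<Longrightarrow> E v = E v0 \<otimes> \<sigma> (v - v0)"
  using E_add[of v0 "v - v0"] E_\<sigma>[of "v - v0"] by simp

lemma continuous_E: "continuous_on UNIV E"
proof (rule continuous_at_imp_continuous_on, rule ballI)
  fix v0 :: 'e
  have "continuous_on (ball v0 \<epsilon>) (\<lambda>v. E v0 \<otimes> \<sigma> (v - v0))"
    by (intro continuous_on_compose2[OF continuous_translation[OF E_closed]]
        continuous_on_compose2[OF continuous_\<sigma>] continuous_intros)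
      (auto simp: dist_norm norm_minus_commute intro!: \<sigma>_closed)
  then have "continuous_on (ball v0 \<epsilon>) E"
    by (rule continuous_on_cong[THEN iffD1, rotated 2])
      (auto simp: E_near dist_norm norm_minus_commute)
  then show "isCont E v0"
    using \<epsilon>_pos by (simp add: continuous_on_eq_continuous_at)
qed

text \<open>The image of \<open>E\<close> is an open subgroup; its cosets partition the group into open sets.\<close>

lemma E_surj:
  assumes "connected (carrier G)"
  shows "range E = carrier G"
proof (rule ccontr)
  assume ne: "range E \<noteq> carrier G"
  have op: "open ((\<lambda>x. a \<otimes> x) ` range E)" if a: "a \<in> carrier G" for a
  proof -
    have "(\<lambda>x. a \<otimes> x) ` range E = (\<Union>v. (\<lambda>x. (a \<otimes> E v) \<otimes> x) ` (\<sigma> ` ball 0 \<epsilon>))"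
    proof (intro equalityI subsetI)
      fix y assume "y \<in> (\<Union>v. (\<lambda>x. (a \<otimes> E v) \<otimes> x) ` (\<sigma> ` ball 0 \<epsilon>))"
      then obtain v u where "u \<in> ball 0 \<epsilon>" "y = (a \<otimes> E v) \<otimes> \<sigma> u" by auto
      then have "y = a \<otimes> E (v + u)"
        using a by (simp add: E_add E_\<sigma> E_closed m_assoc \<sigma>_closed)
      then show "y \<in> (\<lambda>x. a \<otimes> x) ` range E" by blast
    next
      fix y assume "y \<in> (\<lambda>x. a \<otimes> x) ` range E"
      then obtain v where "y = a \<otimes> E v" by auto
      then have "y = (a \<otimes> E v) \<otimes> \<sigma> 0" using a by (simp add: \<sigma>_0 E_closed)
      moreover have "(0::'e) \<in> ball 0 \<epsilon>" using \<epsilon>_pos by simp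
      ultimately show "y \<in> (\<Union>v. (\<lambda>x. (a \<otimes> E v) \<otimes> x) ` (\<sigma> ` ball 0 \<epsilon>))" by blast
    qed
    then show ?thesis
      using a \<sigma>_closed
      by (auto intro!: open_UN open_translation open_range_\<sigma> simp: E_closed)
  qed
  have sub: "range E \<subseteq> carrier G" using E_closed by auto
  have "(\<lambda>x. \<one> \<otimes> x) ` range E = range E" using E_closed by (auto simp: image_image)
  then have o1: "open (range E)" using op[OF one_closed] by simp
  define R where "R = (\<Union>a\<in>carrier G - range E. (\<lambda>x. a \<otimes> x) ` range E)"
  have o2: "open R" unfolding R_def using op by auto
  have disj: "range E \<inter> R = {}"
  proof -
    have "a \<in> range E" if "a \<in> carrier G" "E v = a \<otimes> E w" for a v w
    proof -
      have "a = E (v - w)"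
        using that by (simp add: E_diff E_closed m_assoc)
      then show ?thesis by simp
    qed
    then show ?thesis unfolding R_def by auto
  qed
  have cover: "carrier G \<subseteq> range E \<union> R"
  proof
    fix x assume x: "x \<in> carrier G"
    have "x = x \<otimes> E 0" using x by (simp add: E_0)
    then show "x \<in> range E \<union> R" unfolding R_def using x by blast
  qed
  obtain x where "x \<in> carrier G" "x \<notin> range E" using ne sub by blast
  then have "R \<inter> carrier G \<noteq> {}" using cover by blast
  moreover have "range E \<inter> carrier G \<noteq> {}" using sub by auto
  moreover have "range E \<inter> R \<inter> carrier G = {}" using disj by simp
  ultimately show False
    using connectedD[OF assms o1 o2 _ cover] by blast
qed

text \<open>Homotopy lifting along \<open>E\<close>. Here the group structure provides an explicit lift: telescope
  \<open>h p\<close> along the segment from \<open>0\<close> to \<open>p\<close> into factors so close to the identity that \<open>F\<close> is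
  defined on them, and add up their coordinates.\<close>

lemma lift_exists:
  fixes K :: "'k::euclidean_space set"
  assumes K: "compact K" "0 \<in> K" and star: "\<And>p s. p \<in> K \<Longrightarrow> 0 \<le> s \<Longrightarrow> s \<le> 1 \<Longrightarrow> s *\<^sub>R p \<in> K"
    and h: "continuous_on K h" "h ` K \<subseteq> carrier G" "h 0 = \<one>"
  obtains H where "continuous_on K H" "\<And>p. p \<in> K \<Longrightarrow> E (H p) = h p"
proof -
  let ?N = "\<sigma> ` ball 0 \<epsilon>"
  have hc: "h p \<in> carrier G" if "p \<in> K" for p using h(2) that by blast
  have cont: "continuous_on T (\<lambda>x. inv h (a x) \<otimes> h (b x))"
    if "continuous_on T a" "continuous_on T b" "a ` T \<subseteq> K" "b ` T \<subseteq> K"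
    for T :: "'t::topological_space set" and a b :: "'t \<Rightarrow> 'k"
  proof -
    have "continuous_on T (\<lambda>x. (inv h (a x), h (b x)))"
      by (intro continuous_on_Pair continuous_on_compose2[OF continuous_inv]
          continuous_on_compose2[OF h(1)] that) (use that hc in auto)
    then show ?thesis
      using continuous_on_compose2[OF continuous_mult, of T "\<lambda>x. (inv h (a x), h (b x))"] that hc
      by (auto simp: image_subset_iff)
  qed
  \<comment> \<open>A Lebesgue number of this family, a cover of \<open>K\<close>, bounds the step below which the factors lie in the domain of \<open>F\<close>.\<close>
  define C where "C = {B. open B \<and> (\<forall>p\<in>B \<inter> K. \<forall>q\<in>B \<inter> K. inv h p \<otimes> h q \<in> ?N)}"
  have "\<exists>B\<in>C. p \<in> B" if p: "p \<in> K" for p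
  proof -
    have "continuous_on (K \<times> K) (\<lambda>x. inv h (fst x) \<otimes> h (snd x))"
      by (rule cont) (auto intro!: continuous_intros)
    then obtain T where T: "open T" "T \<inter> (K \<times> K) = (\<lambda>x. inv h (fst x) \<otimes> h (snd x)) -` ?N \<inter> (K \<times> K)"
      using open_range_\<sigma> unfolding continuous_on_open_invariant by blast
    have "\<one> \<in> ?N" using \<sigma>_0 \<epsilon>_pos by (metis centre_in_ball image_eqI)
    then have "(p, p) \<in> T \<inter> (K \<times> K)" unfolding T(2) using p by (simp add: hc)
    then have "(p, p) \<in> T" by simp
    then obtain P Q where PQ: "open P" "open Q" "(p, p) \<in> P \<times> Q" "P \<times> Q \<subseteq> T"
      using open_prod_elim[OF T(1)] by metis
    have "inv h a \<otimes> h b \<in> ?N" if "a \<in> P \<inter> Q \<inter> K" "b \<in> P \<inter> Q \<inter> K" for a b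
    proof -
      have "(a, b) \<in> T \<inter> (K \<times> K)" using that PQ(4) by auto
      then show ?thesis unfolding T(2) by simp
    qed
    then have "P \<inter> Q \<in> C" using PQ by (auto simp: C_def)
    then show ?thesis using PQ(3) by auto
  qed
  then have cover: "K \<subseteq> \<Union>C" by blast
  moreover have "C \<noteq> {}" using cover K(2) by blast
  moreover have "open B" if "B \<in> C" for B using that by (simp add: C_def)
  ultimately obtain \<delta> where \<delta>: "0 < \<delta>" "\<And>T. T \<subseteq> K \<Longrightarrow> diameter T < \<delta> \<Longrightarrow> \<exists>B\<in>C. T \<subseteq> B"
    using Lebesgue_number_lemma[OF K(1)] by metis
  have close: "inv h p \<otimes> h q \<in> ?N" if pq: "p \<in> K" "q \<in> K" "norm (p - q) < \<delta>" for p q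
  proof -
    have "diameter {p, q} \<le> norm (p - q)"
      by (rule diameter_le) (auto simp: norm_minus_commute)
    then obtain B where "B \<in> C" "{p, q} \<subseteq> B" using \<delta>(2)[of "{p, q}"] pq by auto
    then show ?thesis using pq by (auto simp: C_def)
  qed
  obtain M where M: "\<And>p. p \<in> K \<Longrightarrow> norm p \<le> M"
    using compact_imp_bounded[OF K(1)] bounded_iff by blast
  obtain n :: nat where n: "M < real n * \<delta>" using reals_Archimedean3[OF \<delta>(1)] by blast
  have "0 \<le> M" using M[OF K(2)] by simp
  then have n0: "0 < n" using n by (cases n) auto
  define c where "c k p = (real k / real n) *\<^sub>R p" for k and p :: 'k
  have cK: "c k p \<in> K" if "p \<in> K" "k \<le> n" for k p
    unfolding c_def using that n0 by (intro star) auto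
  define x where "x k p = inv h (c k p) \<otimes> h (c (Suc k) p)" for k p
  have xN: "x k p \<in> ?N" if "p \<in> K" "k < n" for k p
  proof -
    have "c k p - c (Suc k) p = - (p /\<^sub>R real n)"
      using n0 by (simp add: c_def scaleR_left_diff_distrib[symmetric] diff_divide_distrib[symmetric] field_simps)
    then have "norm (c k p - c (Suc k) p) = norm p / real n" by (simp add: divide_inverse)
    also have "\<dots> < \<delta>" using M[OF that(1)] n n0 by (simp add: field_simps)
    finally show ?thesis unfolding x_def using that by (intro close cK) auto
  qed
  define H where "H p = (\<Sum>k<n. F (x k p))" for p
  have "continuous_on K H"
    unfolding H_def
  proof (intro continuous_on_sum)
    fix k assume k: "k \<in> {..<n}"
    have "continuous_on K (x k)"
      unfolding x_def
      by (rule cont) (use k cK in \<open>auto simp del: of_nat_Suc simp: c_def intro!: continuous_intros\<close>)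
    then show "continuous_on K (\<lambda>p. F (x k p))"
      by (rule continuous_on_compose2[OF continuous_F]) (use xN k in auto)
  qed
  moreover have "E (H p) = h p" if p: "p \<in> K" for p
  proof -
    have "E (\<Sum>k<j. F (x k p)) = h (c j p)" if "j \<le> n" for j
      using that
    proof (induction j)
      case 0
      then show ?case by (simp add: E_0 c_def h(3))
    next
      case (Suc j)
      have "E (\<Sum>k<Suc j. F (x k p)) = h (c j p) \<otimes> x j p"
        using Suc xN[OF p, of j] by (simp add: E_add E_F)
      also have "\<dots> = h (c (Suc j) p)"
        using Suc.prems by (simp add: x_def m_assoc[symmetric] hc cK p)
      finally show ?case .
    qed
    from this[of n] show ?thesis using n0 by (simp add: H_def c_def)
  qed
  ultimately show ?thesis using that by blast
qed

text \<open>Two points with the same image under \<open>E\<close> are equal or at least \<open>\<epsilon>\<close> apart, so each fibre of \<open>k\<close>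
  is both open and closed in \<open>S\<close>.\<close>

lemma lift_unique:
  assumes "connected S" "continuous_on S k" "\<And>x y. x \<in> S \<Longrightarrow> y \<in> S \<Longrightarrow> E (k x) = E (k y)"
    and "x \<in> S" "y \<in> S"
  shows "k x = k y"
proof -
  let ?T = "S \<inter> k -` {k x}"
  have "?T = S \<inter> k -` ball (k x) \<epsilon>"
    using E_locally_inj[OF assms(3)[OF _ assms(4)]] \<epsilon>_pos
    by (auto simp: dist_norm norm_minus_commute)
  then have "openin (top_of_set S) ?T"
    using continuous_openin_preimage_gen[OF assms(2) open_ball] by simp
  moreover have "closedin (top_of_set S) ?T"
    by (intro continuous_closedin_preimage assms(2)) simp
  ultimately have "?T = S"
    using assms(1,4) unfolding connected_clopen by blast
  then have "y \<in> ?T" using assms(5) by simp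
  then show ?thesis by simp
qed

text \<open>A vector \<open>v\<close> with \<open>E v = \<one>\<close> gives the loop \<open>t \<mapsto> E (t v)\<close>. Lifting a null-homotopy of it shows
  that the lift \<open>t \<mapsto> t v\<close> of the loop is closed as well.\<close>

lemma E_kernel_trivial:
  assumes "simply_connected (carrier G)" "E v = \<one>"
  shows "v = 0"
proof -
  let ?I = "{0..1::real}"
  have "continuous_on ?I (\<lambda>t. E (t *\<^sub>R v))"
    by (intro continuous_on_compose2[OF continuous_E] continuous_intros) auto
  then have "homotopic_loops (carrier G) (\<lambda>t. E (t *\<^sub>R v)) (\<lambda>t. \<one>)"
    by (intro assms(1)[unfolded simply_connected_def, rule_format])
      (auto simp: path_def pathfinish_def pathstart_def path_image_def E_closed E_0 assms(2))
  then obtain h where h: "continuous_on (?I \<times> ?I) h" "h ` (?I \<times> ?I) \<subseteq> carrier G"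
    "\<forall>t\<in>?I. h (0, t) = E (t *\<^sub>R v)" "\<forall>t\<in>?I. h (1, t) = \<one>" "\<forall>s\<in>?I. h (s, 1) = h (s, 0)"
    unfolding homotopic_loops pathfinish_def pathstart_def comp_def image_subset_iff_funcset
    by blast
  obtain H where H: "continuous_on (?I \<times> ?I) H" "\<And>p. p \<in> ?I \<times> ?I \<Longrightarrow> E (H p) = h p"
    by (rule lift_exists[of "?I \<times> ?I" h])
      (use h in \<open>auto simp: E_0 zero_prod_def mult_le_one intro: compact_Times\<close>)
  have cH: "continuous_on ?I (\<lambda>x. H (a x))" if "continuous_on ?I a" "a ` ?I \<subseteq> ?I \<times> ?I" for a
    using continuous_on_compose2[OF H(1) that] .
  \<comment> \<open>The homotopy runs through loops, so the endpoints of the lifts differ by a kernel element, which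
    is constant along the homotopy and zero at its constant end.\<close>
  have "H (0, 1) - H (0, 0) = H (1, 1) - H (1, 0)"
    by (rule lift_unique[of ?I "\<lambda>s. H (s, 1) - H (s, 0)"])
      (use h H(2) in \<open>auto simp: E_diff image_subset_iff intro!: cH continuous_intros\<close>)
  moreover have "H (1, 1) = H (1, 0)"
    by (rule lift_unique[of ?I "\<lambda>t. H (1, t)"])
      (use h H(2) in \<open>auto intro!: cH continuous_intros\<close>)
  moreover have "H (0, 1) - 1 *\<^sub>R v = H (0, 0) - 0 *\<^sub>R v"
    by (rule lift_unique[of ?I "\<lambda>t. H (0, t) - t *\<^sub>R v"])
      (use h H(2) in \<open>auto simp: E_diff E_closed intro!: cH continuous_intros\<close>)
  ultimately show ?thesis by simp
qed

lemma E_bij: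
  assumes "simply_connected (carrier G)"
  shows "bij_betw E UNIV (carrier G)"
proof -
  have "u = v" if "E u = E v" for u v
    using E_kernel_trivial[OF assms, of "u - v"] that by (simp add: E_diff E_closed)
  then show ?thesis
    using E_surj[OF simply_connected_space_imp_connected[OF assms]]
    by (auto simp: bij_betw_def inj_on_def)
qed

end

section \<open>Charts and smooth functions on manifolds\<close>

text \<open>The topological half of \<^const>\<open>smooth_atlas\<close>. It suffices for pulling back smooth functions, and
  it passes to products without any calculus.\<close>

definition topological_atlas ::
  "('a::topological_space, 'e::euclidean_space) atlas \<Rightarrow> bool" where
  "topological_atlas A \<longleftrightarrow>
     (\<forall>(U, \<phi>)\<in>A. open U \<and> open (\<phi> ` U) \<and> homeomorphism U (\<phi> ` U) \<phi> (inv_into U \<phi>))"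

lemma smooth_atlas_imp_topological_atlas: "smooth_atlas A \<Longrightarrow> topological_atlas A"
  by (simp add: smooth_atlas_def topological_atlas_def)

lemma topological_atlasD:
  assumes "topological_atlas A" "(U, \<phi>) \<in> A"
  shows "open U" "open (\<phi> ` U)" "continuous_on U \<phi>" "continuous_on (\<phi> ` U) (inv_into U \<phi>)"
    "\<And>x. x \<in> \<phi> ` U \<Longrightarrow> inv_into U \<phi> x \<in> U" "\<And>x. x \<in> \<phi> ` U \<Longrightarrow> \<phi> (inv_into U \<phi> x) = x"
    "\<And>p. p \<in> U \<Longrightarrow> inv_into U \<phi> (\<phi> p) = p"
proof -
  have *: "open U" "open (\<phi> ` U)" and h: "homeomorphism U (\<phi> ` U) \<phi> (inv_into U \<phi>)"
    using assms by (auto simp: topological_atlas_def)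
  show "open U" "open (\<phi> ` U)" by (fact *)+
  show "continuous_on U \<phi>" "continuous_on (\<phi> ` U) (inv_into U \<phi>)"
    using h by (auto simp: homeomorphism_def)
  show "inv_into U \<phi> x \<in> U" "\<phi> (inv_into U \<phi> x) = x" if "x \<in> \<phi> ` U" for x
    using that by (auto intro: inv_into_into f_inv_into_f)
  show "inv_into U \<phi> (\<phi> p) = p" if "p \<in> U" for p
    using h that by (simp add: homeomorphism_def)
qed

lemma open_mcarrier: "topological_atlas A \<Longrightarrow> open (mcarrier A)"
  unfolding mcarrier_def by (rule open_UN) (use topological_atlasD(1) in auto)

lemma chart_subset_mcarrier: "(U, \<phi>) \<in> A \<Longrightarrow> U \<subseteq> mcarrier A"
  by (auto simp: mcarrier_def)

lemma mcarrier_chart: "p \<in> mcarrier A \<Longrightarrow> \<exists>U \<phi>. (U, \<phi>) \<in> A \<and> p \<in> U"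
  by (auto simp: mcarrier_def)

lemma chart_image_eq:
  assumes "topological_atlas A" "(U, \<phi>) \<in> A"
  shows "\<phi> ` (U \<inter> S) = \<phi> ` U \<inter> inv_into U \<phi> -` S"
proof (intro equalityI subsetI)
  fix x assume x: "x \<in> \<phi> ` U \<inter> inv_into U \<phi> -` S"
  then have "inv_into U \<phi> x \<in> U \<inter> S" "\<phi> (inv_into U \<phi> x) = x"
    using topological_atlasD(5,6)[OF assms] by auto
  then show "x \<in> \<phi> ` (U \<inter> S)" by (metis image_eqI)
qed (use topological_atlasD(7)[OF assms] in auto)

lemma open_chart_image:
  assumes "topological_atlas A" "(U, \<phi>) \<in> A" "open S"
  shows "open (\<phi> ` (U \<inter> S))"
  unfolding chart_image_eq[OF assms(1,2)]
  by (rule continuous_open_preimage[OF topological_atlasD(4,2)[OF assms(1,2)] assms(3)])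

lemma mem_product_atlas:
  "(U, \<phi>) \<in> A \<Longrightarrow> (V, \<psi>) \<in> B \<Longrightarrow> (U \<times> V, map_prod \<phi> \<psi>) \<in> product_atlas A B"
  unfolding product_atlas_def by force

lemma mcarrier_product_atlas: "mcarrier (product_atlas A B) = mcarrier A \<times> mcarrier B"
proof (intro equalityI subsetI)
  fix p assume "p \<in> mcarrier (product_atlas A B)"
  then show "p \<in> mcarrier A \<times> mcarrier B"
    by (fastforce simp: mcarrier_def product_atlas_def)
next
  fix p assume "p \<in> mcarrier A \<times> mcarrier B"
  then obtain U \<phi> V \<psi> where "(U, \<phi>) \<in> A" "(V, \<psi>) \<in> B" "p \<in> U \<times> V"
    using mcarrier_chart[of "fst p" A] mcarrier_chart[of "snd p" B] by (auto simp: mem_Times_iff)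
  then show "p \<in> mcarrier (product_atlas A B)"
    using chart_subset_mcarrier[OF mem_product_atlas] by blast
qed

lemma inv_into_map_prod:
  assumes A: "topological_atlas A" "(U, \<phi>) \<in> A" and B: "topological_atlas B" "(V, \<psi>) \<in> B"
    and "x \<in> \<phi> ` U" "y \<in> \<psi> ` V"
  shows "inv_into (U \<times> V) (map_prod \<phi> \<psi>) (x, y) = (inv_into U \<phi> x, inv_into V \<psi> y)"
proof (rule inv_into_f_eq)
  have "inj_on \<phi> U" "inj_on \<psi> V"
    using topological_atlasD(7)[OF A] topological_atlasD(7)[OF B] by (auto intro: inj_on_inverseI)
  then show "inj_on (map_prod \<phi> \<psi>) (U \<times> V)"
    by (auto simp: inj_on_def)
  show "(inv_into U \<phi> x, inv_into V \<psi> y) \<in> U \<times> V"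
    using assms(5,6) topological_atlasD(5)[OF A] topological_atlasD(5)[OF B] by blast
  show "map_prod \<phi> \<psi> (inv_into U \<phi> x, inv_into V \<psi> y) = (x, y)"
    using assms(5,6) topological_atlasD(6)[OF A] topological_atlasD(6)[OF B] by simp
qed

lemma topological_atlas_product:
  assumes A: "topological_atlas A" and B: "topological_atlas B"
  shows "topological_atlas (product_atlas A B)"
proof -
  have "open (U \<times> V) \<and> open (map_prod \<phi> \<psi> ` (U \<times> V)) \<and>
      homeomorphism (U \<times> V) (map_prod \<phi> \<psi> ` (U \<times> V)) (map_prod \<phi> \<psi>) (inv_into (U \<times> V) (map_prod \<phi> \<psi>))"
    if U: "(U, \<phi>) \<in> A" and V: "(V, \<psi>) \<in> B" for U \<phi> V \<psi>
  proof -
    note a = topological_atlasD[OF A U] and b = topological_atlasD[OF B V]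
    let ?i = "inv_into (U \<times> V) (map_prod \<phi> \<psi>)"
    have im: "map_prod \<phi> \<psi> ` (U \<times> V) = \<phi> ` U \<times> \<psi> ` V" by auto
    have i: "?i (x, y) = (inv_into U \<phi> x, inv_into V \<psi> y)" if "x \<in> \<phi> ` U" "y \<in> \<psi> ` V" for x y
      using inv_into_map_prod[OF A U B V that] .
    have "homeomorphism (U \<times> V) (\<phi> ` U \<times> \<psi> ` V) (map_prod \<phi> \<psi>) ?i"
    proof (rule homeomorphismI)
      show "continuous_on (U \<times> V) (map_prod \<phi> \<psi>)"
        unfolding map_prod_def case_prod_unfold
        by (intro continuous_on_Pair continuous_on_compose2[OF a(3)]
            continuous_on_compose2[OF b(3)] continuous_intros) auto
      have "continuous_on (\<phi> ` U \<times> \<psi> ` V) (\<lambda>p. (inv_into U \<phi> (fst p), inv_into V \<psi> (snd p)))"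
        by (intro continuous_on_Pair continuous_on_compose2[OF a(4)]
            continuous_on_compose2[OF b(4)] continuous_intros) auto
      then show "continuous_on (\<phi> ` U \<times> \<psi> ` V) ?i"
        by (rule continuous_on_cong[THEN iffD1, rotated 2]) (auto simp: i)
      show "?i ` (\<phi> ` U \<times> \<psi> ` V) \<subseteq> U \<times> V" using i a(5) b(5) by auto
      show "?i (map_prod \<phi> \<psi> p) = p" if "p \<in> U \<times> V" for p
        using that i a(7) b(7) by auto
      show "map_prod \<phi> \<psi> (?i p) = p" if "p \<in> \<phi> ` U \<times> \<psi> ` V" for p
        using that i a(6) b(6) by auto
    qed auto
    then show ?thesis using a(1,2) b(1,2) unfolding im by (auto intro: open_Times)
  qed
  then show ?thesis
    unfolding topological_atlas_def product_atlas_def by fastforce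
qed

lemma smooth_funD:
  "smooth_fun A W f \<Longrightarrow> (U, \<phi>) \<in> A \<Longrightarrow> smooth_on (\<phi> ` (U \<inter> W)) (f \<circ> inv_into U \<phi>)"
  by (auto simp: smooth_fun_def)

lemma smooth_fun_subset:
  assumes "smooth_fun A W f" "V \<subseteq> W"
  shows "smooth_fun A V f"
proof -
  have "smooth_on (\<phi> ` (U \<inter> V)) (f \<circ> inv_into U \<phi>)" if "(U, \<phi>) \<in> A" for U \<phi>
    by (rule smooth_on_subset[OF smooth_funD[OF assms(1) that]]) (use assms(2) in blast)
  then show ?thesis by (auto simp: smooth_fun_def)
qed

lemma smooth_fun_cong:
  assumes "topological_atlas A" "open W" "\<And>p. p \<in> W \<Longrightarrow> f p = h p" "smooth_fun A W f"
  shows "smooth_fun A W h"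
proof -
  have "smooth_on (\<phi> ` (U \<inter> W)) (h \<circ> inv_into U \<phi>)" if U: "(U, \<phi>) \<in> A" for U \<phi>
    by (rule smooth_on_cong[OF open_chart_image[OF assms(1) U assms(2)] _ smooth_funD[OF assms(4) U]])
      (use assms(3) topological_atlasD(7)[OF assms(1) U] in auto)
  then show ?thesis by (auto simp: smooth_fun_def)
qed

lemma smooth_fun_const: "smooth_fun A W (\<lambda>q. c)"
  by (auto simp: smooth_fun_def comp_def smooth_on_const)

lemma smooth_fun_add:
  assumes "topological_atlas A" "open W" "smooth_fun A W f" "smooth_fun A W h"
  shows "smooth_fun A W (\<lambda>q. f q + h q)"
proof -
  have "smooth_on (\<phi> ` (U \<inter> W)) (\<lambda>x. (f \<circ> inv_into U \<phi>) x + (h \<circ> inv_into U \<phi>) x)"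
    if U: "(U, \<phi>) \<in> A" for U \<phi>
    by (rule smooth_on_add[OF open_chart_image[OF assms(1) U assms(2)]
          smooth_funD[OF assms(3) U] smooth_funD[OF assms(4) U]])
  then show ?thesis by (auto simp: smooth_fun_def comp_def)
qed

lemma smooth_fun_mult:
  assumes "topological_atlas A" "open W" "smooth_fun A W f" "smooth_fun A W h"
  shows "smooth_fun A W (\<lambda>q. f q * h q)"
proof -
  have "smooth_on (\<phi> ` (U \<inter> W)) (\<lambda>x. (f \<circ> inv_into U \<phi>) x * (h \<circ> inv_into U \<phi>) x)"
    if U: "(U, \<phi>) \<in> A" for U \<phi>
    by (rule smooth_on_mult[OF open_chart_image[OF assms(1) U assms(2)]
          smooth_funD[OF assms(3) U] smooth_funD[OF assms(4) U]])
  then show ?thesis by (auto simp: smooth_fun_def comp_def)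
qed

lemma smooth_fun_chart:
  assumes "smooth_atlas A" "(U, \<phi>) \<in> A" "smooth_on (\<phi> ` U) f"
  shows "smooth_fun A U (\<lambda>p. f (\<phi> p))"
proof -
  note T = smooth_atlas_imp_topological_atlas[OF assms(1)]
  have "smooth_on (\<psi> ` (V \<inter> U)) ((\<lambda>p. f (\<phi> p)) \<circ> inv_into V \<psi>)" if V: "(V, \<psi>) \<in> A" for V \<psi>
  proof -
    have "smooth_on (\<psi> ` (V \<inter> U)) (\<phi> \<circ> inv_into V \<psi>)"
      using assms(1,2) V by (auto simp: smooth_atlas_def)
    then have "smooth_on (\<psi> ` (V \<inter> U)) (\<lambda>x. f ((\<phi> \<circ> inv_into V \<psi>) x))"
      by (rule smooth_on_compose[OF open_chart_image[OF T V topological_atlasD(1)[OF T assms(2)]] assms(3)])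
        (use topological_atlasD(7)[OF T V] in auto)
    then show ?thesis by (simp add: comp_def)
  qed
  then show ?thesis by (auto simp: smooth_fun_def)
qed

lemma smooth_mapD:
  assumes "smooth_map A B F"
  shows "F ` mcarrier A \<subseteq> mcarrier B" "continuous_on (mcarrier A) F"
    "\<And>U \<phi> V \<psi>. (U, \<phi>) \<in> A \<Longrightarrow> (V, \<psi>) \<in> B \<Longrightarrow>
      smooth_on (\<phi> ` (U \<inter> F -` V)) (\<psi> \<circ> F \<circ> inv_into U \<phi>)"
  using assms by (auto simp: smooth_map_def)

lemma open_smooth_map_vimage:
  assumes "topological_atlas A" "smooth_map A B F" "open W"
  shows "open (mcarrier A \<inter> F -` W)"
  by (rule continuous_open_preimage[OF smooth_mapD(2)[OF assms(2)] open_mcarrier[OF assms(1)] assms(3)])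

lemma open_chart_vimage:
  assumes "topological_atlas A" "smooth_map A B F" "open W" "(U, \<phi>) \<in> A"
  shows "open (\<phi> ` (U \<inter> F -` W))"
proof -
  have "U \<inter> F -` W = U \<inter> (mcarrier A \<inter> F -` W)"
    using chart_subset_mcarrier[OF assms(4)] by blast
  then show ?thesis
    using open_chart_image[OF assms(1,4) open_smooth_map_vimage[OF assms(1-3)]] by simp
qed

lemma smooth_fun_pullback:
  assumes A: "topological_atlas A" and B: "topological_atlas B" and F: "smooth_map A B F"
    and W: "open W" "smooth_fun B W f"
  shows "smooth_fun A (mcarrier A \<inter> F -` W) (\<lambda>p. f (F p))"
proof -
  have "smooth_on (\<phi> ` (U \<inter> (mcarrier A \<inter> F -` W))) ((\<lambda>p. f (F p)) \<circ> inv_into U \<phi>)"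
    if U: "(U, \<phi>) \<in> A" for U \<phi>
  proof (rule smooth_on_local)
    fix x assume "x \<in> \<phi> ` (U \<inter> (mcarrier A \<inter> F -` W))"
    then obtain p where p: "p \<in> U" "F p \<in> W" "x = \<phi> p" "p \<in> mcarrier A" by auto
    then obtain V \<psi> where V: "(V, \<psi>) \<in> B" "F p \<in> V"
      using smooth_mapD(1)[OF F] mcarrier_chart by (metis image_subset_iff)
    let ?S = "\<phi> ` (U \<inter> F -` (V \<inter> W))"
    have opS: "open ?S"
      by (rule open_chart_vimage[OF A F _ U]) (use topological_atlasD(1)[OF B V(1)] W(1) in auto)
    have "smooth_on ?S (\<psi> \<circ> F \<circ> inv_into U \<phi>)"
      by (rule smooth_on_subset[OF smooth_mapD(3)[OF F U V(1)]]) auto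
    then have "smooth_on ?S (\<lambda>y. (f \<circ> inv_into V \<psi>) ((\<psi> \<circ> F \<circ> inv_into U \<phi>) y))"
      by (rule smooth_on_compose[OF opS smooth_funD[OF W(2) V(1)]])
        (use topological_atlasD(7)[OF A U] in auto)
    then have "smooth_on ?S ((\<lambda>p. f (F p)) \<circ> inv_into U \<phi>)"
      by (rule smooth_on_cong[OF opS, rotated])
        (use topological_atlasD(7)[OF A U] topological_atlasD(7)[OF B V(1)] in auto)
    then show "\<exists>S. open S \<and> x \<in> S \<and> smooth_on S ((\<lambda>p. f (F p)) \<circ> inv_into U \<phi>)"
      using opS p V(2) by (intro exI[of _ ?S]) auto
  qed
  then show ?thesis by (auto simp: smooth_fun_def)
qed

lemma smooth_map_partial:
  assumes A: "topological_atlas A" and B: "topological_atlas B" and C: "topological_atlas C"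
    and F: "smooth_map (product_atlas A B) C F" and a: "a \<in> mcarrier A"
  shows "smooth_map B C (\<lambda>x. F (a, x))"
proof -
  obtain U1 \<phi>1 where U1: "(U1, \<phi>1) \<in> A" "a \<in> U1" using mcarrier_chart[OF a] by blast
  have cont: "continuous_on (mcarrier B) (\<lambda>x. F (a, x))"
    by (rule continuous_on_compose2[OF smooth_mapD(2)[OF F]])
      (use a in \<open>auto simp: mcarrier_product_atlas intro!: continuous_intros\<close>)
  have "smooth_on (\<phi> ` (U \<inter> (\<lambda>x. F (a, x)) -` V)) (\<psi> \<circ> (\<lambda>x. F (a, x)) \<circ> inv_into U \<phi>)"
    if U: "(U, \<phi>) \<in> B" and V: "(V, \<psi>) \<in> C" for U \<phi> V \<psi>
  proof -
    let ?S = "\<phi> ` (U \<inter> (\<lambda>x. F (a, x)) -` V)"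
    have "?S = \<phi> ` (U \<inter> (mcarrier B \<inter> (\<lambda>x. F (a, x)) -` V))"
      using chart_subset_mcarrier[OF U] by blast
    then have opS: "open ?S"
      using open_chart_image[OF B U continuous_open_preimage[OF cont open_mcarrier[OF B] topological_atlasD(1)[OF C V]]]
      by simp
    let ?R = "\<psi> \<circ> F \<circ> inv_into (U1 \<times> U) (map_prod \<phi>1 \<phi>)"
    have "smooth_on ?S (\<lambda>y. ?R (\<phi>1 a, y))"
      by (rule smooth_on_compose[OF opS smooth_mapD(3)[OF F mem_product_atlas[OF U1(1) U] V]
            smooth_on_Pair[OF opS smooth_on_const smooth_on_ident[OF opS]]])
        (use U1(2) in auto)
    then show ?thesis
      by (rule smooth_on_cong[OF opS, rotated])
        (use inv_into_map_prod[OF A U1(1) B U, of "\<phi>1 a"] topological_atlasD(7)[OF A U1(1) U1(2)] U1(2) in auto)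
  qed
  moreover have "(\<lambda>x. F (a, x)) ` mcarrier B \<subseteq> mcarrier C"
    using smooth_mapD(1)[OF F] a by (auto simp: mcarrier_product_atlas)
  ultimately show ?thesis using cont by (auto simp: smooth_map_def)
qed

section \<open>Tangent vectors and Lie brackets\<close>

lemma smooth_atI: "open W \<Longrightarrow> p \<in> W \<Longrightarrow> W \<subseteq> mcarrier A \<Longrightarrow> smooth_fun A W f \<Longrightarrow> smooth_at A p f"
  by (auto simp: smooth_at_def)

lemma smooth_at_cong:
  assumes "topological_atlas A" "smooth_at A p f" "open W" "p \<in> W" "\<And>q. q \<in> W \<Longrightarrow> f q = h q"
  shows "smooth_at A p h"
proof -
  obtain V where V: "open V" "p \<in> V" "V \<subseteq> mcarrier A" "smooth_fun A V f"
    using assms(2) by (auto simp: smooth_at_def)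
  have "smooth_fun A (V \<inter> W) h"
    by (rule smooth_fun_cong[OF assms(1) _ assms(5)])
      (use V(1) assms(3) smooth_fun_subset[OF V(4)] in auto)
  then show ?thesis
    using V assms(3,4) by (intro smooth_atI[of "V \<inter> W"]) auto
qed

lemma smooth_at_common_domain:
  assumes "smooth_at A p f" "smooth_at A p h" "open W" "p \<in> W"
  obtains V where "open V" "p \<in> V" "V \<subseteq> mcarrier A" "V \<subseteq> W" "smooth_fun A V f" "smooth_fun A V h"
proof -
  obtain V1 where V1: "open V1" "p \<in> V1" "V1 \<subseteq> mcarrier A" "smooth_fun A V1 f"
    using assms(1) unfolding smooth_at_def by blast
  obtain V2 where V2: "open V2" "p \<in> V2" "smooth_fun A V2 h"
    using assms(2) unfolding smooth_at_def by blast
  show ?thesis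
  proof (rule that[of "V1 \<inter> V2 \<inter> W"])
    show "smooth_fun A (V1 \<inter> V2 \<inter> W) f" by (rule smooth_fun_subset[OF V1(4)]) blast
    show "smooth_fun A (V1 \<inter> V2 \<inter> W) h" by (rule smooth_fun_subset[OF V2(3)]) blast
  qed (use V1 V2 assms(3,4) in auto)
qed

lemma smooth_at_const: "topological_atlas A \<Longrightarrow> p \<in> mcarrier A \<Longrightarrow> smooth_at A p (\<lambda>q. c)"
  by (rule smooth_atI[OF open_mcarrier _ order_refl smooth_fun_const])

lemma smooth_at_add:
  assumes "topological_atlas A" "smooth_at A p f" "smooth_at A p h"
  shows "smooth_at A p (\<lambda>q. f q + h q)"
proof -
  obtain V where "open V" "p \<in> V" "V \<subseteq> mcarrier A" "smooth_fun A V f" "smooth_fun A V h"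
    by (rule smooth_at_common_domain[OF assms(2,3) open_UNIV UNIV_I])
  then show ?thesis using smooth_fun_add[OF assms(1)] by (intro smooth_atI[of V]) auto
qed

lemma smooth_at_mult:
  assumes "topological_atlas A" "smooth_at A p f" "smooth_at A p h"
  shows "smooth_at A p (\<lambda>q. f q * h q)"
proof -
  obtain V where "open V" "p \<in> V" "V \<subseteq> mcarrier A" "smooth_fun A V f" "smooth_fun A V h"
    by (rule smooth_at_common_domain[OF assms(2,3) open_UNIV UNIV_I])
  then show ?thesis using smooth_fun_mult[OF assms(1)] by (intro smooth_atI[of V]) auto
qed

lemma smooth_at_imp_mcarrier: "smooth_at A p f \<Longrightarrow> p \<in> mcarrier A"
  by (auto simp: smooth_at_def)

lemma smooth_at_scale:
  assumes "topological_atlas A" "smooth_at A p f"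
  shows "smooth_at A p (\<lambda>q. c * f q)"
  using smooth_at_mult[OF assms(1) smooth_at_const[OF assms(1) smooth_at_imp_mcarrier[OF assms(2)]] assms(2)] .

lemma tangent_add: "v \<in> tangent_space A p \<Longrightarrow> smooth_at A p f \<Longrightarrow> smooth_at A p h \<Longrightarrow>
    v (\<lambda>q. f q + h q) = v f + v h"
  and tangent_mult: "v \<in> tangent_space A p \<Longrightarrow> smooth_at A p f \<Longrightarrow> smooth_at A p h \<Longrightarrow>
    v (\<lambda>q. f q * h q) = v f * h p + f p * v h"
  and tangent_scale: "v \<in> tangent_space A p \<Longrightarrow> smooth_at A p f \<Longrightarrow> v (\<lambda>q. c * f q) = c * v f"
  and tangent_not_smooth: "v \<in> tangent_space A p \<Longrightarrow> \<not> smooth_at A p f \<Longrightarrow> v f = 0"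
  by (simp_all add: tangent_space_def)

lemma tangent_zero: "v \<in> tangent_space A p \<Longrightarrow> v (\<lambda>q. 0) = 0"
  using tangent_scale[of v A p "\<lambda>q. 0" 0] tangent_not_smooth[of v A p "\<lambda>q. 0"]
  by (cases "smooth_at A p (\<lambda>q. 0)") simp_all

text \<open>The difference of the two functions times the indicator function of \<open>W\<close> is the zero function, and
  the Leibniz rule evaluates its derivative at \<open>p\<close> to that of the difference.\<close>

lemma tangent_local:
  assumes A: "topological_atlas A" and v: "v \<in> tangent_space A p"
    and f: "smooth_at A p f" and W: "open W" "p \<in> W" "\<And>q. q \<in> W \<Longrightarrow> f q = h q"
  shows "v h = v f"
proof -
  have h: "smooth_at A p h" by (rule smooth_at_cong[OF A f W])
  have p: "p \<in> mcarrier A" using f by (rule smooth_at_imp_mcarrier)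
  let ?d = "\<lambda>q. f q + (-1) * h q"
  let ?i = "\<lambda>q. if q \<in> W then 1 else 0 :: real"
  have i: "smooth_at A p ?i"
    by (rule smooth_at_cong[OF A smooth_at_const[OF A p, of 1] W(1,2)]) simp
  have mh: "smooth_at A p (\<lambda>q. (-1) * h q)" by (rule smooth_at_scale[OF A h])
  have d: "smooth_at A p ?d" by (rule smooth_at_add[OF A f mh])
  have "(\<lambda>q. ?d q * ?i q) = (\<lambda>q. 0)" using W(3) by auto
  then have "0 = v (\<lambda>q. ?d q * ?i q)" using tangent_zero[OF v] by simp
  also have "\<dots> = v ?d" using tangent_mult[OF v d i] W(2) W(3)[OF W(2)] by simp
  also have "\<dots> = v f - v h" using tangent_add[OF v f mh] tangent_scale[OF v h, of "-1"] by simp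
  finally show ?thesis by simp
qed

lemma smooth_at_lincomb:
  fixes r :: nat
  assumes "topological_atlas A" "p \<in> mcarrier A" "\<And>i. i < r \<Longrightarrow> smooth_at A p (f i)"
  shows "smooth_at A p (\<lambda>q. \<Sum>i<r. c i * f i q)"
  using assms(3)
proof (induction r)
  case (Suc r)
  then show ?case
    using smooth_at_add[OF assms(1), of p "\<lambda>q. \<Sum>i<r. c i * f i q" "\<lambda>q. c r * f r q"]
      smooth_at_scale[OF assms(1)] by simp
qed (simp add: smooth_at_const assms)

lemma tangent_lincomb:
  fixes r :: nat
  assumes A: "topological_atlas A" "p \<in> mcarrier A" and v: "v \<in> tangent_space A p"
    and f: "\<And>i. i < r \<Longrightarrow> smooth_at A p (f i)"
  shows "v (\<lambda>q. \<Sum>i<r. c i * f i q) = (\<Sum>i<r. c i * v (f i))"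
  using f
proof (induction r)
  case (Suc r)
  have "smooth_at A p (\<lambda>q. \<Sum>i<r. c i * f i q)" "smooth_at A p (f r)"
    using Suc.prems by (auto intro: smooth_at_lincomb[OF A])
  then show ?case
    using Suc tangent_add[OF v, of "\<lambda>q. \<Sum>i<r. c i * f i q" "\<lambda>q. c r * f r q"]
      smooth_at_scale[OF A(1)] tangent_scale[OF v] by simp
qed (simp add: tangent_zero[OF v])

lemma smooth_vfield_tangent: "smooth_vfield A W X \<Longrightarrow> p \<in> W \<Longrightarrow> X p \<in> tangent_space A p"
  by (simp add: smooth_vfield_def)

lemma smooth_vfield_smooth_fun:
  "smooth_vfield A W X \<Longrightarrow> open V \<Longrightarrow> V \<subseteq> W \<Longrightarrow> smooth_fun A V f \<Longrightarrow> smooth_fun A V (\<lambda>p. X p f)"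
  by (simp add: smooth_vfield_def)

lemma smooth_vfield_smooth_at:
  assumes "smooth_vfield A W X" "open W" "p \<in> W" "smooth_at A p f"
  shows "smooth_at A p (\<lambda>q. X q f)"
proof -
  obtain V where V: "open V" "p \<in> V" "V \<subseteq> mcarrier A" "V \<subseteq> W" "smooth_fun A V f"
    by (rule smooth_at_common_domain[OF assms(4,4,2,3)])
  then show ?thesis using smooth_vfield_smooth_fun[OF assms(1) V(1,4,5)] by (intro smooth_atI[of V])
qed

lemma lie_bracket_eq:
  "smooth_at A p f \<Longrightarrow> lie_bracket A X Y p f = X p (\<lambda>q. Y q f) - Y p (\<lambda>q. X q f)"
  by (simp add: lie_bracket_def)

lemma lie_bracket_smooth_vfield:
  assumes A: "topological_atlas A" and W: "open W" "W \<subseteq> mcarrier A"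
    and X: "smooth_vfield A W X" and Y: "smooth_vfield A W Y"
  shows "smooth_vfield A W (lie_bracket A X Y)"
proof -
  have "lie_bracket A X Y p \<in> tangent_space A p" if p: "p \<in> W" for p
  proof -
    have iter_add: "Z p (\<lambda>q. Z' q (\<lambda>q. f q + h q)) = Z p (\<lambda>q. Z' q f) + Z p (\<lambda>q. Z' q h)"
      and iter_mult: "Z p (\<lambda>q. Z' q (\<lambda>q. f q * h q)) = Z p (\<lambda>q. Z' q f) * h p + Z' p f * Z p h +
        (Z p f * Z' p h + f p * Z p (\<lambda>q. Z' q h))"
      if Z: "smooth_vfield A W Z" "smooth_vfield A W Z'" and fh: "smooth_at A p f" "smooth_at A p h"
      for Z Z' f h
    proof -
      obtain V where V: "open V" "p \<in> V" "V \<subseteq> mcarrier A" "V \<subseteq> W" "smooth_fun A V f" "smooth_fun A V h"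
        by (rule smooth_at_common_domain[OF fh W(1) p])
      have Vfh: "Z' q \<in> tangent_space A q" "smooth_at A q f" "smooth_at A q h" if "q \<in> V" for q
        using V that smooth_vfield_tangent[OF Z(2)] by (auto intro: smooth_atI)
      note Zp = smooth_vfield_tangent[OF Z(1) p]
      note sf = smooth_vfield_smooth_at[OF Z(2) W(1) p fh(1)]
        and sh = smooth_vfield_smooth_at[OF Z(2) W(1) p fh(2)]
      have "Z p (\<lambda>q. Z' q (\<lambda>q. f q + h q)) = Z p (\<lambda>q. Z' q f + Z' q h)"
        by (rule tangent_local[OF A Zp smooth_at_add[OF A sf sh] V(1,2)])
          (use tangent_add[OF Vfh] in simp)
      then show "Z p (\<lambda>q. Z' q (\<lambda>q. f q + h q)) = Z p (\<lambda>q. Z' q f) + Z p (\<lambda>q. Z' q h)"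
        using tangent_add[OF Zp sf sh] by simp
      note s1 = smooth_at_mult[OF A sf fh(2)] and s2 = smooth_at_mult[OF A fh(1) sh]
      have "Z p (\<lambda>q. Z' q (\<lambda>q. f q * h q)) = Z p (\<lambda>q. Z' q f * h q + f q * Z' q h)"
        by (rule tangent_local[OF A Zp smooth_at_add[OF A s1 s2] V(1,2)])
          (use tangent_mult[OF Vfh] in simp)
      then show "Z p (\<lambda>q. Z' q (\<lambda>q. f q * h q)) = Z p (\<lambda>q. Z' q f) * h p + Z' p f * Z p h +
        (Z p f * Z' p h + f p * Z p (\<lambda>q. Z' q h))"
        using tangent_add[OF Zp s1 s2] tangent_mult[OF Zp sf fh(2)] tangent_mult[OF Zp fh(1) sh] by simp
    qed
    have iter_scale: "Z p (\<lambda>q. Z' q (\<lambda>q. c * f q)) = c * Z p (\<lambda>q. Z' q f)"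
      if Z: "smooth_vfield A W Z" "smooth_vfield A W Z'" and f: "smooth_at A p f" for Z Z' f c
    proof -
      obtain V where V: "open V" "p \<in> V" "V \<subseteq> mcarrier A" "V \<subseteq> W" "smooth_fun A V f"
        by (rule smooth_at_common_domain[OF f f W(1) p])
      have Vf: "Z' q \<in> tangent_space A q" "smooth_at A q f" if "q \<in> V" for q
        using V that smooth_vfield_tangent[OF Z(2)] by (auto intro: smooth_atI)
      note Zp = smooth_vfield_tangent[OF Z(1) p]
      note sf = smooth_vfield_smooth_at[OF Z(2) W(1) p f]
      have "Z p (\<lambda>q. Z' q (\<lambda>q. c * f q)) = Z p (\<lambda>q. c * Z' q f)"
        by (rule tangent_local[OF A Zp smooth_at_scale[OF A sf] V(1,2)])
          (use tangent_scale[OF Vf] in simp)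
      then show ?thesis using tangent_scale[OF Zp sf] by simp
    qed
    show ?thesis
      unfolding tangent_space_def
      by (auto simp: lie_bracket_eq smooth_at_add[OF A] smooth_at_mult[OF A] smooth_at_scale[OF A]
          iter_add[OF X Y] iter_add[OF Y X] iter_mult[OF X Y] iter_mult[OF Y X]
          iter_scale[OF X Y] iter_scale[OF Y X] algebra_simps)
        (auto simp: lie_bracket_def)
  qed
  moreover have "smooth_fun A V (\<lambda>p. lie_bracket A X Y p f)"
    if V: "open V" "V \<subseteq> W" "smooth_fun A V f" for V f
  proof (rule smooth_fun_cong[OF A V(1)])
    note s = smooth_vfield_smooth_fun[OF X V(1,2)] smooth_vfield_smooth_fun[OF Y V(1,2)]
    show "smooth_fun A V (\<lambda>p. X p (\<lambda>q. Y q f) + (-1) * Y p (\<lambda>q. X q f))"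
      by (intro smooth_fun_add[OF A V(1)] smooth_fun_mult[OF A V(1)] smooth_fun_const s V(3))
    fix p assume "p \<in> V"
    then have "smooth_at A p f" using V W(2) by (intro smooth_atI[of V]) auto
    then show "X p (\<lambda>q. Y q f) + (-1) * Y p (\<lambda>q. X q f) = lie_bracket A X Y p f"
      by (simp add: lie_bracket_eq)
  qed
  ultimately show ?thesis by (simp add: smooth_vfield_def)
qed

text \<open>The inner field is extended by zero outside \<open>U\<close> and hence smooth only on \<open>U\<close>; by locality of
  tangent vectors this does not affect its derivatives at a point of \<open>U\<close>.\<close>

lemma iterated_lincomb:
  assumes A: "topological_atlas A" and U: "open U" "U \<subseteq> mcarrier A" "p \<in> U"
    and X: "\<And>i. i < r \<Longrightarrow> smooth_vfield A U (X i)" and f: "smooth_at A p f"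
  shows "lincomb r a (\<lambda>i. X i p) (\<lambda>q. (if q \<in> U then lincomb r b (\<lambda>j. X j q) else (\<lambda>f. 0)) f)
    = (\<Sum>i<r. \<Sum>j<r. a i * (b j * X i p (\<lambda>q. X j q f)))"
proof -
  have s: "smooth_at A p (\<lambda>q. X j q f)" if "j < r" for j
    by (rule smooth_vfield_smooth_at[OF X[OF that] U(1,3) f])
  have pA: "p \<in> mcarrier A" using U by blast
  have "X i p (\<lambda>q. (if q \<in> U then lincomb r b (\<lambda>j. X j q) else (\<lambda>f. 0)) f)
      = (\<Sum>j<r. b j * X i p (\<lambda>q. X j q f))" if i: "i < r" for i
  proof -
    note v = smooth_vfield_tangent[OF X[OF i] U(3)]
    have "X i p (\<lambda>q. (if q \<in> U then lincomb r b (\<lambda>j. X j q) else (\<lambda>f. 0)) f)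
        = X i p (\<lambda>q. \<Sum>j<r. b j * X j q f)"
      by (rule tangent_local[OF A v smooth_at_lincomb[OF A pA] U(1,3)])
        (auto simp: lincomb_def s)
    also have "\<dots> = (\<Sum>j<r. b j * X i p (\<lambda>q. X j q f))"
      by (rule tangent_lincomb[OF A pA v]) (rule s)
    finally show ?thesis .
  qed
  then show ?thesis by (simp add: lincomb_def sum_distrib_left)
qed

lemma abelian_structure_algebra:
  assumes A: "topological_atlas A" and U: "open U" "U \<subseteq> mcarrier A"
    and X: "\<And>i. i < r \<Longrightarrow> smooth_vfield A U (X i)"
    and commute: "\<And>i j p. i < r \<Longrightarrow> j < r \<Longrightarrow> p \<in> U \<Longrightarrow> lie_bracket A (X i) (X j) p = (\<lambda>f. 0)"
  shows "abelian_lie_algebra (structure_algebra A r U X)"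
proof -
  have "lie_bracket A (\<lambda>p. if p \<in> U then lincomb r a (\<lambda>i. X i p) else (\<lambda>f. 0))
      (\<lambda>p. if p \<in> U then lincomb r b (\<lambda>i. X i p) else (\<lambda>f. 0)) p f = 0" for a b p f
  proof (cases "smooth_at A p f \<and> p \<in> U")
    case True
    then have f: "smooth_at A p f" and p: "p \<in> U" by auto
    have "X i p (\<lambda>q. X j q f) = X j p (\<lambda>q. X i q f)" if "i < r" "j < r" for i j
      using fun_cong[OF commute[OF that p], of f] lie_bracket_eq[OF f, of "X i" "X j"] by simp
    then have "(\<Sum>i<r. \<Sum>j<r. a i * (b j * X i p (\<lambda>q. X j q f)))
        = (\<Sum>i<r. \<Sum>j<r. b j * (a i * X j p (\<lambda>q. X i q f)))"
      by (intro sum.cong refl) simp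
    also have "\<dots> = (\<Sum>j<r. \<Sum>i<r. b j * (a i * X j p (\<lambda>q. X i q f)))"
      by (rule sum.swap)
    finally show ?thesis
      using iterated_lincomb[OF A U p X f] p by (simp add: lie_bracket_eq[OF f])
  qed (auto simp: lie_bracket_def)
  then have "lie_bracket A (\<lambda>p. if p \<in> U then lincomb r a (\<lambda>i. X i p) else (\<lambda>f. 0))
      (\<lambda>p. if p \<in> U then lincomb r b (\<lambda>i. X i p) else (\<lambda>f. 0)) = (\<lambda>p f. 0)" for a b
    by (intro ext)
  then show ?thesis
    by (auto simp: abelian_lie_algebra_def structure_algebra_def vfield_algebra_def)
qed

section \<open>Lie groups with abelian Lie algebra\<close>

locale real_lie_group = group G
  for G :: "('g::{t2_space, second_countable_topology}, 'x) monoid_scheme" (structure) +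
  fixes B :: "('g, 'e::euclidean_space) atlas"
  assumes lie_group: "lie_group G B"
begin

lemma smooth_atlas: "smooth_atlas B" and carrier_eq: "carrier G = mcarrier B"
  and smooth_mult: "smooth_map (product_atlas B B) B (\<lambda>(x, y). x \<otimes> y)"
  and smooth_inv: "smooth_map B B (\<lambda>x. inv x)"
  using lie_group by (auto simp: lie_group_def)

lemma atlas: "topological_atlas B"
  by (rule smooth_atlas_imp_topological_atlas[OF smooth_atlas])

lemmas chart = topological_atlasD[OF atlas]

lemma product_atlas: "topological_atlas (product_atlas B B)"
  by (rule topological_atlas_product[OF atlas atlas])

lemma carrier_open: "open (carrier G)"
  by (simp add: carrier_eq open_mcarrier[OF atlas])

lemma chart_carrier: "(U, \<phi>) \<in> B \<Longrightarrow> p \<in> U \<Longrightarrow> p \<in> carrier G"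
  using chart_subset_mcarrier carrier_eq by blast

lemma chart_exists: "p \<in> carrier G \<Longrightarrow> \<exists>U \<kappa>. (U, \<kappa>) \<in> B \<and> p \<in> U"
  using mcarrier_chart[of p B] by (simp add: carrier_eq)

lemma smooth_at_carrier: "smooth_at B p f \<Longrightarrow> p \<in> carrier G"
  using smooth_at_imp_mcarrier carrier_eq by blast

lemma smooth_translation: "a \<in> carrier G \<Longrightarrow> smooth_map B B (\<lambda>x. a \<otimes> x)"
  using smooth_map_partial[OF atlas atlas atlas smooth_mult, of a] by (simp add: carrier_eq)

lemma open_translation_vimage:
  "a \<in> carrier G \<Longrightarrow> open V \<Longrightarrow> open (carrier G \<inter> (\<lambda>x. a \<otimes> x) -` V)"
  using open_smooth_map_vimage[OF atlas smooth_translation] by (simp add: carrier_eq)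

lemma smooth_at_translate:
  assumes a: "a \<in> carrier G" "p \<in> carrier G" and f: "smooth_at B (a \<otimes> p) f"
  shows "smooth_at B p (\<lambda>q. f (a \<otimes> q))"
proof -
  obtain V where V: "open V" "a \<otimes> p \<in> V" "V \<subseteq> mcarrier B" "smooth_fun B V f"
    using f unfolding smooth_at_def by blast
  show ?thesis
  proof (rule smooth_atI)
    show "open (carrier G \<inter> (\<lambda>x. a \<otimes> x) -` V)" by (rule open_translation_vimage[OF a(1) V(1)])
    show "smooth_fun B (carrier G \<inter> (\<lambda>x. a \<otimes> x) -` V) (\<lambda>q. f (a \<otimes> q))"
      unfolding carrier_eq
      by (rule smooth_fun_pullback[OF atlas atlas smooth_translation[OF a(1)] V(1,4)])
  qed (use V(2) a carrier_eq in auto)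
qed

lemma left_invariantD:
  assumes "X \<in> left_invariant_vfields G B"
  shows "smooth_vfield B (carrier G) X" "p \<notin> carrier G \<Longrightarrow> X p = (\<lambda>f. 0)"
    "a \<in> carrier G \<Longrightarrow> p \<in> carrier G \<Longrightarrow> smooth_at B (a \<otimes> p) f \<Longrightarrow>
      X (a \<otimes> p) f = X p (\<lambda>q. f (a \<otimes> q))"
  using assms by (simp_all add: left_invariant_vfields_def)

lemma zero_left_invariant: "(\<lambda>p f. 0) \<in> left_invariant_vfields G B"
  by (auto simp: left_invariant_vfields_def smooth_vfield_def tangent_space_def smooth_fun_const)

text \<open>Left invariance may be applied twice in an iterated derivative. The second application is valid at
  the points \<open>q\<close> near \<open>p\<close> for which \<open>f\<close> is smooth at \<open>a q\<close>, and locality of tangent vectors makes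
  that enough.\<close>

lemma left_invariant_bracket:
  assumes X: "X \<in> left_invariant_vfields G B" and Y: "Y \<in> left_invariant_vfields G B"
  shows "lie_bracket B X Y \<in> left_invariant_vfields G B"
proof -
  have iterate: "Z (a \<otimes> p) (\<lambda>q. Z' q f) = Z p (\<lambda>q. Z' q (\<lambda>q. f (a \<otimes> q)))"
    if Z: "Z \<in> left_invariant_vfields G B" "Z' \<in> left_invariant_vfields G B"
      and ap: "a \<in> carrier G" "p \<in> carrier G" and f: "smooth_at B (a \<otimes> p) f" for Z Z' a p f
  proof -
    obtain V where V: "open V" "a \<otimes> p \<in> V" "V \<subseteq> mcarrier B" "smooth_fun B V f"
      using f unfolding smooth_at_def by blast
    have s: "smooth_at B (a \<otimes> p) (\<lambda>q. Z' q f)"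
      by (rule smooth_vfield_smooth_at[OF left_invariantD(1)[OF Z(2)] carrier_open _ f]) (use ap in simp)
    have "Z (a \<otimes> p) (\<lambda>q. Z' q f) = Z p (\<lambda>q. Z' (a \<otimes> q) f)"
      by (rule left_invariantD(3)[OF Z(1) ap s])
    also have "\<dots> = Z p (\<lambda>q. Z' q (\<lambda>q. f (a \<otimes> q)))"
    proof (rule sym, rule tangent_local[OF atlas
          smooth_vfield_tangent[OF left_invariantD(1)[OF Z(1)] ap(2)] smooth_at_translate[OF ap s]
          open_translation_vimage[OF ap(1) V(1)]])
      show "p \<in> carrier G \<inter> (\<lambda>x. a \<otimes> x) -` V" using ap V(2) by simp
      show "Z' (a \<otimes> q) f = Z' q (\<lambda>q. f (a \<otimes> q))"
        if "q \<in> carrier G \<inter> (\<lambda>x. a \<otimes> x) -` V" for q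
        using left_invariantD(3)[OF Z(2) ap(1)] smooth_atI[OF V(1) _ V(3,4)] that by simp
    qed
    finally show ?thesis .
  qed
  have "smooth_vfield B (carrier G) (lie_bracket B X Y)"
    by (rule lie_bracket_smooth_vfield[OF atlas carrier_open _ left_invariantD(1)[OF X] left_invariantD(1)[OF Y]])
      (simp add: carrier_eq)
  moreover have "lie_bracket B X Y p = (\<lambda>f. 0)" if "p \<notin> carrier G" for p
  proof
    fix f
    have "\<not> smooth_at B p f" using that smooth_at_carrier by blast
    then show "lie_bracket B X Y p f = 0" by (simp add: lie_bracket_def)
  qed
  moreover have "lie_bracket B X Y (a \<otimes> p) f = lie_bracket B X Y p (\<lambda>q. f (a \<otimes> q))"
    if "a \<in> carrier G" "p \<in> carrier G" "smooth_at B (a \<otimes> p) f" for a p f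
    unfolding lie_bracket_eq[OF that(3)] lie_bracket_eq[OF smooth_at_translate[OF that]]
      iterate[OF X Y that] iterate[OF Y X that] by (rule refl)
  ultimately show ?thesis by (simp add: left_invariant_vfields_def)
qed

text \<open>The isomorphism maps a bracket \<open>[X, Y]\<close> to zero. To conclude \<open>[X, Y] = 0\<close> by injectivity it has
  to be known that \<open>[X, Y]\<close> lies in the domain, that is, is left-invariant.\<close>

lemma abelian_lie_algebra_transfer:
  assumes iso: "lie_algebra_isomorphic (lie_algebra_of G B) (vfield_algebra A V)"
    and abelian: "abelian_lie_algebra (vfield_algebra A V)"
  shows "abelian_lie_algebra (lie_algebra_of G B)"
proof -
  let ?L = "left_invariant_vfields G B"
  obtain T where T: "bij_betw T ?L V"
    and br: "\<And>X Y. X \<in> ?L \<Longrightarrow> Y \<in> ?L \<Longrightarrow> T (lie_bracket B X Y) = lie_bracket A (T X) (T Y)"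
    and sc: "\<And>c X. X \<in> ?L \<Longrightarrow> T (\<lambda>p f. c * X p f) = (\<lambda>p f. c * T X p f)"
    using iso unfolding lie_algebra_isomorphic_def lie_algebra_of_def vfield_algebra_def by auto
  have "lie_bracket B X Y = (\<lambda>p f. 0)" if "X \<in> ?L" "Y \<in> ?L" for X Y
  proof -
    have "T X \<in> V" "T Y \<in> V" using T that by (auto simp: bij_betw_def)
    then have "T (lie_bracket B X Y) = (\<lambda>p f. 0)"
      using abelian br[OF that] by (simp add: abelian_lie_algebra_def vfield_algebra_def)
    also have "\<dots> = T (\<lambda>p f. 0)" using sc[OF that(1), of 0] by simp
    finally show ?thesis
      using T left_invariant_bracket[OF that] zero_left_invariant
      by (auto simp: bij_betw_def dest: inj_onD)
  qed
  then show ?thesis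
    by (simp add: abelian_lie_algebra_def lie_algebra_of_def vfield_algebra_def)
qed

definition product_domain ::
  "'g set \<Rightarrow> ('g \<Rightarrow> 'e) \<Rightarrow> 'g set \<Rightarrow> ('g \<Rightarrow> 'e) \<Rightarrow> 'g set \<Rightarrow> ('e \<times> 'e) set" where
  "product_domain U \<kappa> V \<psi> Z =
     {(x, y). x \<in> \<kappa> ` U \<and> y \<in> \<psi> ` V \<and> inv_into U \<kappa> x \<otimes> inv_into V \<psi> y \<in> Z}"

context
  fixes U V :: "'g set" and \<kappa> \<psi> :: "'g \<Rightarrow> 'e"
  assumes U: "(U, \<kappa>) \<in> B" and V: "(V, \<psi>) \<in> B"
begin

lemma product_domain_eq:
  "product_domain U \<kappa> V \<psi> Z = map_prod \<kappa> \<psi> ` ((U \<times> V) \<inter> (\<lambda>(x, y). x \<otimes> y) -` Z)"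
  unfolding chart_image_eq[OF product_atlas mem_product_atlas[OF U V]]
  by (auto simp: product_domain_def inv_into_map_prod[OF atlas U atlas V])

lemma open_product_domain: "open Z \<Longrightarrow> open (product_domain U \<kappa> V \<psi> Z)"
  unfolding product_domain_eq
  by (rule open_chart_vimage[OF product_atlas smooth_mult _ mem_product_atlas[OF U V]])

lemma smooth_product_chart:
  assumes Z: "(Z, \<zeta>) \<in> B"
  shows "smooth_on (product_domain U \<kappa> V \<psi> Z) (\<lambda>p. \<zeta> (inv_into U \<kappa> (fst p) \<otimes> inv_into V \<psi> (snd p)))"
  by (rule smooth_on_cong[OF open_product_domain[OF chart(1)[OF Z]] _
        smooth_mapD(3)[OF smooth_mult mem_product_atlas[OF U V] Z, folded product_domain_eq]])
    (auto simp: product_domain_def inv_into_map_prod[OF atlas U atlas V])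

lemma smooth_product_fun:
  assumes Z: "open Z" "smooth_fun B Z f"
  shows "smooth_on (product_domain U \<kappa> V \<psi> Z) (\<lambda>p. f (inv_into U \<kappa> (fst p) \<otimes> inv_into V \<psi> (snd p)))"
proof -
  have eq: "U \<times> V \<inter> (mcarrier (product_atlas B B) \<inter> (\<lambda>(x, y). x \<otimes> y) -` Z)
      = U \<times> V \<inter> (\<lambda>(x, y). x \<otimes> y) -` Z"
    using chart_subset_mcarrier[OF mem_product_atlas[OF U V]] by blast
  have "smooth_on (product_domain U \<kappa> V \<psi> Z)
      ((\<lambda>p. f (case p of (x, y) \<Rightarrow> x \<otimes> y)) \<circ> inv_into (U \<times> V) (map_prod \<kappa> \<psi>))"
    using smooth_funD[OF smooth_fun_pullback[OF product_atlas atlas smooth_mult Z] mem_product_atlas[OF U V]]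
    unfolding product_domain_eq eq .
  then show ?thesis
    by (rule smooth_on_cong[OF open_product_domain[OF Z(1)], rotated])
      (auto simp: product_domain_def inv_into_map_prod[OF atlas U atlas V])
qed

end

end

locale lie_group_chart = real_lie_group G B
  for G :: "('g::{t2_space, second_countable_topology}, 'x) monoid_scheme" (structure)
    and B :: "('g, 'e::euclidean_space) atlas" +
  fixes U0 :: "'g set" and \<phi> :: "'g \<Rightarrow> 'e"
  assumes U0: "(U0, \<phi>) \<in> B" and one_U0: "\<one> \<in> U0"
begin

definition \<psi> :: "'e \<Rightarrow> 'g" where "\<psi> = inv_into U0 \<phi>"
definition e :: 'e where "e = \<phi> \<one>"
definition \<Omega> :: "'e set" where "\<Omega> = \<phi> ` U0"

lemma open_\<Omega>: "open \<Omega>" unfolding \<Omega>_def by (rule chart(2)[OF U0])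
lemma e_\<Omega>: "e \<in> \<Omega>" using one_U0 by (simp add: e_def \<Omega>_def)
lemma \<psi>_e: "\<psi> e = \<one>" unfolding \<psi>_def e_def by (rule chart(7)[OF U0 one_U0])
lemma \<psi>_U0: "x \<in> \<Omega> \<Longrightarrow> \<psi> x \<in> U0" unfolding \<psi>_def \<Omega>_def by (rule chart(5)[OF U0])
lemma \<psi>_closed: "x \<in> \<Omega> \<Longrightarrow> \<psi> x \<in> carrier G" by (rule chart_carrier[OF U0 \<psi>_U0])
lemma \<phi>_\<psi>: "x \<in> \<Omega> \<Longrightarrow> \<phi> (\<psi> x) = x" unfolding \<psi>_def \<Omega>_def by (rule chart(6)[OF U0])
lemma \<psi>_\<phi>: "p \<in> U0 \<Longrightarrow> \<psi> (\<phi> p) = p" unfolding \<psi>_def by (rule chart(7)[OF U0])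
lemma \<phi>_\<Omega>: "p \<in> U0 \<Longrightarrow> \<phi> p \<in> \<Omega>" by (simp add: \<Omega>_def)
lemma continuous_\<psi>: "continuous_on \<Omega> \<psi>" unfolding \<psi>_def \<Omega>_def by (rule chart(4)[OF U0])

text \<open>The left-invariant field whose value at the identity has the coordinates \<open>v\<close> in the chart \<open>\<phi>\<close>:
  the point \<open>p\<close> is moved along \<open>p (\<psi> y)\<close> with \<open>y\<close> leaving \<open>e\<close> in direction \<open>v\<close>.\<close>

definition left_field :: "'e \<Rightarrow> 'g vfield" where
  "left_field v = (\<lambda>p f. if smooth_at B p f
     then frechet_derivative (\<lambda>y. f (p \<otimes> \<psi> y)) (at e) v else 0)"

lemma left_field_derivative:
  assumes f: "smooth_at B p f"
  shows "((\<lambda>y. f (p \<otimes> \<psi> y)) has_derivative (\<lambda>v. left_field v p f)) (at e)"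
proof -
  have p: "p \<in> carrier G" using f by (rule smooth_at_carrier)
  obtain U \<kappa> where U: "(U, \<kappa>) \<in> B" "p \<in> U"
    using chart_exists[OF p] by blast
  obtain Z where Z: "open Z" "p \<in> Z" "smooth_fun B Z f"
    using f unfolding smooth_at_def by blast
  have "(\<kappa> p, e) \<in> product_domain U \<kappa> U0 \<phi> Z"
    using U Z(2) p \<psi>_e e_\<Omega> chart(7)[OF U] by (simp add: product_domain_def \<psi>_def \<Omega>_def)
  from smooth_on_has_derivative[OF smooth_product_fun[OF U(1) U0 Z(1,3)] this]
  have "((\<lambda>y. f (inv_into U \<kappa> (fst (\<kappa> p, y)) \<otimes> inv_into U0 \<phi> (snd (\<kappa> p, y)))) has_derivative
      (\<lambda>v. frechet_derivative (\<lambda>p. f (inv_into U \<kappa> (fst p) \<otimes> inv_into U0 \<phi> (snd p))) (at (\<kappa> p, e)) (0, v))) (at e)"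
    by (rule has_derivative_compose[OF has_derivative_Pair[OF has_derivative_const has_derivative_ident]])
  then have "(\<lambda>y. f (p \<otimes> \<psi> y)) differentiable (at e)"
    unfolding differentiable_def by (auto simp: chart(7)[OF U] \<psi>_def)
  then show ?thesis using f by (simp add: left_field_def frechet_derivative_works)
qed

lemma left_field_eqI:
  assumes "smooth_at B p f" "((\<lambda>y. f (p \<otimes> \<psi> y)) has_derivative D) (at e)"
  shows "left_field v p f = D v"
  by (rule fun_cong[OF has_derivative_unique[OF left_field_derivative[OF assms(1)] assms(2)]])

lemma left_field_smooth_fun:
  assumes V: "open V" "V \<subseteq> carrier G" "smooth_fun B V f"
  shows "smooth_fun B V (\<lambda>p. left_field v p f)"
proof -
  have "smooth_on (\<kappa> ` (U \<inter> V)) ((\<lambda>p. left_field v p f) \<circ> inv_into U \<kappa>)" if U: "(U, \<kappa>) \<in> B" for U \<kappa>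
  proof -
    let ?S = "\<kappa> ` (U \<inter> V)"
    let ?K = "\<lambda>p. f (inv_into U \<kappa> (fst p) \<otimes> inv_into U0 \<phi> (snd p))"
    have opS: "open ?S" by (rule open_chart_image[OF atlas U V(1)])
    note sK = smooth_product_fun[OF U U0 V(1,3)]
    have dom: "(x, e) \<in> product_domain U \<kappa> U0 \<phi> V" if "x \<in> ?S" for x
      using that e_\<Omega> \<psi>_e chart(7)[OF U] chart_carrier[OF U]
      by (auto simp: product_domain_def \<psi>_def \<Omega>_def)
    have "smooth_on ?S (\<lambda>x. frechet_derivative ?K (at (x, e)) (0, v))"
      by (rule smooth_on_compose[OF opS smooth_on_frechet_derivative[OF sK]
            smooth_on_Pair[OF opS smooth_on_ident[OF opS] smooth_on_const]])
        (use dom in blast)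
    then show ?thesis
    proof (rule smooth_on_cong[OF opS, rotated])
      fix x assume x: "x \<in> ?S"
      then have "smooth_at B (inv_into U \<kappa> x) f"
        using V chart(7)[OF U] carrier_eq by (intro smooth_atI[of V]) auto
      moreover have "((\<lambda>y. ?K (x, y)) has_derivative (\<lambda>v. frechet_derivative ?K (at (x, e)) (0, v))) (at e)"
        by (rule has_derivative_compose[OF has_derivative_Pair[OF has_derivative_const has_derivative_ident]
              smooth_on_has_derivative[OF sK dom[OF x]]])
      ultimately show "frechet_derivative ?K (at (x, e)) (0, v) = ((\<lambda>p. left_field v p f) \<circ> inv_into U \<kappa>) x"
        using left_field_eqI[of "inv_into U \<kappa> x" f] by (simp add: \<psi>_def)
    qed
  qed
  then show ?thesis by (auto simp: smooth_fun_def)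
qed

lemma left_field_tangent: "p \<in> carrier G \<Longrightarrow> left_field v p \<in> tangent_space B p"
proof -
  assume p: "p \<in> carrier G"
  have "left_field v p (\<lambda>q. f q + h q) = left_field v p f + left_field v p h"
    if "smooth_at B p f" "smooth_at B p h" for f h
    by (rule left_field_eqI[OF smooth_at_add[OF atlas that]
          has_derivative_add[OF left_field_derivative[OF that(1)] left_field_derivative[OF that(2)]]])
  moreover have "left_field v p (\<lambda>q. f q * h q) = left_field v p f * h p + f p * left_field v p h"
    if "smooth_at B p f" "smooth_at B p h" for f h
    using left_field_eqI[OF smooth_at_mult[OF atlas that]
          has_derivative_mult[OF left_field_derivative[OF that(1)] left_field_derivative[OF that(2)]], of v]
    by (simp add: \<psi>_e p)
  moreover have "left_field v p (\<lambda>q. c * f q) = c * left_field v p f"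
    if "smooth_at B p f" for c f
    by (rule left_field_eqI[OF smooth_at_scale[OF atlas that]
          has_derivative_mult_right[OF left_field_derivative[OF that]]])
  moreover have "left_field v p f = 0" if "\<not> smooth_at B p f" for f
    using that by (simp add: left_field_def)
  ultimately show ?thesis by (simp add: tangent_space_def)
qed

lemma left_field_left_invariant: "left_field v \<in> left_invariant_vfields G B"
proof -
  have "smooth_vfield B (carrier G) (left_field v)"
    using left_field_tangent left_field_smooth_fun by (simp add: smooth_vfield_def)
  moreover have "left_field v p = (\<lambda>f. 0)" if "p \<notin> carrier G" for p
  proof
    fix f
    have "\<not> smooth_at B p f" using that smooth_at_carrier by blast
    then show "left_field v p f = 0" by (simp add: left_field_def)
  qed
  moreover have "left_field v (a \<otimes> p) f = left_field v p (\<lambda>q. f (a \<otimes> q))"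
    if ap: "a \<in> carrier G" "p \<in> carrier G" and f: "smooth_at B (a \<otimes> p) f" for a p f
    by (rule left_field_eqI[OF f],
        rule has_derivative_transform_within_open[OF left_field_derivative[OF smooth_at_translate[OF ap f]] open_\<Omega> e_\<Omega>])
      (simp add: m_assoc ap \<psi>_closed)
  ultimately show ?thesis by (simp add: left_invariant_vfields_def)
qed

definition mult_coord :: "'e \<times> 'e \<Rightarrow> 'e" where
  "mult_coord p = \<phi> (\<psi> (fst p) \<otimes> \<psi> (snd p))"

definition quot_coord :: "'e \<times> 'e \<Rightarrow> 'e" where
  "quot_coord p = \<phi> (inv \<psi> (fst p) \<otimes> \<psi> (snd p))"

definition mult_dom :: "('e \<times> 'e) set" where
  "mult_dom = {(x, y). x \<in> \<Omega> \<and> y \<in> \<Omega> \<and> \<psi> x \<otimes> \<psi> y \<in> U0}"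

definition quot_dom :: "('e \<times> 'e) set" where
  "quot_dom = {(x, y). x \<in> \<Omega> \<and> y \<in> \<Omega> \<and> inv \<psi> x \<otimes> \<psi> y \<in> U0}"

text \<open>The coordinates of \<^const>\<open>left_field\<close> at \<open>\<psi> x\<close>.\<close>

definition frame :: "'e \<Rightarrow> 'e \<Rightarrow> 'e" where
  "frame = (\<lambda>x v. frechet_derivative mult_coord (at (x, e)) (0, v))"

lemma mult_dom_eq: "mult_dom = product_domain U0 \<phi> U0 \<phi> U0"
  by (simp add: mult_dom_def product_domain_def \<psi>_def \<Omega>_def)

lemma open_mult_dom: "open mult_dom"
  unfolding mult_dom_eq by (rule open_product_domain[OF U0 U0 chart(1)[OF U0]])

lemma smooth_mult_coord: "smooth_on mult_dom mult_coord"
  using smooth_product_chart[OF U0 U0 U0] unfolding mult_dom_eq mult_coord_def[abs_def] \<psi>_def .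

text \<open>The inverse of a point of the chart domain may lie outside it, so the quotient has to be read
  through a second chart around that inverse.\<close>

lemma quot_coord_locally_smooth:
  assumes "p \<in> quot_dom"
  shows "\<exists>S. open S \<and> p \<in> S \<and> S \<subseteq> quot_dom \<and> smooth_on S quot_coord"
proof -
  obtain x0 y0 where p: "p = (x0, y0)" "x0 \<in> \<Omega>" "y0 \<in> \<Omega>" "inv \<psi> x0 \<otimes> \<psi> y0 \<in> U0"
    using assms by (auto simp: quot_dom_def)
  have "inv \<psi> x0 \<in> carrier G" using p(2) \<psi>_closed by simp
  then obtain U1 \<phi>1 where U1: "(U1, \<phi>1) \<in> B" "inv \<psi> x0 \<in> U1"
    using chart_exists by blast
  define D where "D = \<phi> ` (U0 \<inter> (\<lambda>x. inv x) -` U1)"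
  define \<iota> where "\<iota> = \<phi>1 \<circ> (\<lambda>x. inv x) \<circ> inv_into U0 \<phi>"
  have opD: "open D" unfolding D_def by (rule open_chart_vimage[OF atlas smooth_inv chart(1)[OF U1(1)] U0])
  have si: "smooth_on D \<iota>" unfolding D_def \<iota>_def by (rule smooth_mapD(3)[OF smooth_inv U0 U1(1)])
  let ?R = "product_domain U1 \<phi>1 U0 \<phi> U0"
  have opR: "open ?R" by (rule open_product_domain[OF U1(1) U0 chart(1)[OF U0]])
  have opDT: "open (D \<times> \<Omega>)" by (intro open_Times opD open_\<Omega>)
  have sP: "smooth_on (D \<times> \<Omega>) (\<lambda>p. (\<iota> (fst p), snd p))"
    by (rule smooth_on_Pair[OF opDT
          smooth_on_compose[OF opDT si smooth_on_bounded_linear[OF bounded_linear_fst opDT]]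
          smooth_on_bounded_linear[OF bounded_linear_snd opDT]]) auto
  let ?S = "(D \<times> \<Omega>) \<inter> (\<lambda>p. (\<iota> (fst p), snd p)) -` ?R"
  have opS: "open ?S"
    by (rule continuous_open_preimage[OF smooth_on_imp_continuous_on[OF sP] opDT opR])
  have i: "inv_into U1 \<phi>1 (\<iota> x) = inv \<psi> x" "x \<in> \<Omega>" "\<iota> x \<in> \<phi>1 ` U1" if "x \<in> D" for x
    using that chart(7)[OF U0] chart(7)[OF U1(1)] by (auto simp: D_def \<iota>_def \<psi>_def \<Omega>_def)
  have D_iff: "x \<in> D" if "x \<in> \<Omega>" "inv \<psi> x \<in> U1" for x
    unfolding D_def using that \<psi>_U0 \<phi>_\<psi> by (intro image_eqI[of _ _ "\<psi> x"]) auto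
  have x0D: "x0 \<in> D" by (rule D_iff[OF p(2) U1(2)])
  have "p \<in> ?S"
    using p x0D i[OF x0D] by (simp add: product_domain_def \<psi>_def \<Omega>_def)
  moreover have "?S \<subseteq> quot_dom"
  proof
    fix p assume "p \<in> ?S"
    then have "fst p \<in> D" "snd p \<in> \<Omega>" "inv_into U1 \<phi>1 (\<iota> (fst p)) \<otimes> \<psi> (snd p) \<in> U0"
      by (auto simp: product_domain_def \<psi>_def)
    then show "p \<in> quot_dom" using i[of "fst p"] by (cases p) (simp add: quot_dom_def)
  qed
  moreover have "smooth_on ?S quot_coord"
  proof (rule smooth_on_cong[OF opS])
    show "smooth_on ?S (\<lambda>p. \<phi> (inv_into U1 \<phi>1 (fst (\<iota> (fst p), snd p)) \<otimes>
        inv_into U0 \<phi> (snd (\<iota> (fst p), snd p))))"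
      by (rule smooth_on_compose[OF opS smooth_product_chart[OF U1(1) U0 U0] smooth_on_subset[OF sP]]) auto
    show "\<phi> (inv_into U1 \<phi>1 (fst (\<iota> (fst p), snd p)) \<otimes> inv_into U0 \<phi> (snd (\<iota> (fst p), snd p))) = quot_coord p"
      if "p \<in> ?S" for p
      using i(1)[of "fst p"] that unfolding quot_coord_def \<psi>_def by auto
  qed
  ultimately show ?thesis using opS by blast
qed

lemma open_quot_dom: "open quot_dom"
  using quot_coord_locally_smooth by (subst open_subopen) blast

lemma smooth_quot_coord: "smooth_on quot_dom quot_coord"
  by (rule smooth_on_local) (use quot_coord_locally_smooth in blast)

lemma smooth_frame: "smooth_on {x. (x, e) \<in> mult_dom} (\<lambda>x. frame x v)"
proof -
  have "{x. (x, e) \<in> mult_dom} = (\<lambda>x. (x, e)) -` mult_dom" by auto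
  then have op: "open {x. (x, e) \<in> mult_dom}"
    by (simp add: open_vimage[OF open_mult_dom] continuous_on_Pair)
  show ?thesis
    unfolding frame_def
    by (rule smooth_on_compose[OF op smooth_on_frechet_derivative[OF smooth_mult_coord]
          smooth_on_Pair[OF op smooth_on_ident[OF op] smooth_on_const]]) auto
qed

lemma frame_domain: "(x, e) \<in> mult_dom \<longleftrightarrow> x \<in> \<Omega>"
  using \<psi>_closed \<psi>_U0 e_\<Omega> by (auto simp: mult_dom_def \<psi>_e)

lemma mult_coord_e: "x \<in> \<Omega> \<Longrightarrow> mult_coord (x, e) = x"
  by (simp add: mult_coord_def \<psi>_e \<psi>_closed \<phi>_\<psi>)

lemma has_derivative_frame:
  assumes "x \<in> \<Omega>"
  shows "((\<lambda>y. mult_coord (x, y)) has_derivative frame x) (at e)"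
proof -
  have "(x, e) \<in> mult_dom" using assms by (simp add: frame_domain)
  from has_derivative_compose[OF has_derivative_Pair[OF has_derivative_const has_derivative_ident]
      smooth_on_has_derivative[OF smooth_mult_coord this]]
  show ?thesis by (simp add: frame_def)
qed

lemma mult_coord_near: "x \<in> \<Omega> \<Longrightarrow> \<exists>S. open S \<and> e \<in> S \<and> (\<forall>y\<in>S. (x, y) \<in> mult_dom)"
  by (intro exI[of _ "(\<lambda>y. (x, y)) -` mult_dom"] conjI open_vimage[OF open_mult_dom] continuous_intros)
    (simp_all add: frame_domain)

text \<open>This expresses the abstract derivations by Frechet derivatives in the chart; the function \<open>h\<close> is
  prescribed on \<open>U0\<close> only, so that it can be applied to iterated derivatives.\<close>

lemma left_field_in_chart:
  fixes F :: "'e \<Rightarrow> real"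
  assumes x: "x \<in> \<Omega>" and h: "smooth_at B (\<psi> x) h" "\<And>p. p \<in> U0 \<Longrightarrow> h p = F (\<phi> p)"
    and F: "(F has_derivative F') (at x)"
  shows "left_field u (\<psi> x) h = F' (frame x u)"
proof -
  obtain S where S: "open S" "e \<in> S" "\<forall>y\<in>S. (x, y) \<in> mult_dom" using mult_coord_near[OF x] by blast
  have "((\<lambda>y. F (mult_coord (x, y))) has_derivative (\<lambda>u. F' (frame x u))) (at e)"
    by (rule has_derivative_compose[OF has_derivative_frame[OF x]]) (simp add: mult_coord_e x F)
  then have "((\<lambda>y. h (\<psi> x \<otimes> \<psi> y)) has_derivative (\<lambda>u. F' (frame x u))) (at e)"
    by (rule has_derivative_transform_within_open[OF _ S(1,2)])
      (use S(3) h(2) in \<open>auto simp: mult_coord_def mult_dom_def\<close>)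
  then show ?thesis by (rule left_field_eqI[OF h(1)])
qed

text \<open>The bracket of two fields vanishes; evaluated on the coordinate functions \<open>p \<mapsto> \<phi> p \<bullet> b\<close> it is the
  usual expression in the derivatives of the components.\<close>

lemma frame_commuting:
  assumes abelian: "abelian_lie_algebra (lie_algebra_of G B)" and x: "x \<in> \<Omega>"
  shows "frechet_derivative (\<lambda>x. frame x v) (at x) (frame x u)
    = frechet_derivative (\<lambda>x. frame x u) (at x) (frame x v)"
proof (rule euclidean_eqI)
  fix b :: 'e
  define h where "h p = \<phi> p \<bullet> b" for p
  have bl: "bounded_linear (\<lambda>z. z \<bullet> b)" by (rule bounded_linear_inner_left)
  have smooth_h: "smooth_fun B U0 h"
    unfolding h_def
    by (rule smooth_fun_chart[OF smooth_atlas U0 smooth_on_bounded_linear[OF bl chart(2)[OF U0]]])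
  have U0c: "U0 \<subseteq> carrier G" using chart_carrier[OF U0] by blast
  have at: "smooth_at B p f" if "p \<in> U0" "smooth_fun B U0 f" for p f
    by (rule smooth_atI[OF chart(1)[OF U0] that(1) _ that(2)]) (use U0c carrier_eq in simp)
  have first: "left_field v p h = frame (\<phi> p) v \<bullet> b" if p: "p \<in> U0" for p v
  proof -
    have "left_field v (\<psi> (\<phi> p)) h = frame (\<phi> p) v \<bullet> b"
      by (rule left_field_in_chart[OF \<phi>_\<Omega>[OF p], where F = "\<lambda>z. z \<bullet> b" and F' = "\<lambda>z. z \<bullet> b"])
        (use at[OF p smooth_h] in \<open>auto simp: \<psi>_\<phi> p h_def intro: bounded_linear.has_derivative[OF bl has_derivative_ident]\<close>)
    then show ?thesis by (simp add: \<psi>_\<phi> p)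
  qed
  have second: "left_field u (\<psi> x) (\<lambda>q. left_field v q h)
      = frechet_derivative (\<lambda>x. frame x v) (at x) (frame x u) \<bullet> b" for u v
  proof (rule left_field_in_chart[OF x])
    show "smooth_at B (\<psi> x) (\<lambda>q. left_field v q h)"
      by (rule at[OF \<psi>_U0[OF x] left_field_smooth_fun[OF chart(1)[OF U0] U0c smooth_h]])
    show "((\<lambda>x. frame x v \<bullet> b) has_derivative
        (\<lambda>w. frechet_derivative (\<lambda>x. frame x v) (at x) w \<bullet> b)) (at x)"
      by (rule bounded_linear.has_derivative[OF bl smooth_on_has_derivative[OF smooth_frame]])
        (simp add: frame_domain x)
  qed (rule first)
  have "lie_bracket B (left_field u) (left_field v) = (\<lambda>p f. 0)"
    using abelian left_field_left_invariant
    by (simp add: abelian_lie_algebra_def lie_algebra_of_def vfield_algebra_def)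
  then have "lie_bracket B (left_field u) (left_field v) (\<psi> x) h = 0" by simp
  then show "frechet_derivative (\<lambda>x. frame x v) (at x) (frame x u) \<bullet> b
      = frechet_derivative (\<lambda>x. frame x u) (at x) (frame x v) \<bullet> b"
    by (simp add: lie_bracket_eq[OF at[OF \<psi>_U0[OF x] smooth_h]] second)
qed

lemma local_abelian_group:
  assumes "abelian_lie_algebra (lie_algebra_of G B)"
  shows "local_abelian_group e (mult_dom \<inter> quot_dom) mult_coord quot_coord"
proof
  show "open (mult_dom \<inter> quot_dom)" by (intro open_Int open_mult_dom open_quot_dom)
  show "(e, e) \<in> mult_dom \<inter> quot_dom" using e_\<Omega> one_U0 by (simp add: mult_dom_def quot_dom_def \<psi>_e)
  show "smooth_on (mult_dom \<inter> quot_dom) mult_coord" by (rule smooth_on_subset[OF smooth_mult_coord]) simp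
  show "smooth_on (mult_dom \<inter> quot_dom) quot_coord" by (rule smooth_on_subset[OF smooth_quot_coord]) simp
  show "mult_coord (x, e) = x" if "(x, e) \<in> mult_dom \<inter> quot_dom" for x
    using that by (intro mult_coord_e) (simp add: mult_dom_def)
  show "mult_coord (e, y) = y" if "(e, y) \<in> mult_dom \<inter> quot_dom" for y
    using that by (simp add: mult_coord_def mult_dom_def \<psi>_e \<psi>_closed \<phi>_\<psi>)
  show "quot_coord (x, mult_coord (x, y)) = y" if "(x, y) \<in> mult_dom \<inter> quot_dom" "(x, mult_coord (x, y)) \<in> mult_dom \<inter> quot_dom" for x y
    using that by (auto simp: quot_coord_def mult_coord_def mult_dom_def \<psi>_\<phi> \<psi>_closed m_assoc[symmetric] \<phi>_\<psi>)
  show "mult_coord (mult_coord (a, x), y) = mult_coord (a, mult_coord (x, y))"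
    if "(a, x) \<in> mult_dom \<inter> quot_dom" "(x, y) \<in> mult_dom \<inter> quot_dom" "(mult_coord (a, x), y) \<in> mult_dom \<inter> quot_dom" "(a, mult_coord (x, y)) \<in> mult_dom \<inter> quot_dom" for a x y
    using that by (auto simp: mult_coord_def mult_dom_def \<psi>_\<phi> \<psi>_closed m_assoc)
  show "frechet_derivative (\<lambda>x. frechet_derivative mult_coord (at (x, e)) (0, v)) (at x) (frechet_derivative mult_coord (at (x, e)) (0, u))
      = frechet_derivative (\<lambda>x. frechet_derivative mult_coord (at (x, e)) (0, u)) (at x) (frechet_derivative mult_coord (at (x, e)) (0, v))"
    if "(x, e) \<in> mult_dom \<inter> quot_dom" for x u v
    using frame_commuting[OF assms, of x v u] that by (simp add: frame_def mult_dom_def)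
qed

end

text \<open>The exponential map \<open>E\<close> built from canonical coordinates is a bijective homomorphism. Near \<open>v0\<close> it
  is \<open>v \<mapsto> E v0 \<otimes> \<sigma> (v - v0)\<close>, and its inverse \<open>T\<close> is \<open>p \<mapsto> T p0 + F (inv p0 \<otimes> p)\<close> near \<open>p0\<close>;
  both are composed of smooth translations and canonical coordinates.\<close>

theorem (in lie_group_chart) abelian_simply_connected_iso:
  assumes abelian: "abelian_lie_algebra (lie_algebra_of G B)"
    and sc: "simply_connected (carrier G)"
  shows "comm_group G \<and> lie_group_isomorphic G B (additive_group :: 'e monoid) euclidean_atlas"
proof -
  obtain N and V :: "'e set" and f g \<epsilon> where N: "open N" "e \<in> N" "open V" "homeomorphism N V f g"
    "smooth_on N f" "smooth_on V g" "f e = 0" "0 < \<epsilon>" "ball 0 \<epsilon> \<subseteq> V"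
    and g_add: "\<And>u w. u \<in> ball 0 \<epsilon> \<Longrightarrow> w \<in> ball 0 \<epsilon> \<Longrightarrow>
      (g u, g w) \<in> mult_dom \<inter> quot_dom \<and> u + w \<in> V \<and> mult_coord (g u, g w) = g (u + w)"
    apply (rule local_abelian_group.canonical_coordinates[OF local_abelian_group[OF abelian]])
    subgoal for N V f g \<epsilon> by (rule that[of N V f g \<epsilon>]) blast+
    done
  let ?ball = "ball (0::'e) \<epsilon>"
  have g\<Omega>: "g u \<in> \<Omega>" if "u \<in> ?ball" for u
    using g_add[OF that that] by (auto simp: mult_dom_def)
  have gN: "g u \<in> N" "f (g u) = u" if "u \<in> ?ball" for u
    using N(4,9) that by (auto simp: homeomorphism_def)
  define \<sigma> where "\<sigma> u = \<psi> (g u)" for u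
  define F where "F p = f (\<phi> p)" for p
  have \<phi>_\<sigma>: "\<phi> (\<sigma> u) = g u" and \<sigma>_U0: "\<sigma> u \<in> U0" if "u \<in> ?ball" for u
    using g\<Omega>[OF that] by (simp_all add: \<sigma>_def \<phi>_\<psi> \<psi>_U0)
  have range_\<sigma>: "\<sigma> ` ?ball = U0 \<inter> \<phi> -` (N \<inter> f -` ?ball)"
  proof (intro equalityI subsetI)
    fix p assume p: "p \<in> U0 \<inter> \<phi> -` (N \<inter> f -` ?ball)"
    then have "g (f (\<phi> p)) = \<phi> p" using N(4) by (auto simp: homeomorphism_def)
    then have "\<sigma> (f (\<phi> p)) = p" using p by (simp add: \<sigma>_def \<psi>_\<phi>)
    moreover have "f (\<phi> p) \<in> ?ball" using p by simp
    ultimately show "p \<in> \<sigma> ` ?ball" by (metis image_eqI)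
  qed (use \<sigma>_U0 \<phi>_\<sigma> gN in auto)
  interpret E: local_exponential G \<sigma> F \<epsilon>
  proof
    show "open (carrier G)" by (rule carrier_open)
    show "continuous_on (carrier G \<times> carrier G) (\<lambda>(x, y). x \<otimes> y)"
      using smooth_mapD(2)[OF smooth_mult] by (simp add: mcarrier_product_atlas carrier_eq)
    show "continuous_on (carrier G) (\<lambda>x. inv x)"
      using smooth_mapD(2)[OF smooth_inv] by (simp add: carrier_eq)
    show "0 < \<epsilon>" by (rule N(8))
    show "\<sigma> u \<in> carrier G" if "u \<in> ?ball" for u
      by (rule chart_carrier[OF U0 \<sigma>_U0[OF that]])
    have "open (N \<inter> f -` ?ball)"
      by (rule continuous_open_preimage[OF smooth_on_imp_continuous_on[OF N(5)] N(1) open_ball])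
    then show "open (\<sigma> ` ?ball)"
      unfolding range_\<sigma> by (rule continuous_open_preimage[OF chart(3)[OF U0] chart(1)[OF U0]])
    show "continuous_on ?ball \<sigma>"
      unfolding \<sigma>_def
      by (rule continuous_on_compose2[OF continuous_\<psi>
            continuous_on_subset[OF smooth_on_imp_continuous_on[OF N(6)] N(9)]]) (use g\<Omega> in blast)
    show "continuous_on (\<sigma> ` ?ball) F"
      unfolding F_def
      by (rule continuous_on_compose2[OF smooth_on_imp_continuous_on[OF N(5)]
            continuous_on_subset[OF chart(3)[OF U0]]]) (auto simp: range_\<sigma>)
    show "F (\<sigma> u) = u" if "u \<in> ?ball" for u
      by (simp add: F_def \<phi>_\<sigma>[OF that] gN[OF that])
    show "\<sigma> (u + w) = \<sigma> u \<otimes> \<sigma> w" if "u \<in> ?ball" "w \<in> ?ball" for u w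
    proof -
      have "\<sigma> u \<otimes> \<sigma> w \<in> U0" "\<phi> (\<sigma> u \<otimes> \<sigma> w) = g (u + w)"
        using g_add[OF that] by (auto simp: \<sigma>_def mult_dom_def mult_coord_def)
      then show ?thesis using \<psi>_\<phi> by (metis \<sigma>_def)
    qed
  qed
  have bij: "bij_betw E.E UNIV (carrier G)" by (rule E.E_bij[OF sc])
  define T where "T = inv_into UNIV E.E"
  have ET: "E.E (T p) = p" if "p \<in> carrier G" for p
    unfolding T_def using bij that by (intro f_inv_into_f) (auto simp: bij_betw_def)
  have TE: "T (E.E v) = v" for v
    unfolding T_def using bij by (intro inv_into_f_f) (auto simp: bij_betw_def)
  have comm: "comm_group G"
  proof (rule group_comm_groupI)
    fix x y assume "x \<in> carrier G" "y \<in> carrier G"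
    then show "x \<otimes> y = y \<otimes> x"
      using E.E_add[of "T x" "T y"] E.E_add[of "T y" "T x"] by (simp add: ET add.commute)
  qed
  have T_mult: "T (x \<otimes> y) = T x + T y" if "x \<in> carrier G" "y \<in> carrier G" for x y
    using TE[of "T x + T y"] that by (simp add: E.E_add ET)
  have "T \<in> iso G additive_group"
    using bij_betw_inv_into[OF bij] T_mult
    by (auto simp: iso_def hom_def additive_group_def T_def)
  have T_near: "T p = T p0 + F (inv p0 \<otimes> p)"
    if "p0 \<in> carrier G" "p \<in> carrier G" "inv p0 \<otimes> p \<in> \<sigma> ` ?ball" for p p0
  proof -
    have "E.E (T p0 + F (inv p0 \<otimes> p)) = p"
      using that by (simp add: E.E_add ET E.E_F m_assoc[symmetric])
    then show ?thesis using TE by metis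
  qed
  have near: "inv p0 \<otimes> p0 \<in> \<sigma> ` ?ball" if "p0 \<in> carrier G" for p0
    using that N(8) by (auto intro!: image_eqI[of _ _ 0] simp: E.\<sigma>_0)
  have contT: "continuous_on (carrier G) T"
  proof (rule continuous_at_imp_continuous_on, rule ballI)
    fix p0 assume p0: "p0 \<in> carrier G"
    let ?S = "carrier G \<inter> (\<lambda>x. inv p0 \<otimes> x) -` (\<sigma> ` ?ball)"
    have "open ?S" using p0 by (intro open_translation_vimage E.open_range_\<sigma>) simp
    moreover have "continuous_on ?S (\<lambda>p. T p0 + F (inv p0 \<otimes> p))"
      using p0
      by (intro continuous_on_add continuous_on_const continuous_on_compose2[OF E.continuous_F]
          continuous_on_subset[OF E.continuous_translation]) auto
    then have "continuous_on ?S T"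
      by (rule continuous_on_cong[THEN iffD1, rotated 2]) (use T_near[OF p0] in auto)
    moreover have "p0 \<in> ?S" using p0 near[OF p0] by simp
    ultimately show "isCont T p0" using continuous_on_eq_continuous_at by blast
  qed
  have "smooth_on (\<kappa> ` U) (T \<circ> inv_into U \<kappa>)" if U: "(U, \<kappa>) \<in> B" for U \<kappa>
  proof (rule smooth_on_local)
    fix x0 assume "x0 \<in> \<kappa> ` U"
    then obtain p0 where p0: "p0 \<in> U" "x0 = \<kappa> p0" by auto
    have p0c: "p0 \<in> carrier G" by (rule chart_carrier[OF U p0(1)])
    let ?L = "\<lambda>x. inv p0 \<otimes> x"
    have L: "smooth_map B B ?L" using p0c by (intro smooth_translation) simp
    let ?S = "\<kappa> ` (U \<inter> ?L -` (\<sigma> ` ?ball))"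
    have opS: "open ?S" by (rule open_chart_vimage[OF atlas L E.open_range_\<sigma> U])
    let ?R = "\<phi> \<circ> ?L \<circ> inv_into U \<kappa>"
    have "smooth_on ?S ?R"
      by (rule smooth_on_subset[OF smooth_mapD(3)[OF L U U0]]) (use \<sigma>_U0 in auto)
    then have "smooth_on ?S (\<lambda>x. f (?R x))"
      by (rule smooth_on_compose[OF opS N(5)])
        (use chart(7)[OF U] range_\<sigma> in \<open>auto simp: \<phi>_\<sigma> gN\<close>)
    then have "smooth_on ?S (\<lambda>x. T p0 + f (?R x))"
      by (rule smooth_on_add[OF opS smooth_on_const])
    then have "smooth_on ?S (T \<circ> inv_into U \<kappa>)"
    proof (rule smooth_on_cong[OF opS, rotated])
      fix x assume "x \<in> ?S"
      then obtain p where p: "p \<in> U" "?L p \<in> \<sigma> ` ?ball" "x = \<kappa> p" by auto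
      then show "T p0 + f (?R x) = (T \<circ> inv_into U \<kappa>) x"
        using T_near[OF p0c chart_carrier[OF U p(1)] p(2)] by (simp add: F_def chart(7)[OF U])
    qed
    moreover have "x0 \<in> ?S" using p0 near[OF p0c] by blast
    ultimately show "\<exists>S. open S \<and> x0 \<in> S \<and> smooth_on S (T \<circ> inv_into U \<kappa>)"
      using opS by blast
  qed
  then have smooth_T: "smooth_map B euclidean_atlas T"
    using contT by (auto simp: smooth_map_def euclidean_atlas_def mcarrier_def[of "{_}"] carrier_eq comp_def)
  have "smooth_on (E.E -` Z) (\<zeta> \<circ> E.E)" if Z: "(Z, \<zeta>) \<in> B" for Z \<zeta>
  proof (rule smooth_on_local)
    fix v0 assume v0: "v0 \<in> E.E -` Z"
    let ?L = "\<lambda>x. E.E v0 \<otimes> x"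
    have L: "smooth_map B B ?L" by (rule smooth_translation[OF E.E_closed])
    let ?S = "ball v0 \<epsilon> \<inter> E.E -` Z"
    have opS: "open ?S"
      by (intro open_Int open_ball open_vimage[OF chart(1)[OF Z] E.continuous_E])
    have S: "v - v0 \<in> ?ball" "E.E v0 \<otimes> \<sigma> (v - v0) = E.E v" "E.E v \<in> Z" if "v \<in> ?S" for v
      using that E.E_near[of v v0] by (auto simp: dist_norm norm_minus_commute)
    have "smooth_on ?S (\<lambda>v. v - v0)"
      by (rule smooth_on_diff[OF opS smooth_on_ident[OF opS] smooth_on_const])
    then have "smooth_on ?S (\<lambda>v. g (v - v0))"
      by (rule smooth_on_compose[OF opS N(6)]) (use S(1) N(9) in blast)
    then have "smooth_on ?S (\<lambda>v. (\<zeta> \<circ> ?L \<circ> inv_into U0 \<phi>) (g (v - v0)))"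
    proof (rule smooth_on_compose[OF opS smooth_mapD(3)[OF L U0 Z]])
      show "(\<lambda>v. g (v - v0)) ` ?S \<subseteq> \<phi> ` (U0 \<inter> ?L -` Z)"
      proof
        fix x assume "x \<in> (\<lambda>v. g (v - v0)) ` ?S"
        then obtain v where v: "v \<in> ?S" "x = g (v - v0)" by blast
        have "x = \<phi> (\<sigma> (v - v0))" using v(2) \<phi>_\<sigma>[OF S(1)[OF v(1)]] by simp
        moreover have "\<sigma> (v - v0) \<in> U0 \<inter> ?L -` Z"
          using \<sigma>_U0[OF S(1)[OF v(1)]] S(2,3)[OF v(1)] by simp
        ultimately show "x \<in> \<phi> ` (U0 \<inter> ?L -` Z)" by blast
      qed
    qed
    then have "smooth_on ?S (\<zeta> \<circ> E.E)"
    proof (rule smooth_on_cong[OF opS, rotated])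
      fix v assume "v \<in> ?S"
      then show "(\<zeta> \<circ> ?L \<circ> inv_into U0 \<phi>) (g (v - v0)) = (\<zeta> \<circ> E.E) v"
        using S(2) by (simp add: \<sigma>_def \<psi>_def)
    qed
    then show "\<exists>S. open S \<and> v0 \<in> S \<and> smooth_on S (\<zeta> \<circ> E.E)"
      using opS v0 N(8) by (intro exI[of _ ?S]) auto
  qed
  moreover have "inv_into UNIV (\<lambda>x::'e. x) = (\<lambda>x. x)"
    by (rule ext, rule inv_into_f_eq) auto
  ultimately have "smooth_map euclidean_atlas B E.E"
    using E.continuous_E E.E_closed
    by (auto simp: smooth_map_def euclidean_atlas_def mcarrier_def[of "{_}"] carrier_eq[symmetric] comp_def)
  moreover have "inv_into (carrier G) T = E.E"
    by (rule ext, rule inv_into_f_eq) (auto simp: TE E.E_closed intro: inj_on_inverseI[of _ E.E] ET)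
  ultimately have "smooth_map euclidean_atlas B (inv_into (carrier G) T)" by simp
  with comm smooth_T \<open>T \<in> iso G additive_group\<close> show ?thesis
    by (auto simp: lie_group_isomorphic_def)
qed

section \<open>The model group of a Walker foliation\<close>

text \<open>The torsion vanishes, and so do both covariant derivatives of parallel fields in it.\<close>

lemma parallel_basis_commutes:
  assumes "levi_civita_connection A g nabla" "open U" "U \<subseteq> mcarrier A"
    and "parallel_basis A nabla r D U X" and "i < r" "j < r" "p \<in> U"
  shows "lie_bracket A (X i) (X j) p = (\<lambda>f. 0)"
proof -
  have X: "smooth_vfield A U (X i)" "smooth_vfield A U (X j)"
    using assms(4-6) by (auto simp: parallel_basis_def smooth_section_def)
  have "nabla (X i) (X j) p = (\<lambda>f. 0)" "nabla (X j) (X i) p = (\<lambda>f. 0)"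
    using assms(4-7) X by (simp_all add: parallel_basis_def)
  moreover have "(\<lambda>h. nabla (X i) (X j) p h - nabla (X j) (X i) p h) = lie_bracket A (X i) (X j) p"
    using assms(1-3,7) X by (simp add: levi_civita_connection_def)
  ultimately show ?thesis by simp
qed

theorem corollary3p6:
  fixes A :: "('a::{t2_space, second_countable_topology}, real ^ 'n) atlas"
    and g :: "'a \<Rightarrow> 'a tvec \<Rightarrow> 'a tvec \<Rightarrow> real"
    and nabla :: "'a vfield \<Rightarrow> 'a vfield \<Rightarrow> 'a vfield"
    and D :: "'a \<Rightarrow> 'a tvec set"
    and r :: nat
    and U :: "'a set"
    and X :: "nat \<Rightarrow> 'a vfield"
    and G :: "('g::{t2_space, second_countable_topology}, 'x) monoid_scheme"
    and B :: "('g, real ^ 'r) atlas"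
  assumes "walker_manifold A g nabla r D"
    and "CARD('r) = r"
    and "open U" and "U \<noteq> {}" and "U \<subseteq> mcarrier A"
    and "parallel_basis A nabla r D U X"
    and "model_group A r U X G B"
  shows "((comm_group G \<and>
           lie_group_isomorphic G B (additive_group :: (real ^ 'r) monoid) euclidean_atlas)
            \<longleftrightarrow> (\<forall>i<r. \<forall>j<r. \<forall>p\<in>U. lie_bracket A (X i) (X j) p = (\<lambda>f. 0)))
       \<and> ((\<forall>i<r. \<forall>j<r. \<forall>p\<in>U. lie_bracket A (X i) (X j) p = (\<lambda>f. 0))
            \<longleftrightarrow> abelian_lie_algebra (structure_algebra A r U X))
       \<and> (r = 1 \<longrightarrow>
           comm_group G \<and>
           lie_group_isomorphic G B (additive_group :: (real ^ 'r) monoid) euclidean_atlas \<and>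
           (\<forall>i<r. \<forall>j<r. \<forall>p\<in>U. lie_bracket A (X i) (X j) p = (\<lambda>f. 0)) \<and>
           abelian_lie_algebra (structure_algebra A r U X))
       \<and> (CARD('n) = 3 \<longrightarrow>
           r = 1 \<and>
           comm_group G \<and>
           lie_group_isomorphic G B (additive_group :: (real ^ 'r) monoid) euclidean_atlas \<and>
           (\<forall>i<r. \<forall>j<r. \<forall>p\<in>U. lie_bracket A (X i) (X j) p = (\<lambda>f. 0)) \<and>
           abelian_lie_algebra (structure_algebra A r U X))"
proof -
  have walker: "smooth_atlas A" "levi_civita_connection A g nabla" "1 \<le> r" "2 * r \<le> CARD('n)"
    using assms(1) by (simp_all add: walker_manifold_def)
  have model: "lie_group G B" "simply_connected (carrier G)"
    "lie_algebra_isomorphic (lie_algebra_of G B) (structure_algebra A r U X)"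
    using assms(7) by (simp_all add: model_group_def)
  have commute: "\<forall>i<r. \<forall>j<r. \<forall>p\<in>U. lie_bracket A (X i) (X j) p = (\<lambda>f. 0)"
    using parallel_basis_commutes[OF walker(2) assms(3,5,6)] by blast
  have X: "smooth_vfield A U (X i)" if "i < r" for i
    using assms(6) that by (auto simp: parallel_basis_def smooth_section_def)
  have abelian: "abelian_lie_algebra (structure_algebra A r U X)"
    by (rule abelian_structure_algebra[OF smooth_atlas_imp_topological_atlas[OF walker(1)] assms(3,5) X])
      (use commute in auto)
  have group: "group G" using model(1) by (simp add: lie_group_def)
  interpret real_lie_group G B
    by (rule real_lie_group.intro[OF group]) (unfold_locales, rule model(1))
  obtain U0 \<phi> where U0: "(U0, \<phi>) \<in> B" "\<one>\<^bsub>G\<^esub> \<in> U0"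
    using chart_exists[OF one_closed] by blast
  interpret lie_group_chart G B U0 \<phi> by unfold_locales (fact U0)+
  have "abelian_lie_algebra (lie_algebra_of G B)"
    using abelian_lie_algebra_transfer[OF model(3)[unfolded structure_algebra_def]
        abelian[unfolded structure_algebra_def]] .
  from abelian_simply_connected_iso[OF this model(2)]
  have iso: "comm_group G" "lie_group_isomorphic G B (additive_group :: (real ^ 'r) monoid) euclidean_atlas"
    by simp_all
  have "r = 1" if "CARD('n) = 3" using walker(3,4) that by simp
  then show ?thesis using iso commute abelian by blast
qed

end
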